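(* Let $\mathbf m$ be an arbitrary probability measure on $(\mathbb R^2,\mathscr B(\mathbb R^2))$ such that $\mathbf m((0,\infty)\times\mathbb R)=1$. Then there exist a filtered probability space $(\Omega,\mathcal F,\mathbb F,\mathbb P)$, a pair $[(x(t),y(t)),\,t\ge 0]$ of continuous $\mathbb F$-adapted real processes and an $\mathbb F$-Wiener process $W$ such that $(x(0),y(0))\sim\mathbf m$ and, $\mathbb P$-a.s., for all $t\ge 0$: \[ x(t)>0,\qquad x(t)=x(0)+\int_0^t y(s)\,ds, \] \[ y(t)=y(0)+\delta\int_0^t\frac{ds}{x(s)^3}-\gamma\int_0^t\frac{y(s)\,ds}{x(s)^4}+\sqrt{2D}\int_0^t\frac{dW(s)}{x(s)^2}. \]
   Context: Fix real constants $\delta\in\mathbb R$, $\gamma>0$, $D>0$. A Wiener process is a standard one-dimensional Brownian motion; the stochastic integral is the Itô integral. *)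

theory Defs
  imports "HOL-Probability.Probability"
begin

text \<open>Filtered probability space: M a probability space, F a filtration (indexed by real
  time; only t \<ge> 0 is relevant) of sub-sigma-algebras of M.\<close>
definition filtered_prob_space :: "'a measure \<Rightarrow> (real \<Rightarrow> 'a measure) \<Rightarrow> bool" where
  "filtered_prob_space M F \<longleftrightarrow>
     prob_space M \<and> filtration (space M) F \<and> (\<forall>t. sets (F t) \<subseteq> sets M)"

definition adapted_process :: "(real \<Rightarrow> 'a measure) \<Rightarrow> (real \<Rightarrow> 'a \<Rightarrow> real) \<Rightarrow> bool" where
  "adapted_process F X \<longleftrightarrow> (\<forall>t\<ge>0. X t \<in> borel_measurable (F t))"

definition continuous_process :: "'a measure \<Rightarrow> (real \<Rightarrow> 'a \<Rightarrow> real) \<Rightarrow> bool" where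
  "continuous_process M X \<longleftrightarrow> (\<forall>\<omega>\<in>space M. continuous_on {0..} (\<lambda>t. X t \<omega>))"

definition wiener_process :: "'a measure \<Rightarrow> (real \<Rightarrow> 'a measure) \<Rightarrow> (real \<Rightarrow> 'a \<Rightarrow> real) \<Rightarrow> bool" where
  "wiener_process M F W \<longleftrightarrow>
     adapted_process F W \<and> continuous_process M W \<and> (AE \<omega> in M. W 0 \<omega> = 0) \<and>
     (\<forall>s t. 0 \<le> s \<longrightarrow> s < t \<longrightarrow>
        distributed M lborel (\<lambda>\<omega>. W t \<omega> - W s \<omega>) (normal_density 0 (sqrt (t - s))) \<and>
        (\<forall>A\<in>sets (F s). \<forall>B\<in>sets borel.
           measure M (A \<inter> ((\<lambda>\<omega>. W t \<omega> - W s \<omega>) -` B \<inter> space M)) =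
           measure M A * measure M ((\<lambda>\<omega>. W t \<omega> - W s \<omega>) -` B \<inter> space M)))"

definition ito_sum :: "(real \<Rightarrow> 'a \<Rightarrow> real) \<Rightarrow> (real \<Rightarrow> 'a \<Rightarrow> real) \<Rightarrow> real \<Rightarrow> nat \<Rightarrow> 'a \<Rightarrow> real" where
  "ito_sum H W t n \<omega> =
     (\<Sum>k<2^n. H (real k * t / 2^n) \<omega> *
                (W (real (Suc k) * t / 2^n) \<omega> - W (real k * t / 2^n) \<omega>))"

text \<open>I is (a continuous version of) the Ito integral process t \<mapsto> int_0^t H dW, for a
  continuous adapted integrand H: for every t \<ge> 0, I(t) is the limit in probability of the
  left-point Riemann sums along partitions with mesh tending to 0.\<close>
definition ito_integral_process ::
  "'a measure \<Rightarrow> (real \<Rightarrow> 'a \<Rightarrow> real) \<Rightarrow> (real \<Rightarrow> 'a \<Rightarrow> real) \<Rightarrow> (real \<Rightarrow> 'a \<Rightarrow> real) \<Rightarrow> bool" where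
  "ito_integral_process M H W I \<longleftrightarrow>
     continuous_process M I \<and>
     (\<forall>t\<ge>0. I t \<in> borel_measurable M \<and>
        (\<forall>e>0. (\<lambda>n. measure M {\<omega>\<in>space M. \<bar>ito_sum H W t n \<omega> - I t \<omega>\<bar> > e}) \<longlonglongrightarrow> 0))"

end

theory Submission
  imports Defs
begin

text \<open>The equation is solved separately for every continuous path \<open>w\<close> of the noise. Put
  \<open>c = sqrt (2 * D)\<close>. As \<open>x\<close> is continuously differentiable, integration by parts turns the
  Ito integral into \<open>w / x\<^sup>2\<close> minus its value at 0 plus the Lebesgue integral of \<open>2 * w * y / x ^ 3\<close>,
  and the dissipation \<open>- \<gamma> * y / x ^ 4\<close> is the derivative of \<open>\<gamma> / 3 / x ^ 3\<close>. Hence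
  \<open>v = y - \<gamma> / 3 / x ^ 3 - c * w / x\<^sup>2\<close> satisfies together with \<open>x\<close> an ordinary differential
  equation that is locally Lipschitz on \<open>x > 0\<close>. It does not explode: the quantity
  \<open>q = x\<^sup>2 * y - \<gamma> / x - c * w\<close> has derivative \<open>2 * x * y\<^sup>2 + \<delta> / x\<close>, and at a running minimum of
  \<open>x\<close> we have \<open>y \<le> 0\<close>, so \<open>\<gamma> / x \<le> - q - c * w\<close>; Gronwall's inequality bounds \<open>1 / x\<close>, and then
  \<open>v\<close>, whose equation is linear. Adaptedness holds because the solution is a pointwise limit of
  Picard iterates, which are themselves limits of Riemann sums of the past of the path.

  Brownian motion comes from Kolmogorov's extension theorem on the dyadic times (the laws of the
  partial sums of i.i.d. Gaussian variables are consistent under refinement of the grid), and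
  from a fourth-moment bound with the Borel--Cantelli lemma for continuity.\<close>

section \<open>Dyadic approximation of paths\<close>

text \<open>The noise coefficient \<open>1 / x^2\<close> involves the position only, and the
  position is differentiable; this is why no correction term arises and the equation makes sense
  along each continuous path. The quantity \<open>q\<close> comes from multiplying the velocity
  equation by \<open>x^2\<close>: the noise becomes additive, the friction becomes the exact
  derivative of \<open>\<gamma> / x\<close>, and the term \<open>2 * x * y^2\<close> left over from
  differentiating \<open>x^2 * y\<close> has the favourable sign, so \<open>1 / x\<close> is bounded
  before anything is known about \<open>y\<close>. The obstacle is that the field is neither bounded
  nor globally Lipschitz, and that the region visited depends on the path. It is replaced by fields
  truncated at level \<open>n\<close>, whose solutions exist on the half-line for every path; the a
  priori bounds show that on each finite interval the sequence in \<open>n\<close> is eventually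
  constant. The solution is a limit over levels that are the same for all paths, so measurability
  survives without stopping times. The initial pair is carried by the same random walk as the noise,
  which makes it independent of the increments of \<open>W\<close> by construction.\<close>

lemma geometric_Cauchy:
  fixes a :: "nat \<Rightarrow> 'a::banach"
  assumes step: "\<And>n. n \<ge> N \<Longrightarrow> norm (a (Suc n) - a n) \<le> C * q ^ n" and q: "0 \<le> q" "q < 1"
  shows geometric_Cauchy_convergent: "convergent a"
    and geometric_Cauchy_bound: "n \<ge> N \<Longrightarrow> norm (lim a - a n) \<le> C * q ^ n / (1 - q)"
proof -
  have *: "a \<longlonglongrightarrow> a n + (\<Sum>i. a (Suc (n + i)) - a (n + i)) \<and>
      norm (\<Sum>i. a (Suc (n + i)) - a (n + i)) \<le> C * q ^ n / (1 - q)" if "n \<ge> N" for n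
  proof -
    let ?d = "\<lambda>i. a (Suc (n + i)) - a (n + i)"
    have g: "(\<lambda>i. C * q ^ n * q ^ i) sums (C * q ^ n * (1 / (1 - q)))"
      using q by (intro sums_mult geometric_sums) auto
    have d: "norm (?d i) \<le> C * q ^ n * q ^ i" for i
      using step[of "n + i"] that by (simp add: power_add mult.assoc)
    have s: "summable (\<lambda>i. norm (?d i))"
      by (rule summable_comparison_test[OF _ sums_summable[OF g]]) (use d in auto)
    have "norm (suminf ?d) \<le> (\<Sum>i. norm (?d i))" by (rule summable_norm[OF s])
    also have "\<dots> \<le> (\<Sum>i. C * q ^ n * q ^ i)"
      by (rule suminf_le[OF d s sums_summable[OF g]])
    also have "\<dots> = C * q ^ n / (1 - q)" using sums_unique[OF g] by simp
    finally have bnd: "norm (suminf ?d) \<le> C * q ^ n / (1 - q)" .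
    have "(\<Sum>i<k. ?d i) = a (n + k) - a n" for k
      using sum_lessThan_telescope[of "\<lambda>i. a (n + i)" k] by simp
    then have "(\<lambda>k. a (n + k) - a n) \<longlonglongrightarrow> suminf ?d"
      using summable_LIMSEQ[OF summable_norm_cancel[OF s]] by simp
    from tendsto_add[OF tendsto_const[of "a n"] this]
    have "(\<lambda>k. a (k + n)) \<longlonglongrightarrow> a n + suminf ?d" by (simp add: add.commute)
    with bnd show ?thesis by (simp add: LIMSEQ_offset)
  qed
  from *[of N] show "convergent a" by (auto simp: convergent_def)
  assume "n \<ge> N"
  from *[OF this] show "norm (lim a - a n) \<le> C * q ^ n / (1 - q)"
    using limI[of a "a n + (\<Sum>i. a (Suc (n + i)) - a (n + i))"] by simp
qed

lemma nat_floor_less: "0 \<le> x \<Longrightarrow> x < real N \<Longrightarrow> nat \<lfloor>x\<rfloor> < N"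
  by linarith

definition grid_floor :: "nat \<Rightarrow> real \<Rightarrow> real" where
  "grid_floor n t = real (nat \<lfloor>t * 2 ^ n\<rfloor>) / 2 ^ n"

lemma grid_floor_le: "0 \<le> t \<Longrightarrow> grid_floor n t \<le> t"
  by (simp add: grid_floor_def divide_le_eq)

lemma grid_floor_ge: "0 \<le> t \<Longrightarrow> t - 1 / 2 ^ n < grid_floor n t"
proof -
  assume "0 \<le> t"
  then have "t * 2 ^ n - 1 < real (nat \<lfloor>t * 2 ^ n\<rfloor>)"
    using floor_correct[of "t * 2 ^ n"] by simp
  then have "t < (real (nat \<lfloor>t * 2 ^ n\<rfloor>) + 1) / 2 ^ n"
    by (simp add: less_divide_eq)
  then show ?thesis by (simp add: grid_floor_def add_divide_distrib)
qed

lemma grid_floor_tendsto: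
  assumes "0 \<le> t"
  shows "(\<lambda>n. grid_floor n t) \<longlonglongrightarrow> t"
proof (rule tendsto_sandwich)
  have "(\<lambda>n. t - (1 / 2) ^ n) \<longlonglongrightarrow> t - 0"
    by (intro tendsto_intros LIMSEQ_realpow_zero) auto
  then show "(\<lambda>n. t - 1 / 2 ^ n) \<longlonglongrightarrow> t" by (simp add: power_one_over)
  show "\<forall>\<^sub>F n in sequentially. t - 1 / 2 ^ n \<le> grid_floor n t"
    using grid_floor_ge[OF assms] by (simp add: less_imp_le)
  show "\<forall>\<^sub>F n in sequentially. grid_floor n t \<le> t"
    using grid_floor_le[OF assms] by simp
qed simp

text \<open>A regularity condition on dyadic values alone, hence a measurable event. The time
  horizon \<open>j\<close> grows with the level, so that one condition covers the whole half-line.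
  The ratio \<open>9 / 10\<close> is a choice: fourth moments of Gaussian increments allow any ratio
  below 1 whose fourth power exceeds \<open>1 / 2\<close>.\<close>

definition tame :: "(real \<Rightarrow> real) \<Rightarrow> bool" where
  "tame X \<longleftrightarrow> (\<exists>j0. \<forall>j\<ge>j0. \<forall>k<j * 2 ^ j. \<bar>X (real (Suc k) / 2 ^ j) - X (real k / 2 ^ j)\<bar> \<le> (9 / 10) ^ j)"

definition grid_lim :: "(real \<Rightarrow> real) \<Rightarrow> real \<Rightarrow> real" where
  "grid_lim X t = lim (\<lambda>n. X (grid_floor n t))"

lemma floor_double:
  assumes "0 \<le> (x::real)"
  shows "nat \<lfloor>2 * x\<rfloor> = 2 * nat \<lfloor>x\<rfloor> \<or> nat \<lfloor>2 * x\<rfloor> = Suc (2 * nat \<lfloor>x\<rfloor>)"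
proof -
  have "\<lfloor>2 * x\<rfloor> = 2 * \<lfloor>x\<rfloor> \<or> \<lfloor>2 * x\<rfloor> = 2 * \<lfloor>x\<rfloor> + 1" by linarith
  then show ?thesis using assms by (auto simp: nat_mult_distrib nat_add_distrib)
qed

text \<open>Refining the grid once either keeps the grid point below \<open>t\<close> or moves it
  across one cell of the finer level, at a cost of at most \<open>(9/10) ^ Suc n\<close>. The
  geometric tail of these costs sums to \<open>9 * (9/10) ^ n\<close>. The condition
  \<open>t < real n\<close> places the cell within the horizon of \<open>tame\<close>.\<close>

lemma tame_grid_lim:
  assumes "tame X"
  obtains j0 where "\<And>t n. 0 \<le> t \<Longrightarrow> t < real n \<Longrightarrow> n \<ge> j0 \<Longrightarrow> \<bar>grid_lim X t - X (grid_floor n t)\<bar> \<le> 9 * (9/10) ^ n"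
    and "\<And>t. 0 \<le> t \<Longrightarrow> (\<lambda>n. X (grid_floor n t)) \<longlonglongrightarrow> grid_lim X t"
    and "\<And>j k. j \<ge> j0 \<Longrightarrow> k < j * 2 ^ j \<Longrightarrow> \<bar>X (real (Suc k) / 2 ^ j) - X (real k / 2 ^ j)\<bar> \<le> (9 / 10) ^ j"
proof -
  from assms obtain j0 where j0: "\<And>j k. j \<ge> j0 \<Longrightarrow> k < j * 2 ^ j \<Longrightarrow>
      \<bar>X (real (Suc k) / 2 ^ j) - X (real k / 2 ^ j)\<bar> \<le> (9 / 10) ^ j"
    unfolding tame_def by blast
  have step: "norm (X (grid_floor (Suc n) t) - X (grid_floor n t)) \<le> 9 / 10 * (9 / 10) ^ n"
    if t: "0 \<le> t" "t < real n" and n: "n \<ge> j0" for n t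
  proof -
    define k where "k = nat \<lfloor>t * 2 ^ n\<rfloor>"
    have "k < n * 2 ^ n"
      unfolding k_def using t by (intro nat_floor_less) auto
    also have "n * 2 ^ n \<le> Suc n * 2 ^ n" by simp
    finally have k: "2 * k < Suc n * 2 ^ Suc n" by (simp only: power_Suc)
    have g: "grid_floor n t = real (2 * k) / 2 ^ Suc n" by (simp add: grid_floor_def k_def)
    have "nat \<lfloor>t * 2 ^ Suc n\<rfloor> = 2 * k \<or> nat \<lfloor>t * 2 ^ Suc n\<rfloor> = Suc (2 * k)"
      using floor_double[of "t * 2 ^ n"] t unfolding k_def by (simp add: mult.left_commute)
    then have "X (grid_floor (Suc n) t) = X (grid_floor n t) \<or>
        grid_floor (Suc n) t = real (Suc (2 * k)) / 2 ^ Suc n"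
      unfolding g by (auto simp: grid_floor_def)
    then show ?thesis
    proof
      assume "grid_floor (Suc n) t = real (Suc (2 * k)) / 2 ^ Suc n"
      then show ?thesis using j0[of "Suc n" "2 * k"] n k unfolding g by simp
    qed simp
  qed
  have b: "\<bar>grid_lim X t - X (grid_floor n t)\<bar> \<le> 9 * (9/10) ^ n" if "0 \<le> t" "t < real n" "n \<ge> j0" for t n
    using geometric_Cauchy_bound[of n "\<lambda>n. X (grid_floor n t)" "9/10" "9/10" n] step[of t] that
    by (simp add: grid_lim_def)
  have c: "(\<lambda>n. X (grid_floor n t)) \<longlonglongrightarrow> grid_lim X t" if "0 \<le> t" for t
  proof -
    define N where "N = max j0 (nat \<lceil>t + 1\<rceil>)"
    have N: "t < real n" "j0 \<le> n" if "n \<ge> N" for n using that unfolding N_def by linarith+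
    have "convergent (\<lambda>n. X (grid_floor n t))"
      by (rule geometric_Cauchy_convergent[of N _ "9/10" "9/10"]) (use step \<open>0 \<le> t\<close> N in auto)
    then show ?thesis by (simp add: grid_lim_def convergent_LIMSEQ_iff)
  qed
  show ?thesis by (rule that[OF b c j0])
qed

text \<open>Two points closer than one mesh width have equal or adjacent grid points. Comparing each
  limit with its grid value costs 9 units of \<open>(9/10) ^ n\<close>, and crossing between the
  grid points costs one more, which is the origin of the factor 19.\<close>

lemma tame_continuous:
  assumes "tame X"
  shows "continuous_on {0..} (grid_lim X)"
  unfolding continuous_on_iff
proof (intro ballI allI impI)
  fix t e :: real assume t: "t \<in> {0..}" and e: "0 < e"
  from assms obtain j0 where
    b: "\<And>t n. 0 \<le> t \<Longrightarrow> t < real n \<Longrightarrow> n \<ge> j0 \<Longrightarrow> \<bar>grid_lim X t - X (grid_floor n t)\<bar> \<le> 9 * (9/10) ^ n"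
    and i: "\<And>j k. j \<ge> j0 \<Longrightarrow> k < j * 2 ^ j \<Longrightarrow> \<bar>X (real (Suc k) / 2 ^ j) - X (real k / 2 ^ j)\<bar> \<le> (9 / 10) ^ j"
    by (rule tame_grid_lim) (rule that)
  have "(\<lambda>n. 19 * (9/10::real) ^ n) \<longlonglongrightarrow> 19 * 0" by (intro tendsto_intros LIMSEQ_realpow_zero) auto
  then have "eventually (\<lambda>n. 19 * (9/10::real) ^ n < e) sequentially"
    using e order_tendstoD(2)[of _ "19 * 0" sequentially e] by simp
  then obtain n1 where n1: "\<And>n. n \<ge> n1 \<Longrightarrow> 19 * (9/10::real) ^ n < e"
    by (auto simp: eventually_sequentially)
  \<comment> \<open>The margin 2 keeps every point at distance less than 1 from \<open>t\<close>
    below \<open>n\<close>, where the tame estimates apply.\<close>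
  define n where "n = max (max n1 j0) (nat \<lceil>t + 2\<rceil>)"
  have n: "n1 \<le> n" "j0 \<le> n" "t + 2 \<le> real n" unfolding n_def by linarith+
  have adj: "\<bar>X (grid_floor n r) - X (grid_floor n s)\<bar> \<le> (9/10) ^ n"
    if "0 \<le> s" "s \<le> r" "r < s + 1 / 2 ^ n" "r < real n" for r s
  proof -
    have "r * 2 ^ n < s * 2 ^ n + 1" using that(3) by (simp add: field_simps)
    moreover have "s * 2 ^ n \<le> r * 2 ^ n" using that by simp
    ultimately have "\<lfloor>r * 2 ^ n\<rfloor> = \<lfloor>s * 2 ^ n\<rfloor> \<or> \<lfloor>r * 2 ^ n\<rfloor> = \<lfloor>s * 2 ^ n\<rfloor> + 1" by linarith
    moreover have "0 \<le> \<lfloor>s * 2 ^ n\<rfloor>" using that by simp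
    ultimately have "nat \<lfloor>r * 2 ^ n\<rfloor> = nat \<lfloor>s * 2 ^ n\<rfloor> \<or> nat \<lfloor>r * 2 ^ n\<rfloor> = Suc (nat \<lfloor>s * 2 ^ n\<rfloor>)"
      by (auto simp: nat_add_distrib)
    then show ?thesis
    proof
      assume a: "nat \<lfloor>r * 2 ^ n\<rfloor> = Suc (nat \<lfloor>s * 2 ^ n\<rfloor>)"
      have "nat \<lfloor>s * 2 ^ n\<rfloor> < n * 2 ^ n" using that by (intro nat_floor_less) auto
      from i[OF n(2) this] show ?thesis by (simp add: grid_floor_def a)
    qed (simp add: grid_floor_def)
  qed
  have near: "\<bar>grid_lim X r - grid_lim X s\<bar> < e"
    if "0 \<le> s" "s \<le> r" "r < s + 1 / 2 ^ n" "r < real n" for r s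
    using adj[OF that] b[of r n] b[of s n] n1[OF n(1)] that n by linarith
  show "\<exists>d>0. \<forall>t'\<in>{0..}. dist t' t < d \<longrightarrow> dist (grid_lim X t') (grid_lim X t) < e"
  proof (intro exI[of _ "1 / 2 ^ n"] conjI ballI impI)
    fix r :: real assume r: "r \<in> {0..}" "dist r t < 1 / 2 ^ n"
    have "(1::real) / 2 ^ n \<le> 1" by (simp add: field_simps)
    with r(2) have "dist r t < 1" by linarith
    then have "r < real n" "t < real n" using n(3) by (auto simp: dist_real_def)
    then show "dist (grid_lim X r) (grid_lim X t) < e"
      using near[of r t] near[of t r] r t
      by (cases "r \<le> t") (auto simp: dist_real_def abs_minus_commute)
  qed simp
qed

section \<open>Gaussian random walks on dyadic grids\<close>

text \<open>The walk lives in \<open>real \<times> (real \<times> real)\<close>: step 0 carries the initial pair in the last two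
  coordinates, the later steps are the noise increments over the mesh \<open>1 / 2 ^ j\<close> in the first.\<close>
definition incr_law :: "(real \<times> real) measure \<Rightarrow> nat \<Rightarrow> nat \<Rightarrow> (real \<times> real \<times> real) measure" where
  "incr_law m j k =
     (if k = 0 then distr m borel (\<lambda>p. (0, p))
      else distr (density lborel (normal_density 0 (sqrt (1 / 2 ^ j)))) borel (\<lambda>z. (z, 0)))"

definition walk_law :: "(real \<times> real) measure \<Rightarrow> nat \<Rightarrow> (nat \<Rightarrow> real \<times> real \<times> real) measure" where
  "walk_law m j = (\<Pi>\<^sub>M k\<in>UNIV. incr_law m j k)"

text \<open>Passes from the increments of a fine grid to those of the grid with twice the mesh. Step
  0 is the initial datum and is left alone, so the coarse step \<open>k\<close> with
  \<open>k > 0\<close> merges the fine steps \<open>2 * k - 1\<close> and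
  \<open>2 * k\<close>.\<close>

definition halve :: "(nat \<Rightarrow> real \<times> real \<times> real) \<Rightarrow> nat \<Rightarrow> real \<times> real \<times> real" where
  "halve \<omega> k = (if k = 0 then \<omega> 0 else \<omega> (2 * k - 1) + \<omega> (2 * k))"

text \<open>The sum includes step 0: the first coordinate is the noise at time
  \<open>k / 2 ^ j\<close>, while the last two keep the initial pair.\<close>

definition walk :: "nat \<Rightarrow> (nat \<Rightarrow> real \<times> real \<times> real) \<Rightarrow> real \<times> real \<times> real" where
  "walk k \<omega> = (\<Sum>i\<le>k. \<omega> i)"

lemma walk_halve: "walk k (halve \<omega>) = walk (2 * k) \<omega>"
  by (induction k) (auto simp: walk_def halve_def add.assoc)

lemma measurable_fst_borel [measurable]:
  "(fst :: 'a::second_countable_topology \<times> 'b::second_countable_topology \<Rightarrow> 'a) \<in> borel_measurable borel"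
  by (intro borel_measurable_continuous_onI continuous_intros)

lemma measurable_snd_borel [measurable]:
  "(snd :: 'a::second_countable_topology \<times> 'b::second_countable_topology \<Rightarrow> 'b) \<in> borel_measurable borel"
  by (intro borel_measurable_continuous_onI continuous_intros)

lemma sets_incr_law [simp, measurable_cong]: "sets (incr_law m j k) = sets borel"
  by (simp add: incr_law_def)

lemma space_incr_law [simp]: "space (incr_law m j k) = UNIV"
  by (simp add: incr_law_def)

lemma sets_walk_law [simp, measurable_cong]: "sets (walk_law m j) = sets (\<Pi>\<^sub>M k\<in>UNIV. borel)"
  unfolding walk_law_def by (rule sets_PiM_cong) auto

lemma space_walk_law [simp]: "space (walk_law m j) = UNIV"
  unfolding walk_law_def by (simp add: space_PiM)

lemma measurable_walk [measurable]: "walk k \<in> borel_measurable (\<Pi>\<^sub>M k\<in>UNIV. borel)"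
  unfolding walk_def by measurable

locale walk_init =
  fixes m :: "(real \<times> real) measure"
  assumes prob_m: "prob_space m" and sets_m: "sets m = sets borel"
begin

lemma prob_incr_law: "prob_space (incr_law m j k)"
  unfolding incr_law_def using prob_m prob_space_normal_density[of "sqrt (1 / 2 ^ j)" 0] sets_m
  by (auto intro!: prob_space.prob_space_distr cong: measurable_cong_sets)

sublocale walk_law: prob_space "walk_law m j" for j
  unfolding walk_law_def by (intro prob_space_PiM prob_incr_law)

lemma distr_component: "distr (walk_law m j) borel (\<lambda>\<omega>. \<omega> k) = incr_law m j k"
proof -
  interpret product_prob_space "incr_law m j" UNIV
    by (intro product_prob_spaceI prob_incr_law)
  have "distr (walk_law m j) (incr_law m j k) (\<lambda>\<omega>. \<omega> k) = incr_law m j k"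
    unfolding walk_law_def by (rule PiM_component) auto
  also have "distr (walk_law m j) (incr_law m j k) (\<lambda>\<omega>. \<omega> k) = distr (walk_law m j) borel (\<lambda>\<omega>. \<omega> k)"
    by (rule distr_cong) auto
  finally show ?thesis .
qed

lemma indep_components: "walk_law.indep_vars j (\<lambda>_. borel) (\<lambda>k \<omega>. \<omega> k) UNIV"
proof (subst walk_law.indep_vars_iff_distr_eq_PiM)
  show "distr (walk_law m j) (\<Pi>\<^sub>M i\<in>UNIV. borel) (\<lambda>x. \<lambda>i\<in>UNIV. x i) =
        (\<Pi>\<^sub>M i\<in>UNIV. distr (walk_law m j) borel (\<lambda>\<omega>. \<omega> i))"
    unfolding distr_component
    by (simp add: walk_law_def[symmetric] restrict_UNIV distr_id2)
qed auto

lemma distr_fst_component: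
  assumes "k \<noteq> 0"
  shows "distributed (walk_law m j) lborel (\<lambda>\<omega>. fst (\<omega> k)) (normal_density 0 (sqrt (1 / 2 ^ j)))"
proof -
  have "distr (walk_law m j) lborel (\<lambda>\<omega>. fst (\<omega> k)) =
        distr (distr (walk_law m j) borel (\<lambda>\<omega>. \<omega> k)) lborel fst"
    by (subst distr_distr) (auto simp: comp_def)
  also have "\<dots> = density lborel (normal_density 0 (sqrt (1 / 2 ^ j)))"
    unfolding distr_component using assms
    apply (simp add: incr_law_def)
    apply (subst distr_distr)
    apply (auto simp: comp_def distr_id2)
    done
  finally show ?thesis by (simp add: distributed_def)
qed

lemma distributed_incr:
  assumes "a < b"
  shows "distributed (walk_law m j) lborel (\<lambda>\<omega>. \<Sum>i=Suc a..b. fst (\<omega> i))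
           (normal_density 0 (sqrt (real (b - a) / 2 ^ j)))"
proof -
  have "walk_law.indep_vars j (\<lambda>_. borel) (\<lambda>k \<omega>. fst (\<omega> k)) UNIV"
    using walk_law.indep_vars_compose2[OF indep_components, of "\<lambda>_. fst" "\<lambda>_. borel"]
    by simp
  then have "walk_law.indep_vars j (\<lambda>_. borel) (\<lambda>k \<omega>. fst (\<omega> k)) {Suc a..b}"
    by (rule walk_law.indep_vars_subset) auto
  from walk_law.sum_indep_normal[OF _ _ this, of "\<lambda>_. sqrt (1 / 2 ^ j)" "\<lambda>_. 0"] assms
  show ?thesis using distr_fst_component by (simp add: Suc_diff_Suc)
qed

text \<open>Consistency of the walks under refinement. A product measure is determined by
  independence and its marginals: the halved steps use disjoint blocks of independent steps, and the
  sum of two independent normals of variance \<open>1 / 2 ^ Suc j\<close> is normal with variance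
  \<open>1 / 2 ^ j\<close>.\<close>

lemma distr_halve: "distr (walk_law m (Suc j)) (\<Pi>\<^sub>M k\<in>UNIV. borel) halve = walk_law m j"
proof -
  define K :: "nat \<Rightarrow> nat set" where "K k = (if k = 0 then {0} else {2 * k - 1, 2 * k})" for k
  have [measurable]: "(\<lambda>\<omega>. halve \<omega> k) \<in> borel_measurable (\<Pi>\<^sub>M k\<in>UNIV. borel)" for k
    by (cases "k = 0") (auto simp: halve_def)
  define g where "g k f = (\<Sum>i\<in>K k. f i)" for k and f :: "nat \<Rightarrow> real \<times> real \<times> real"
  have g: "g k (restrict \<omega> (K k)) = halve \<omega> k" for k \<omega>
    by (auto simp: g_def K_def halve_def)
  have "disjoint_family_on K UNIV"
    unfolding disjoint_family_on_def K_def by (auto split: if_splits)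
  from walk_law.indep_vars_restrict[OF indep_components _ this, of "Suc j"]
  have "walk_law.indep_vars (Suc j) (\<lambda>k. PiM (K k) (\<lambda>_. borel)) (\<lambda>k \<omega>. restrict (\<lambda>i. \<omega> i) (K k)) UNIV"
    by simp
  then have "walk_law.indep_vars (Suc j) (\<lambda>_. borel) (\<lambda>k \<omega>. g k (restrict (\<lambda>i. \<omega> i) (K k))) UNIV"
    by (rule walk_law.indep_vars_compose2) (auto simp: g_def)
  then have *: "walk_law.indep_vars (Suc j) (\<lambda>_. borel) (\<lambda>k \<omega>. halve \<omega> k) UNIV"
    by (simp add: g)
  have marg: "distr (walk_law m (Suc j)) borel (\<lambda>\<omega>. halve \<omega> k) = incr_law m j k" for k
  proof (cases "k = 0")
    case True
    have "distr (walk_law m (Suc j)) borel (\<lambda>\<omega>. halve \<omega> k) = incr_law m (Suc j) k"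
      using distr_component[of "Suc j" 0] True by (simp add: halve_def)
    then show ?thesis using True by (simp add: incr_law_def)
  next
    case False
    \<comment> \<open>The last two coordinates of a noise step vanish almost surely, so the law of a
      halved step is determined by its first coordinate.\<close>
    have AEz: "AE \<omega> in walk_law m (Suc j). snd (\<omega> i) = 0" if "i \<noteq> 0" for i
    proof -
      have eq: "incr_law m (Suc j) i = distr (density lborel (normal_density 0 (sqrt (1 / 2 ^ Suc j)))) borel (\<lambda>z. (z, 0))"
        using that by (simp add: incr_law_def)
      have "AE x in distr (walk_law m (Suc j)) borel (\<lambda>\<omega>. \<omega> i). snd x = 0"
        unfolding distr_component eq by (subst AE_distr_iff) auto
      then show ?thesis by (subst (asm) AE_distr_iff) auto
    qed
    have ne: "2 * k - 1 \<noteq> 0" "2 * k \<noteq> 0" using False by auto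
    \<comment> \<open>The interval from \<open>Suc (2*k-2)\<close> to \<open>2*k\<close> is the pair
      of merged indices, written in the shape to which \<open>distributed_incr\<close>
      applies.\<close>
    have "AE \<omega> in walk_law m (Suc j). halve \<omega> k = (\<Sum>i=Suc (2*k-2)..2*k. fst (\<omega> i), 0)"
      using AEz[OF ne(1)] AEz[OF ne(2)]
    proof eventually_elim
      case (elim \<omega>)
      have "{Suc (2*k-2)..2*k} = {2*k-1, 2*k}" using False by auto
      then show ?case using False elim by (auto simp: halve_def prod_eq_iff)
    qed
    then have "distr (walk_law m (Suc j)) borel (\<lambda>\<omega>. halve \<omega> k) =
        distr (walk_law m (Suc j)) borel (\<lambda>\<omega>. (\<Sum>i=Suc (2*k-2)..2*k. fst (\<omega> i), 0))"
      by (intro distr_cong_AE) (auto simp: halve_def)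
    also have "\<dots> = distr (distr (walk_law m (Suc j)) lborel (\<lambda>\<omega>. \<Sum>i=Suc (2*k-2)..2*k. fst (\<omega> i))) borel (\<lambda>z. (z, 0))"
      by (subst distr_distr) (auto simp: comp_def)
    also have "distr (walk_law m (Suc j)) lborel (\<lambda>\<omega>. \<Sum>i=Suc (2*k-2)..2*k. fst (\<omega> i)) =
        density lborel (normal_density 0 (sqrt (real (2*k - (2*k-2)) / 2 ^ Suc j)))"
      using False by (intro distributed_distr_eq_density distributed_incr) auto
    also have "real (2*k - (2*k-2)) / 2 ^ Suc j = 1 / 2 ^ j"
      using False by (simp add: of_nat_diff)
    finally show ?thesis using False by (simp add: incr_law_def)
  qed
  have "distr (walk_law m (Suc j)) (\<Pi>\<^sub>M k\<in>UNIV. borel) (\<lambda>\<omega>. \<lambda>k\<in>UNIV. halve \<omega> k) =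
      (\<Pi>\<^sub>M k\<in>UNIV. distr (walk_law m (Suc j)) borel (\<lambda>\<omega>. halve \<omega> k))"
    using * by (subst (asm) walk_law.indep_vars_iff_distr_eq_PiM) auto
  then show ?thesis by (simp only: marg restrict_UNIV walk_law_def[symmetric])
qed

end

section \<open>Consistent laws on finite sets of dyadic times and their Kolmogorov extension\<close>

definition dyadics :: "real set" where
  "dyadics = {real k / 2 ^ j |k j. True}"

definition on_grid :: "nat \<Rightarrow> real set \<Rightarrow> bool" where
  "on_grid j J \<longleftrightarrow> (\<forall>d\<in>J. \<exists>k::nat. d = real k / 2 ^ j)"

lemma on_grid_add: "on_grid j J \<Longrightarrow> on_grid (j + i) J"
  unfolding on_grid_def
proof safe
  fix d assume "\<forall>d\<in>J. \<exists>k. d = real k / 2 ^ j" "d \<in> J"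
  then obtain k where "d = real k / 2 ^ j" by blast
  then have "d = real (k * 2 ^ i) / 2 ^ (j + i)" by (simp add: power_add)
  then show "\<exists>k. d = real k / 2 ^ (j + i)" by blast
qed

lemma on_grid_exists: "finite J \<Longrightarrow> J \<subseteq> dyadics \<Longrightarrow> \<exists>j. on_grid j J"
proof (induction J rule: finite_induct)
  case (insert d J)
  then obtain j where j: "on_grid j J" by blast
  obtain k i where "d = real k / 2 ^ i" using insert.prems by (auto simp: dyadics_def)
  then have "on_grid i {d}" by (auto simp: on_grid_def)
  then have "on_grid (i + j) {d}" "on_grid (i + j) J"
    using on_grid_add[of i "{d}" j] on_grid_add[OF j, of i] by (auto simp: add.commute)
  then show ?case by (intro exI[of _ "i + j"]) (auto simp: on_grid_def)
qed (auto simp: on_grid_def)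

context walk_init
begin

definition path_law :: "nat \<Rightarrow> real set \<Rightarrow> (real \<Rightarrow> real \<times> real \<times> real) measure" where
  "path_law j J =
     distr (walk_law m j) (\<Pi>\<^sub>M d\<in>J. borel) (\<lambda>\<omega>. \<lambda>d\<in>J. walk (nat \<lfloor>d * 2 ^ j\<rfloor>) \<omega>)"

text \<open>The extension theorem wants a family indexed by the time set alone. The least level is a
  canonical choice; by \<open>fdd_eq\<close> every level whose grid contains \<open>J\<close> gives
  the same law.\<close>

definition fdd :: "real set \<Rightarrow> (real \<Rightarrow> real \<times> real \<times> real) measure" where
  "fdd J = path_law (LEAST j. on_grid j J) J"

text \<open>A point of the coarse grid has twice the index on the fine grid, and by
  \<open>walk_halve\<close> the fine walk at that index is the coarse walk built from the halved
  steps, whose law is given by \<open>distr_halve\<close>.\<close>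

lemma path_law_Suc:
  assumes "on_grid j J"
  shows "path_law (Suc j) J = path_law j J"
proof -
  have [measurable]: "halve \<in> measurable (\<Pi>\<^sub>M k\<in>UNIV. borel) (\<Pi>\<^sub>M k\<in>UNIV. borel)"
  proof -
    have [measurable]: "(\<lambda>\<omega>. halve \<omega> k) \<in> borel_measurable (\<Pi>\<^sub>M k\<in>UNIV. borel)" for k
      by (cases "k = 0") (auto simp: halve_def)
    show ?thesis
      using measurable_restrict[of UNIV "\<lambda>k \<omega>. halve \<omega> k" "\<Pi>\<^sub>M k\<in>UNIV. borel" "\<lambda>_. borel"]
      by (simp add: restrict_UNIV)
  qed
  have "path_law j J = distr (walk_law m (Suc j)) (\<Pi>\<^sub>M d\<in>J. borel)
      (\<lambda>\<omega>. \<lambda>d\<in>J. walk (nat \<lfloor>d * 2 ^ j\<rfloor>) (halve \<omega>))"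
    unfolding path_law_def distr_halve[symmetric, of j]
    by (subst distr_distr) (auto simp: comp_def)
  also have "\<dots> = path_law (Suc j) J"
    unfolding path_law_def
  proof (intro distr_cong refl restrict_ext)
    fix \<omega> d assume "d \<in> J"
    with assms obtain k where "d = real k / 2 ^ j" by (auto simp: on_grid_def)
    then show "walk (nat \<lfloor>d * 2 ^ j\<rfloor>) (halve \<omega>) = walk (nat \<lfloor>d * 2 ^ Suc j\<rfloor>) \<omega>"
      by (simp add: walk_halve nat_mult_distrib[symmetric])
        (metis floor_of_nat nat_int of_nat_mult of_nat_numeral mult.commute)
  qed
  finally show ?thesis by simp
qed

lemma path_law_add: "on_grid j J \<Longrightarrow> path_law (j + i) J = path_law j J"
  by (induction i) (simp_all add: path_law_Suc on_grid_add)

lemma fdd_eq: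
  assumes "on_grid j J"
  shows "fdd J = path_law j J"
proof -
  have "on_grid (LEAST j. on_grid j J) J" "(LEAST j. on_grid j J) \<le> j"
    using assms by (auto intro: LeastI Least_le)
  then show ?thesis
    unfolding fdd_def by (metis path_law_add le_add_diff_inverse)
qed

text \<open>A grid that contains the larger set \<open>H\<close> also contains \<open>J\<close>, so
  both laws are images of one and the same walk and the projection property reduces to composing
  restrictions.\<close>

sublocale path: polish_projective dyadics fdd
proof (intro polish_projective.intro projective_family.intro)
  fix J H :: "real set" assume JH: "J \<subseteq> H" "finite H" "H \<subseteq> dyadics"
  then obtain j where j: "on_grid j H" using on_grid_exists by blast
  then have j': "on_grid j J" using JH by (auto simp: on_grid_def)
  show "fdd J = distr (fdd H) (\<Pi>\<^sub>M d\<in>J. borel) (\<lambda>f. restrict f J)"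
    unfolding fdd_eq[OF j] fdd_eq[OF j'] path_law_def using JH
    by (subst distr_distr)
      (auto simp: comp_def Int_absorb1 intro!: distr_cong measurable_restrict_subset)
next
  fix J :: "real set" assume "finite J" "J \<subseteq> dyadics"
  then obtain j where j: "on_grid j J" using on_grid_exists by blast
  show "prob_space (fdd J)"
    unfolding fdd_eq[OF j] path_law_def by (intro walk_law.prob_space_distr) auto
qed

definition base :: "(real \<Rightarrow> real \<times> real \<times> real) measure" where
  "base = path.lim"

sublocale base: prob_space base
  unfolding base_def by (rule path.P.prob_space_axioms)

lemma sets_base [measurable_cong]: "sets base = sets (\<Pi>\<^sub>M d\<in>dyadics. borel)"
  by (simp add: base_def)

lemma distr_base:
  assumes "finite J" "J \<subseteq> dyadics" "on_grid j J"
  shows "distr base (\<Pi>\<^sub>M d\<in>J. borel) (\<lambda>\<omega>. restrict \<omega> J) = path_law j J"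
proof (rule measure_eqI)
  show "sets (distr base (\<Pi>\<^sub>M d\<in>J. borel) (\<lambda>\<omega>. restrict \<omega> J)) = sets (path_law j J)"
    by (simp add: path_law_def)
next
  fix X assume "X \<in> sets (distr base (\<Pi>\<^sub>M d\<in>J. borel) (\<lambda>\<omega>. restrict \<omega> J))"
  then have X: "X \<in> sets (\<Pi>\<^sub>M d\<in>J. borel)" by simp
  have "emeasure (distr base (\<Pi>\<^sub>M d\<in>J. borel) (\<lambda>\<omega>. restrict \<omega> J)) X =
      emeasure path.lim (prod_emb dyadics (\<lambda>_. borel) J X)"
    using assms X
    by (subst emeasure_distr)
      (auto simp: base_def prod_emb_def space_PiM intro!: measurable_restrict_subset
        cong: measurable_cong_sets)
  also have "\<dots> = emeasure (path_law j J) X"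
    using path.emeasure_lim_emb[OF assms(2,1) X] fdd_eq[OF assms(3)] by simp
  finally show "emeasure (distr base (\<Pi>\<^sub>M d\<in>J. borel) (\<lambda>\<omega>. restrict \<omega> J)) X =
    emeasure (path_law j J) X" .
qed

text \<open>Transfer principle: whatever depends on finitely many values on one grid can be computed
  for a walk with independent steps. Gaussian increments and independence under \<open>base\<close>
  are both obtained from it.\<close>

lemma distr_base_grid:
  assumes [measurable]: "g \<in> measurable (\<Pi>\<^sub>M k\<in>{..n}. borel) N"
  shows "distr base N (\<lambda>\<omega>. g (\<lambda>k\<in>{..n}. \<omega> (real k / 2 ^ j))) =
         distr (walk_law m j) N (\<lambda>\<omega>. g (\<lambda>k\<in>{..n}. walk k \<omega>))"
proof -
  define J where "J = (\<lambda>k. real k / 2 ^ j) ` {..n}"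
  have J: "finite J" "J \<subseteq> dyadics" "on_grid j J"
    by (auto simp: J_def dyadics_def on_grid_def)
  have JI: "real k / 2 ^ j \<in> J" if "k \<le> n" for k using that by (auto simp: J_def)
  have [measurable]: "(\<lambda>f. f (real k / 2 ^ j)) \<in> borel_measurable (\<Pi>\<^sub>M d\<in>J. borel)" if "k \<le> n" for k
    using JI[OF that] by measurable
  have [measurable]: "(\<lambda>f. \<lambda>k\<in>{..n}. f (real k / 2 ^ j)) \<in> measurable (\<Pi>\<^sub>M d\<in>J. borel) (\<Pi>\<^sub>M k\<in>{..n}. borel)"
    by (rule measurable_restrict) auto
  have [measurable]: "(\<lambda>\<omega>. restrict \<omega> J) \<in> measurable base (\<Pi>\<^sub>M d\<in>J. borel)"
    using J by (auto intro!: measurable_restrict_subset cong: measurable_cong_sets simp: sets_base)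
  have "distr base N (\<lambda>\<omega>. g (\<lambda>k\<in>{..n}. \<omega> (real k / 2 ^ j))) =
      distr (distr base (\<Pi>\<^sub>M d\<in>J. borel) (\<lambda>\<omega>. restrict \<omega> J)) N
        (\<lambda>f. g (\<lambda>k\<in>{..n}. f (real k / 2 ^ j)))"
    by (subst distr_distr) (auto simp: comp_def JI cong: restrict_cong)
  also have "\<dots> = distr (walk_law m j) N (\<lambda>\<omega>. g (\<lambda>k\<in>{..n}. walk k \<omega>))"
    unfolding distr_base[OF J] path_law_def
    by (subst distr_distr) (auto simp: comp_def JI cong: restrict_cong)
  finally show ?thesis .
qed

lemma grid_in_dyadics [simp]: "real k / 2 ^ j \<in> dyadics"
  by (auto simp: dyadics_def)

lemma measurable_base_grid [measurable]: "(\<lambda>\<omega>. \<omega> (real k / 2 ^ j)) \<in> borel_measurable base"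
  using measurable_component_singleton[of "real k / 2 ^ j" dyadics "\<lambda>_. borel"]
  by (simp cong: measurable_cong_sets add: sets_base)

lemma distr_base_0: "distr base borel (\<lambda>\<omega>. \<omega> 0) = distr m borel (\<lambda>p. (0, p))"
  using distr_base_grid[of "\<lambda>f. f 0" 0 borel 0] distr_component[of 0 0]
  by (simp add: walk_def incr_law_def)

lemma distr_base_init: "distr base borel (\<lambda>\<omega>. snd (\<omega> 0)) = m"
proof -
  have [measurable]: "(\<lambda>\<omega>. \<omega> 0) \<in> borel_measurable base"
    using measurable_base_grid[of 0 0] by simp
  have "distr base borel (\<lambda>\<omega>. snd (\<omega> 0)) = distr (distr base borel (\<lambda>\<omega>. \<omega> 0)) borel snd"
    by (subst distr_distr) (auto simp: comp_def)
  also have "\<dots> = m"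
    unfolding distr_base_0 using sets_m
    by (subst distr_distr) (auto simp: comp_def distr_id2 cong: measurable_cong_sets)
  finally show ?thesis .
qed

lemma AE_base_0: "AE \<omega> in base. fst (\<omega> 0) = 0"
proof -
  have [measurable]: "(\<lambda>\<omega>. \<omega> 0) \<in> borel_measurable base"
    using measurable_base_grid[of 0 0] by simp
  have "AE x in distr base borel (\<lambda>\<omega>. \<omega> 0). fst x = 0"
    unfolding distr_base_0 using sets_m by (subst AE_distr_iff) (auto cong: measurable_cong_sets)
  then show ?thesis by (subst (asm) AE_distr_iff) auto
qed

lemma walk_diff: "a \<le> b \<Longrightarrow> fst (walk b \<omega>) - fst (walk a \<omega>) = (\<Sum>i=Suc a..b. fst (\<omega> i))"
proof -
  assume "a \<le> b"
  then have "{..b} = {..a} \<union> {Suc a..b}" by auto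
  then have "(\<Sum>i\<le>b. fst (\<omega> i)) = (\<Sum>i\<le>a. fst (\<omega> i)) + (\<Sum>i=Suc a..b. fst (\<omega> i))"
    by (simp add: sum.union_disjoint)
  then show ?thesis by (simp add: walk_def fst_sum)
qed

lemma distributed_grid_incr:
  assumes "a < b"
  shows "distributed base lborel (\<lambda>\<omega>. fst (\<omega> (real b / 2 ^ j)) - fst (\<omega> (real a / 2 ^ j)))
           (normal_density 0 (sqrt (real (b - a) / 2 ^ j)))"
proof -
  have "distr base lborel (\<lambda>\<omega>. fst (\<omega> (real b / 2 ^ j)) - fst (\<omega> (real a / 2 ^ j))) =
      distr (walk_law m j) lborel (\<lambda>\<omega>. fst (walk b \<omega>) - fst (walk a \<omega>))"
    using distr_base_grid[of "\<lambda>f. fst (f b) - fst (f a)" b lborel j] assms by simp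
  also have "\<dots> = density lborel (normal_density 0 (sqrt (real (b - a) / 2 ^ j)))"
    using distributed_incr[OF assms, of j] assms by (simp add: walk_diff distributed_def)
  finally show ?thesis by (simp add: distributed_def)
qed

text \<open>The past up to index \<open>a\<close> and the later increment use disjoint blocks of
  independent steps. Independence is an identity between a joint law and its two marginals, and each
  of these three laws is carried over to \<open>base\<close> by
  \<open>distr_base_grid\<close>.\<close>

lemma indep_grid_incr:
  assumes "a < b" and f [measurable]: "f \<in> borel_measurable (\<Pi>\<^sub>M k\<in>{..a}. borel)"
  shows "base.indep_var borel (\<lambda>\<omega>. f (\<lambda>k\<in>{..a}. \<omega> (real k / 2 ^ j)) :: real)
           borel (\<lambda>\<omega>. fst (\<omega> (real b / 2 ^ j)) - fst (\<omega> (real a / 2 ^ j)))"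
proof -
  have disj: "{..a} \<inter> {Suc a..b} = {}" by auto
  have [measurable]: "(\<lambda>f. \<lambda>k\<in>{..a}. \<Sum>i\<le>k. f i) \<in>
      measurable (\<Pi>\<^sub>M k\<in>{..a}. borel) (\<Pi>\<^sub>M k\<in>{..a}. borel :: (real \<times> real \<times> real) measure)"
    by (rule measurable_restrict) (auto intro!: borel_measurable_sum)
  have "walk_law.indep_var j (\<Pi>\<^sub>M k\<in>{..a}. borel) (\<lambda>\<omega>. restrict \<omega> {..a})
      (\<Pi>\<^sub>M k\<in>{Suc a..b}. borel) (\<lambda>\<omega>. restrict \<omega> {Suc a..b})"
    using walk_law.indep_var_restrict[OF indep_components disj, of j] by simp
  then have "walk_law.indep_var j borel ((\<lambda>h. f (\<lambda>k\<in>{..a}. \<Sum>i\<le>k. h i)) \<circ> (\<lambda>\<omega>. restrict \<omega> {..a}))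
      borel ((\<lambda>f. \<Sum>i=Suc a..b. fst (f i)) \<circ> (\<lambda>\<omega>. restrict \<omega> {Suc a..b}))"
    by (rule walk_law.indep_var_compose) (auto intro!: borel_measurable_sum)
  also have "(\<lambda>h. f (\<lambda>k\<in>{..a}. \<Sum>i\<le>k. h i)) \<circ> (\<lambda>\<omega>. restrict \<omega> {..a}) =
      (\<lambda>\<omega>. f (\<lambda>k\<in>{..a}. walk k \<omega>))"
    by (auto simp: fun_eq_iff walk_def intro!: arg_cong[where f=f] restrict_ext sum.cong)
  also have "(\<lambda>f. \<Sum>i=Suc a..b. fst (f i)) \<circ> (\<lambda>\<omega>. restrict \<omega> {Suc a..b}) =
      (\<lambda>\<omega>. fst (walk b \<omega>) - fst (walk a \<omega>))"
    using assms by (auto simp: fun_eq_iff walk_diff)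
  finally have ind: "walk_law.indep_var j borel (\<lambda>\<omega>. f (\<lambda>k\<in>{..a}. walk k \<omega>))
      borel (\<lambda>\<omega>. fst (walk b \<omega>) - fst (walk a \<omega>))" .
  have R: "restrict (\<lambda>k\<in>{..b}. h k) {..a} = restrict h {..a}" for h :: "nat \<Rightarrow> real \<times> real \<times> real"
    using assms by auto
  have [measurable]: "(\<lambda>h. restrict h {..a}) \<in> measurable (\<Pi>\<^sub>M k\<in>{..b}. borel)
      (\<Pi>\<^sub>M k\<in>{..a}. borel :: (real \<times> real \<times> real) measure)"
    using assms by (intro measurable_restrict_subset) auto
  have e1: "distr base borel (\<lambda>\<omega>. f (\<lambda>k\<in>{..a}. \<omega> (real k / 2 ^ j))) =
      distr (walk_law m j) borel (\<lambda>\<omega>. f (\<lambda>k\<in>{..a}. walk k \<omega>))"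
    using distr_base_grid[of "\<lambda>h. f (restrict h {..a})" b borel j] by (simp only: R) simp
  have e2: "distr base borel (\<lambda>\<omega>. fst (\<omega> (real b / 2 ^ j)) - fst (\<omega> (real a / 2 ^ j))) =
      distr (walk_law m j) borel (\<lambda>\<omega>. fst (walk b \<omega>) - fst (walk a \<omega>))"
    using distr_base_grid[of "\<lambda>f. fst (f b) - fst (f a)" b borel j] assms by simp
  have e3: "distr base (borel \<Otimes>\<^sub>M borel)
        (\<lambda>\<omega>. (f (\<lambda>k\<in>{..a}. \<omega> (real k / 2 ^ j)), fst (\<omega> (real b / 2 ^ j)) - fst (\<omega> (real a / 2 ^ j)))) =
      distr (walk_law m j) (borel \<Otimes>\<^sub>M borel)
        (\<lambda>\<omega>. (f (\<lambda>k\<in>{..a}. walk k \<omega>), fst (walk b \<omega>) - fst (walk a \<omega>)))"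
    using distr_base_grid[of "\<lambda>h. (f (restrict h {..a}), fst (h b) - fst (h a))" b "borel \<Otimes>\<^sub>M borel" j] assms
    by (simp only: R) simp
  show ?thesis
    using ind unfolding walk_law.indep_var_distribution_eq base.indep_var_distribution_eq
    by (simp add: e1 e2 e3)
qed

end

section \<open>Brownian motion\<close>

text \<open>Markov's inequality for the fourth power; the constant is
  \<open>4! / (2! * 2^2) = 3\<close>. Second moments would be too weak later: there are about
  \<open>2 ^ j\<close> increments of variance \<open>1 / 2 ^ j\<close>, so the union bound would not
  be summable.\<close>

lemma (in prob_space) normal_fourth_moment_tail:
  assumes X: "distributed M lborel X (normal_density 0 \<sigma>)" and "0 < \<sigma>" "0 < c"
  shows "prob {\<omega>\<in>space M. c < \<bar>X \<omega>\<bar>} \<le> 3 * \<sigma> ^ 4 / c ^ 4"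
proof -
  have [measurable]: "X \<in> borel_measurable M"
    using X by (simp add: distributed_def)
  have m: "has_bochner_integral lborel (\<lambda>x. normal_density 0 \<sigma> x * x ^ 4) (3 * \<sigma> ^ 4)"
  proof -
    have "fact (2 * 2) / ((2 / \<sigma>\<^sup>2)\<^sup>2 * fact 2) = 3 * \<sigma> ^ 4"
      using \<open>0 < \<sigma>\<close> by (simp add: fact_numeral power_divide field_simps)
    with normal_moment_even[of \<sigma> 0 2] \<open>0 < \<sigma>\<close> show ?thesis by (simp only: diff_zero) simp
  qed
  have i: "integrable M (\<lambda>\<omega>. X \<omega> ^ 4)"
    using distributed_integrable[OF X, of "\<lambda>x. x ^ 4"] m by (auto simp: has_bochner_integral_iff)
  have e: "(\<integral>\<omega>. X \<omega> ^ 4 \<partial>M) = 3 * \<sigma> ^ 4"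
    using distributed_integral[OF X, of "\<lambda>x. x ^ 4"] m by (auto simp: has_bochner_integral_iff)
  have "c ^ 4 \<le> x ^ 4" if "c < \<bar>x\<bar>" for x :: real
    using power_mono[of c "\<bar>x\<bar>" 4] that \<open>0 < c\<close> by (simp add: power_even_abs)
  then have "prob {\<omega>\<in>space M. c < \<bar>X \<omega>\<bar>} \<le> prob {\<omega>\<in>space M. c ^ 4 \<le> X \<omega> ^ 4}"
    by (intro finite_measure_mono) auto
  also have "\<dots> \<le> (1 / c ^ 4) * (\<integral>\<omega>. X \<omega> ^ 4 \<partial>M)"
    using integral_Markov_inequality[OF i, of "c ^ 4"] \<open>0 < c\<close> \<open>0 < \<sigma>\<close>
    by (simp add: emeasure_eq_measure e ennreal_le_iff)
  finally show ?thesis by (simp add: e)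
qed

text \<open>By dominated convergence the characteristic functions converge pointwise; as all
  \<open>U n\<close> have the same law, the sequence is constant and Levy's uniqueness theorem
  identifies the limit law.\<close>

lemma distributed_std_normal_limit:
  assumes "prob_space M"
    and U: "\<And>n. distributed M lborel (U n) std_normal_density"
    and lim: "AE \<omega> in M. (\<lambda>n. U n \<omega>) \<longlonglongrightarrow> V \<omega>" and V [measurable]: "V \<in> borel_measurable M"
  shows "distributed M lborel V std_normal_density"
proof -
  interpret prob_space M by fact
  have [measurable]: "U n \<in> borel_measurable M" for n
    using U[of n] by (simp add: distributed_def)
  have UN: "distr M borel (U n) = std_normal_distribution" for n
    using U[of n] distr_cong[of M M lborel borel "U n" "U n"] by (simp add: distributed_def)
  have "char (distr M borel V) t = char std_normal_distribution t" for t
  proof (rule LIMSEQ_unique)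
    have c: "char (distr M borel Y) t = (\<integral>\<omega>. iexp (t * Y \<omega>) \<partial>M)" if "Y \<in> borel_measurable M" for Y
      unfolding char_def using that by (subst integral_distr) auto
    have "(\<lambda>n. \<integral>\<omega>. iexp (t * U n \<omega>) \<partial>M) \<longlonglongrightarrow> (\<integral>\<omega>. iexp (t * V \<omega>) \<partial>M)"
    proof (rule integral_dominated_convergence[where w="\<lambda>_. 1"])
      show "AE \<omega> in M. (\<lambda>n. iexp (t * U n \<omega>)) \<longlonglongrightarrow> iexp (t * V \<omega>)"
        using lim by eventually_elim (auto intro!: tendsto_intros)
    qed auto
    moreover have "(\<integral>\<omega>. iexp (t * U n \<omega>) \<partial>M) = char std_normal_distribution t" for n
      by (subst c[symmetric]) (simp_all add: UN)
    ultimately show "(\<lambda>n. char std_normal_distribution t) \<longlonglongrightarrow> char (distr M borel V) t"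
      by (simp only: c[OF V])
  qed simp
  then have "distr M borel V = std_normal_distribution"
    by (intro Levy_uniqueness ext)
      (auto intro!: real_distribution_distr real_dist_normal_dist)
  moreover have "distr M lborel V = distr M borel V" by (rule distr_cong) auto
  ultimately show ?thesis by (simp add: distributed_def)
qed

context walk_init
begin

text \<open>Borel--Cantelli. One increment exceeds \<open>(9/10) ^ j\<close> with probability at
  most \<open>3 * (1/4) ^ j / (6561/10000) ^ j\<close>, where \<open>6561/10000\<close> is the
  fourth power of \<open>9/10\<close>. Multiplying by the \<open>j * 2 ^ j\<close> cells gives the
  summable bound \<open>3 * j * (5000/6561) ^ j\<close>.\<close>

lemma AE_tame: "AE \<omega> in base. tame (\<lambda>t. fst (\<omega> t))"
proof -
  define \<Delta> where "\<Delta> j k \<omega> = fst (\<omega> (real (Suc k) / 2 ^ j)) - fst (\<omega> (real k / 2 ^ j))"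
    for j k and \<omega> :: "real \<Rightarrow> real \<times> real \<times> real"
  have [measurable]: "\<Delta> j k \<in> borel_measurable base" for j k unfolding \<Delta>_def by measurable
  define A where "A j = {\<omega>\<in>space base. \<exists>k<j * 2 ^ j. (9/10) ^ j < \<bar>\<Delta> j k \<omega>\<bar>}" for j
  have [measurable]: "A j \<in> sets base" for j unfolding A_def by measurable
  have A: "base.prob (A j) \<le> 3 * (real j * (5000/6561) ^ j)" for j
  proof -
    have "base.prob {\<omega>\<in>space base. (9/10) ^ j < \<bar>\<Delta> j k \<omega>\<bar>} \<le> 3 * (10000/26244) ^ j" for k
    proof -
      have "distributed base lborel (\<Delta> j k) (normal_density 0 (sqrt (1 / 2 ^ j)))"
        using distributed_grid_incr[of k "Suc k" j] by (simp add: \<Delta>_def[abs_def])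
      from base.normal_fourth_moment_tail[OF this, of "(9/10) ^ j"]
      have "base.prob {\<omega>\<in>space base. (9/10) ^ j < \<bar>\<Delta> j k \<omega>\<bar>} \<le>
          3 * sqrt (1 / 2 ^ j) ^ 4 / ((9/10) ^ j) ^ 4" by simp
      also have "sqrt (1 / 2 ^ j) ^ 4 = (1 / 2 ^ j)\<^sup>2"
        using power_mult[of "sqrt (1 / 2 ^ j)" 2 2] by simp
      also have "\<dots> = (1 / 4) ^ j"
        by (simp add: power2_eq_square power_divide power_mult_distrib[symmetric])
      also have "((9/10::real) ^ j) ^ 4 = (6561/10000) ^ j"
        by (subst power_mult[symmetric], subst mult.commute, subst power_mult)
          (simp add: power_divide)
      also have "3 * (1 / 4) ^ j / (6561/10000) ^ j = 3 * ((10000/26244) ^ j :: real)"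
        unfolding times_divide_eq_right[symmetric] power_divide[symmetric] by simp
      finally show ?thesis .
    qed
    note 1 = this
    have "A j = (\<Union>k<j * 2 ^ j. {\<omega>\<in>space base. (9/10) ^ j < \<bar>\<Delta> j k \<omega>\<bar>})"
      by (auto simp: A_def)
    then have "base.prob (A j) \<le> (\<Sum>k<j * 2 ^ j. base.prob {\<omega>\<in>space base. (9/10) ^ j < \<bar>\<Delta> j k \<omega>\<bar>})"
      by (simp only:) (rule base.finite_measure_subadditive_finite; auto)
    also have "\<dots> \<le> (\<Sum>k<j * 2 ^ j. 3 * (10000/26244) ^ j)" by (intro sum_mono 1)
    also have "\<dots> = real (j * 2 ^ j) * (3 * (10000/26244) ^ j)" by (simp only: sum_constant card_lessThan)
    also have "\<dots> = 3 * (real j * (2 * (10000/26244)) ^ j)"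
      unfolding power_mult_distrib by (simp only: of_nat_mult of_nat_power of_nat_numeral mult_ac)
    finally show ?thesis by simp
  qed
  have "summable (\<lambda>j. real j * (5000/6561) ^ j :: real)"
  proof (rule summable_comparison_test')
    show "summable (\<lambda>j. real (Suc j) * (5000/6561) ^ j)"
      using geometric_deriv_sums[of "5000/6561 :: real"] by (auto dest: sums_summable)
  qed (auto intro!: mult_right_mono)
  then have "summable (\<lambda>j. 3 * (real j * (5000/6561) ^ j))" by (rule summable_mult)
  then have "summable (\<lambda>j. base.prob (A j))"
    by (rule summable_comparison_test') (use A in auto)
  then have "AE \<omega> in base. eventually (\<lambda>j. \<omega> \<in> space base - A j) sequentially"
    by (intro borel_cantelli_AE1) (auto simp: base.emeasure_eq_measure)
  then show ?thesis
  proof eventually_elim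
    case (elim \<omega>)
    then obtain j0 where j0: "\<And>j. j \<ge> j0 \<Longrightarrow> \<omega> \<in> space base - A j"
      by (auto simp: eventually_sequentially)
    have "\<bar>\<Delta> j k \<omega>\<bar> \<le> (9 / 10) ^ j" if "j \<ge> j0" "k < j * 2 ^ j" for j k
      using j0[OF that(1)] that(2) unfolding A_def by (auto simp: not_less dest: leD)
    then show ?case
      unfolding tame_def \<Delta>_def by blast
  qed
qed

text \<open>The default 0 on irregular outcomes makes every path continuous, not just almost every
  one, so that the pathwise equation can be solved for every outcome.\<close>

definition W :: "real \<Rightarrow> (real \<Rightarrow> real \<times> real \<times> real) \<Rightarrow> real" where
  "W t \<omega> = (if tame (\<lambda>t. fst (\<omega> t)) then grid_lim (\<lambda>t. fst (\<omega> t)) t else 0)"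

lemma measurable_grid_floor [measurable]: "(\<lambda>\<omega>. \<omega> (grid_floor n t)) \<in> borel_measurable base"
  unfolding grid_floor_def by measurable

lemma measurable_W [measurable]: "W t \<in> borel_measurable base"
proof -
  have "Measurable.pred base (\<lambda>\<omega>. tame (\<lambda>t. fst (\<omega> t)))"
    unfolding tame_def by measurable
  then show ?thesis
    unfolding W_def[abs_def] grid_lim_def by measurable
qed

lemma continuous_W: "continuous_on {0..} (\<lambda>t. W t \<omega>)"
  using tame_continuous by (cases "tame (\<lambda>t. fst (\<omega> t))") (auto simp: W_def)

lemma AE_W_lim:
  "AE \<omega> in base. \<forall>t\<ge>0. (\<lambda>n. fst (\<omega> (grid_floor n t))) \<longlonglongrightarrow> W t \<omega>"
  using AE_tame
proof eventually_elim
  case (elim \<omega>)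
  from elim obtain j0 where "\<And>t. 0 \<le> t \<Longrightarrow>
      (\<lambda>n. fst (\<omega> (grid_floor n t))) \<longlonglongrightarrow> grid_lim (\<lambda>t. fst (\<omega> t)) t"
    by (rule tame_grid_lim) (rule that)
  then show ?case using elim by (simp add: W_def)
qed

lemma AE_W_0: "AE \<omega> in base. W 0 \<omega> = 0"
  using AE_W_lim AE_base_0
proof eventually_elim
  case (elim \<omega>)
  from elim(1) have "(\<lambda>n. fst (\<omega> (grid_floor n 0))) \<longlonglongrightarrow> W 0 \<omega>" by simp
  then show ?case using elim(2) by (simp add: grid_floor_def LIMSEQ_const_iff)
qed

text \<open>The grid points below \<open>s\<close> and \<open>t\<close> may coincide on coarse
  grids, and then the increment between them has no density; from level \<open>n0\<close> on they
  are distinct.\<close>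

lemma grid_incr:
  fixes s t :: real
  assumes "0 \<le> s" "s < t"
  obtains n0 where "\<And>n. n \<ge> n0 \<Longrightarrow> nat \<lfloor>s * 2 ^ n\<rfloor> < nat \<lfloor>t * 2 ^ n\<rfloor>"
proof -
  from grid_floor_tendsto[of t] assms have "\<forall>\<^sub>F n in sequentially. s < grid_floor n t"
    by (auto dest: order_tendstoD)
  then obtain n0 where n0: "\<And>n. n \<ge> n0 \<Longrightarrow> s < grid_floor n t" by (auto simp: eventually_sequentially)
  show ?thesis
  proof (rule that)
    fix n assume "n \<ge> n0"
    from n0[OF this] grid_floor_le[of s n] assms have "grid_floor n s < grid_floor n t" by simp
    then show "nat \<lfloor>s * 2 ^ n\<rfloor> < nat \<lfloor>t * 2 ^ n\<rfloor>"
      unfolding grid_floor_def by (simp add: divide_less_cancel)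
  qed
qed

lemma distributed_W_incr:
  assumes "0 \<le> s" "s < t"
  shows "distributed base lborel (\<lambda>\<omega>. W t \<omega> - W s \<omega>) (normal_density 0 (sqrt (t - s)))"
proof -
  from assms obtain n0 where n0: "\<And>n. n \<ge> n0 \<Longrightarrow> nat \<lfloor>s * 2 ^ n\<rfloor> < nat \<lfloor>t * 2 ^ n\<rfloor>"
    by (rule grid_incr) (rule that)
  define a where "a n = grid_floor (n + n0) s" for n
  define b where "b n = grid_floor (n + n0) t" for n
  have ab: "a n < b n" for n
    unfolding a_def b_def grid_floor_def using n0[of "n + n0"]
    by (intro divide_strict_right_mono) (simp_all only: of_nat_less_iff, simp_all)
  \<comment> \<open>The variance of the grid increment changes with \<open>n\<close>; after
    normalisation the law is the same for all \<open>n\<close>, as the limit lemma requires.\<close>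
  define U where "U n \<omega> = (fst (\<omega> (b n)) - fst (\<omega> (a n))) / sqrt (b n - a n)"
    for n and \<omega> :: "real \<Rightarrow> real \<times> real \<times> real"
  have U: "distributed base lborel (U n) std_normal_density" for n
  proof -
    have "distributed base lborel (\<lambda>\<omega>. fst (\<omega> (b n)) - fst (\<omega> (a n))) (normal_density 0 (sqrt (b n - a n)))"
      using distributed_grid_incr[OF n0[of "n + n0"], of "n + n0"] n0[of "n + n0"]
      by (simp add: a_def b_def grid_floor_def of_nat_diff diff_divide_distrib less_imp_le)
    then show ?thesis
      using base.normal_standard_normal_convert[of "sqrt (b n - a n)" _ 0] ab[of n] by (simp add: U_def[abs_def])
  qed
  have lims: "(\<lambda>n. sqrt (b n - a n)) \<longlonglongrightarrow> sqrt (t - s)"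
    unfolding a_def b_def using assms
    by (intro tendsto_intros LIMSEQ_ignore_initial_segment[OF grid_floor_tendsto]) auto
  have lim: "AE \<omega> in base. (\<lambda>n. U n \<omega>) \<longlonglongrightarrow> (W t \<omega> - W s \<omega>) / sqrt (t - s)"
    using AE_W_lim
  proof eventually_elim
    case (elim \<omega>)
    then show ?case
      unfolding U_def using assms
      by (intro tendsto_divide tendsto_diff lims)
        (auto simp: a_def b_def intro!: LIMSEQ_ignore_initial_segment)
  qed
  have "distributed base lborel (\<lambda>\<omega>. (W t \<omega> - W s \<omega> - 0) / sqrt (t - s)) std_normal_density"
    using distributed_std_normal_limit[OF base.prob_space_axioms U lim] by simp
  then show ?thesis
    using base.normal_standard_normal_convert[of "sqrt (t - s)" "\<lambda>\<omega>. W t \<omega> - W s \<omega>" 0] assms by simp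
qed

end

section \<open>Independence of the increments of \<open>W\<close> from the past\<close>

text \<open>A continuous, piecewise linear substitute for the indicator of \<open>{..a}\<close>,
  equal to 1 up to \<open>a\<close> and, for positive \<open>k\<close>, to 0 from
  \<open>a + 1 / k\<close> on. Continuity is what allows independence on grids to pass to the limit;
  indicators could fail at the boundary point.\<close>

definition cutoff :: "nat \<Rightarrow> real \<Rightarrow> real \<Rightarrow> real" where
  "cutoff k a x = max 0 (min 1 (1 - real k * (x - a)))"

lemma cutoff_nonneg [simp]: "0 \<le> cutoff k a x" and cutoff_le_1 [simp]: "cutoff k a x \<le> 1"
  by (auto simp: cutoff_def)

lemma measurable_cutoff [measurable]: "cutoff k a \<in> borel_measurable borel"
  unfolding cutoff_def by measurable

lemma tendsto_cutoff: "(f \<longlongrightarrow> l) G \<Longrightarrow> ((\<lambda>n. cutoff k a (f n)) \<longlongrightarrow> cutoff k a l) G"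
  unfolding cutoff_def by (intro tendsto_intros)

lemma cutoff_tendsto_indicator: "(\<lambda>k. cutoff k a x) \<longlonglongrightarrow> indicator {..a} x"
proof (cases "x \<le> a")
  case True
  then have "cutoff k a x = 1" for k by (auto simp: cutoff_def min_def mult_nonneg_nonpos)
  then show ?thesis using True by simp
next
  case False
  then have "filterlim (\<lambda>k. real k * (x - a)) at_top sequentially"
    by (intro filterlim_at_top_mult_tendsto_pos[OF tendsto_const _ filterlim_real_sequentially]) auto
  then have "\<forall>\<^sub>F k in sequentially. 1 \<le> real k * (x - a)"
    by (simp add: filterlim_at_top)
  then have "\<forall>\<^sub>F k in sequentially. cutoff k a x = 0"
    by eventually_elim (auto simp: cutoff_def)
  then show ?thesis using False by (simp add: tendsto_eventually)
qed

context walk_init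
begin

text \<open>A generator of the past that is stable under intersection: an event for the initial pair
  together with finitely many upper bounds, each pair in \<open>R\<close> being a time up to
  \<open>s\<close> and a bound. Its indicator is a finite product of indicators of half-lines, which
  the cutoffs approximate.\<close>

definition hist :: "real \<Rightarrow> (real \<Rightarrow> real \<times> real \<times> real) set set" where
  "hist s = {{\<omega>\<in>space base. snd (\<omega> 0) \<in> C \<and> (\<forall>p\<in>R. W (fst p) \<omega> \<le> snd p)} |C R.
     C \<in> sets borel \<and> finite R \<and> R \<subseteq> {0..s} \<times> UNIV}"

definition Filt :: "real \<Rightarrow> (real \<Rightarrow> real \<times> real \<times> real) measure" where
  "Filt s = sigma (space base) (hist s)"

lemma measurable_base_0 [measurable]: "(\<lambda>\<omega>. \<omega> 0) \<in> borel_measurable base"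
  using measurable_base_grid[of 0 0] by simp

lemma hist_subset: "hist s \<subseteq> sets base"
proof
  fix A assume "A \<in> hist s"
  then obtain C R where [measurable]: "C \<in> sets borel" and "finite R"
    and A: "A = {\<omega>\<in>space base. snd (\<omega> 0) \<in> C \<and> (\<forall>p\<in>R. W (fst p) \<omega> \<le> snd p)}"
    by (auto simp: hist_def)
  have [measurable]: "countable R" using \<open>finite R\<close> by (rule countable_finite)
  show "A \<in> sets base" unfolding A by measurable
qed

lemma space_Filt [simp]: "space (Filt s) = space base"
  by (simp add: Filt_def space_measure_of_conv)

lemma sets_Filt: "sets (Filt s) = sigma_sets (space base) (hist s)"
  unfolding Filt_def by (rule sets_measure_of) (auto simp: hist_def)

lemma Int_stable_hist: "Int_stable (hist s)"
proof (rule Int_stableI)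
  fix A B assume "A \<in> hist s" "B \<in> hist s"
  then obtain C R C' R' where "C \<in> sets borel" "finite R" "R \<subseteq> {0..s} \<times> UNIV"
    "C' \<in> sets borel" "finite R'" "R' \<subseteq> {0..s} \<times> UNIV"
    "A = {\<omega>\<in>space base. snd (\<omega> 0) \<in> C \<and> (\<forall>p\<in>R. W (fst p) \<omega> \<le> snd p)}"
    "B = {\<omega>\<in>space base. snd (\<omega> 0) \<in> C' \<and> (\<forall>p\<in>R'. W (fst p) \<omega> \<le> snd p)}"
    by (auto simp: hist_def)
  then show "A \<inter> B \<in> hist s"
    unfolding hist_def by (intro CollectI exI[of _ "C \<inter> C'"] exI[of _ "R \<union> R'"]) auto
qed

lemma filtration_Filt: "filtration (space base) Filt"
proof
  fix s t :: real assume "s \<le> t"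
  then have "hist s \<subseteq> hist t" unfolding hist_def by fastforce
  then show "sets (Filt s) \<subseteq> sets (Filt t)"
    unfolding sets_Filt by (rule sigma_sets_mono')
qed simp

lemma Filt_subset: "sets (Filt s) \<subseteq> sets base"
  unfolding sets_Filt using hist_subset by (rule sets.sigma_sets_subset)

lemma measurable_W_Filt:
  assumes "0 \<le> r" "r \<le> s"
  shows "W r \<in> borel_measurable (Filt s)"
proof (subst borel_measurable_iff_le, intro allI)
  fix a
  have "{\<omega>\<in>space (Filt s). W r \<omega> \<le> a} \<in> hist s"
    unfolding hist_def using assms by (intro CollectI exI[of _ UNIV] exI[of _ "{(r, a)}"]) auto
  then show "{\<omega>\<in>space (Filt s). W r \<omega> \<le> a} \<in> sets (Filt s)"
    unfolding sets_Filt by blast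
qed

lemma measurable_init_Filt: "(\<lambda>\<omega>. snd (\<omega> 0)) \<in> borel_measurable (Filt s)"
proof (rule measurableI)
  fix C :: "(real \<times> real) set" assume C: "C \<in> sets borel"
  have "(\<lambda>\<omega>. snd (\<omega> 0)) -` C \<inter> space (Filt s) \<in> hist s"
    unfolding hist_def using C by (intro CollectI exI[of _ C] exI[of _ "{}"]) auto
  then show "(\<lambda>\<omega>. snd (\<omega> 0)) -` C \<inter> space (Filt s) \<in> sets (Filt s)"
    unfolding sets_Filt by blast
qed simp

text \<open>Rounding down is monotone, so at level \<open>n\<close> all times up to \<open>s\<close>
  are read at indices up to that of \<open>s\<close>. The first factor is thus a function of the
  grid past, and the increment after that index is independent of it.\<close>

lemma grid_indep:
  assumes C [measurable]: "C \<in> sets borel" and R: "finite R" "R \<subseteq> {0..s} \<times> UNIV"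
    and st: "nat \<lfloor>s * 2 ^ n\<rfloor> < nat \<lfloor>t * 2 ^ n\<rfloor>"
  shows "(\<integral>\<omega>. (indicator C (snd (\<omega> 0)) * (\<Prod>p\<in>R. cutoff k (snd p) (fst (\<omega> (grid_floor n (fst p)))))) *
              cutoff k b (fst (\<omega> (grid_floor n t)) - fst (\<omega> (grid_floor n s))) \<partial>base) =
         (\<integral>\<omega>. indicator C (snd (\<omega> 0)) * (\<Prod>p\<in>R. cutoff k (snd p) (fst (\<omega> (grid_floor n (fst p))))) \<partial>base) *
         (\<integral>\<omega>. cutoff k b (fst (\<omega> (grid_floor n t)) - fst (\<omega> (grid_floor n s))) \<partial>base)"
proof -
  let ?a = "nat \<lfloor>s * 2 ^ n\<rfloor>"
  define f where "f h = indicator C (snd (h 0)) * (\<Prod>p\<in>R. cutoff k (snd p) (fst (h (nat \<lfloor>fst p * 2 ^ n\<rfloor>))))"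
    for h :: "nat \<Rightarrow> real \<times> real \<times> real"
  have le: "nat \<lfloor>fst p * 2 ^ n\<rfloor> \<le> ?a" if "p \<in> R" for p
    using R that by (intro nat_mono floor_mono mult_right_mono) auto
  have [measurable]: "(\<lambda>h. h (nat \<lfloor>fst p * 2 ^ n\<rfloor>)) \<in> borel_measurable (\<Pi>\<^sub>M i\<in>{..?a}. borel)" if "p \<in> R" for p
    by (rule measurable_component_singleton) (use le[OF that] in simp)
  have [measurable]: "f \<in> borel_measurable (\<Pi>\<^sub>M i\<in>{..?a}. borel)"
    unfolding f_def by (intro borel_measurable_times borel_measurable_prod) measurable
  have f01: "0 \<le> f h" "f h \<le> 1" for h
    unfolding f_def by (auto intro!: mult_nonneg_nonneg prod_nonneg mult_le_one prod_le_1 simp: indicator_def)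
  have f_eq: "f (\<lambda>i\<in>{..?a}. \<omega> (real i / 2 ^ n)) =
      indicator C (snd (\<omega> 0)) * (\<Prod>p\<in>R. cutoff k (snd p) (fst (\<omega> (grid_floor n (fst p)))))" for \<omega>
    unfolding f_def grid_floor_def using le by (auto intro!: prod.cong)
  have "base.indep_var borel (\<lambda>\<omega>. f (\<lambda>i\<in>{..?a}. \<omega> (real i / 2 ^ n)))
      borel (\<lambda>\<omega>. fst (\<omega> (grid_floor n t)) - fst (\<omega> (grid_floor n s)))"
    unfolding grid_floor_def by (rule indep_grid_incr[OF st]) measurable
  then have "base.indep_var borel ((\<lambda>x. x) \<circ> (\<lambda>\<omega>. f (\<lambda>i\<in>{..?a}. \<omega> (real i / 2 ^ n))))
      borel (cutoff k b \<circ> (\<lambda>\<omega>. fst (\<omega> (grid_floor n t)) - fst (\<omega> (grid_floor n s))))"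
    by (rule base.indep_var_compose) auto
  then have ind: "base.indep_var borel (\<lambda>\<omega>. f (\<lambda>i\<in>{..?a}. \<omega> (real i / 2 ^ n)))
      borel (\<lambda>\<omega>. cutoff k b (fst (\<omega> (grid_floor n t)) - fst (\<omega> (grid_floor n s))))"
    by (simp add: comp_def)
  have [measurable]: "(\<lambda>\<omega>. \<lambda>i\<in>{..?a}. \<omega> (real i / 2 ^ n)) \<in> measurable base (\<Pi>\<^sub>M i\<in>{..?a}. borel)"
    by (rule measurable_restrict) measurable
  have "integrable base (\<lambda>\<omega>. f (\<lambda>i\<in>{..?a}. \<omega> (real i / 2 ^ n)))"
    by (rule base.integrable_const_bound[of _ 1]) (auto simp: f01)
  moreover have "integrable base (\<lambda>\<omega>. cutoff k b (fst (\<omega> (grid_floor n t)) - fst (\<omega> (grid_floor n s))))"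
    by (rule base.integrable_const_bound[of _ 1]) auto
  ultimately show ?thesis
    using base.indep_var_lebesgue_integral[OF ind] by (simp only: f_eq)
qed

text \<open>The limit in the grid level \<open>n\<close> with the cutoff parameter \<open>k\<close>
  fixed: the cutoffs are continuous and bounded by 1, so dominated convergence applies to both sides
  of \<open>grid_indep\<close>.\<close>

lemma W_indep_cutoff:
  assumes C [measurable]: "C \<in> sets borel" and R: "finite R" "R \<subseteq> {0..s} \<times> UNIV"
    and st: "0 \<le> s" "s < t"
  shows "(\<integral>\<omega>. (indicator C (snd (\<omega> 0)) * (\<Prod>p\<in>R. cutoff k (snd p) (W (fst p) \<omega>))) * cutoff k b (W t \<omega> - W s \<omega>) \<partial>base) =
         (\<integral>\<omega>. indicator C (snd (\<omega> 0)) * (\<Prod>p\<in>R. cutoff k (snd p) (W (fst p) \<omega>)) \<partial>base) *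
         (\<integral>\<omega>. cutoff k b (W t \<omega> - W s \<omega>) \<partial>base)"
proof -
  let ?Y = "\<lambda>n \<omega>. indicator C (snd (\<omega> 0)) * (\<Prod>p\<in>R. cutoff k (snd p) (fst (\<omega> (grid_floor n (fst p)))))"
  let ?Z = "\<lambda>n \<omega>. cutoff k b (fst (\<omega> (grid_floor n t)) - fst (\<omega> (grid_floor n s)))"
  let ?Y' = "\<lambda>\<omega>. indicator C (snd (\<omega> 0)) * (\<Prod>p\<in>R. cutoff k (snd p) (W (fst p) \<omega>))"
  let ?Z' = "\<lambda>\<omega>. cutoff k b (W t \<omega> - W s \<omega>)"
  have Y: "AE \<omega> in base. (\<lambda>n. ?Y n \<omega>) \<longlonglongrightarrow> ?Y' \<omega>"
    using AE_W_lim by eventually_elim (use R in \<open>auto intro!: tendsto_intros tendsto_cutoff\<close>)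
  have Z: "AE \<omega> in base. (\<lambda>n. ?Z n \<omega>) \<longlonglongrightarrow> ?Z' \<omega>"
    using AE_W_lim by eventually_elim (use st in \<open>auto intro!: tendsto_intros tendsto_cutoff\<close>)
  have YZ: "AE \<omega> in base. (\<lambda>n. ?Y n \<omega> * ?Z n \<omega>) \<longlonglongrightarrow> ?Y' \<omega> * ?Z' \<omega>"
    using Y Z by eventually_elim (rule tendsto_mult)
  have bnd: "\<bar>?Y n \<omega>\<bar> \<le> 1" "\<bar>?Z n \<omega>\<bar> \<le> 1" for n \<omega>
    by (auto simp: abs_mult indicator_def abs_prod intro!: prod_le_1)
  have bnd2: "\<bar>?Y n \<omega> * ?Z n \<omega>\<bar> \<le> 1" for n \<omega>
    unfolding abs_mult[of "?Y n \<omega>"] by (intro mult_le_one bnd abs_ge_zero)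
  have 1: "(\<lambda>n. \<integral>\<omega>. ?Y n \<omega> * ?Z n \<omega> \<partial>base) \<longlonglongrightarrow> (\<integral>\<omega>. ?Y' \<omega> * ?Z' \<omega> \<partial>base)"
  proof (rule integral_dominated_convergence[where w="\<lambda>_. 1", OF _ _ _ YZ])
    show "AE \<omega> in base. norm (?Y n \<omega> * ?Z n \<omega>) \<le> 1" for n
      by (intro AE_I2) (simp only: real_norm_def bnd2)
  qed measurable
  have 2: "(\<lambda>n. (\<integral>\<omega>. ?Y n \<omega> \<partial>base) * (\<integral>\<omega>. ?Z n \<omega> \<partial>base)) \<longlonglongrightarrow>
      (\<integral>\<omega>. ?Y' \<omega> \<partial>base) * (\<integral>\<omega>. ?Z' \<omega> \<partial>base)"
    by (intro tendsto_mult integral_dominated_convergence[where w="\<lambda>_. 1"] Y Z)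
      (use bnd in auto)
  have "\<forall>\<^sub>F n in sequentially. (\<integral>\<omega>. ?Y n \<omega> \<partial>base) * (\<integral>\<omega>. ?Z n \<omega> \<partial>base) =
      (\<integral>\<omega>. ?Y n \<omega> * ?Z n \<omega> \<partial>base)"
  proof -
    from st obtain n0 where n0: "\<And>n. n \<ge> n0 \<Longrightarrow> nat \<lfloor>s * 2 ^ n\<rfloor> < nat \<lfloor>t * 2 ^ n\<rfloor>"
      by (rule grid_incr) (rule that)
    show ?thesis
      unfolding eventually_sequentially using grid_indep[OF C R n0, symmetric] by blast
  qed
  from LIMSEQ_unique[OF 1 Lim_transform_eventually[OF 2 this]] show ?thesis .
qed

text \<open>The limit in the cutoff parameter, taken after the grid limit: the cutoffs converge
  pointwise to the indicators of the events themselves.\<close>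

lemma W_indep_hist:
  assumes A: "A \<in> hist s" and st: "0 \<le> s" "s < t"
  shows "measure base (A \<inter> {\<omega>\<in>space base. W t \<omega> - W s \<omega> \<le> b}) =
         measure base A * measure base {\<omega>\<in>space base. W t \<omega> - W s \<omega> \<le> b}"
proof -
  from A obtain C R where C [measurable]: "C \<in> sets borel" and R: "finite R" "R \<subseteq> {0..s} \<times> UNIV"
    and A_eq: "A = {\<omega>\<in>space base. snd (\<omega> 0) \<in> C \<and> (\<forall>p\<in>R. W (fst p) \<omega> \<le> snd p)}"
    by (auto simp: hist_def)
  have [measurable]: "A \<in> sets base" using A hist_subset by auto
  let ?D = "{\<omega>\<in>space base. W t \<omega> - W s \<omega> \<le> b}"
  let ?Y = "\<lambda>k \<omega>. indicator C (snd (\<omega> 0)) * (\<Prod>p\<in>R. cutoff k (snd p) (W (fst p) \<omega>))"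
  let ?Z = "\<lambda>k \<omega>. cutoff k b (W t \<omega> - W s \<omega>)"
  have Y: "(\<lambda>k. ?Y k \<omega>) \<longlonglongrightarrow> indicator A \<omega>" if "\<omega> \<in> space base" for \<omega>
  proof -
    have "(\<lambda>k. ?Y k \<omega>) \<longlonglongrightarrow> indicator C (snd (\<omega> 0)) * (\<Prod>p\<in>R. indicator {..snd p} (W (fst p) \<omega>))"
      by (intro tendsto_mult tendsto_const tendsto_prod cutoff_tendsto_indicator)
    also have "(\<Prod>p\<in>R. indicator {..snd p} (W (fst p) \<omega>)) = (if \<forall>p\<in>R. W (fst p) \<omega> \<le> snd p then 1 else 0 :: real)"
    proof (cases "\<forall>p\<in>R. W (fst p) \<omega> \<le> snd p")
      case False
      then show ?thesis using R(1) by (auto intro!: prod_zero bexI simp: not_le)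
    qed auto
    also have "indicator C (snd (\<omega> 0)) * (if \<forall>p\<in>R. W (fst p) \<omega> \<le> snd p then 1 else 0) = (indicator A \<omega> :: real)"
      using that by (auto simp: A_eq indicator_def)
    finally show ?thesis .
  qed
  have Z: "(\<lambda>k. ?Z k \<omega>) \<longlonglongrightarrow> indicator ?D \<omega>" if "\<omega> \<in> space base" for \<omega>
    using cutoff_tendsto_indicator[of b "W t \<omega> - W s \<omega>"] that by (simp add: indicator_def)
  have bnd: "\<bar>?Y n \<omega>\<bar> \<le> 1" "\<bar>?Z n \<omega>\<bar> \<le> 1" for n \<omega>
    by (auto simp: abs_mult indicator_def abs_prod intro!: prod_le_1)
  have bnd2: "\<bar>?Y n \<omega> * ?Z n \<omega>\<bar> \<le> 1" for n \<omega>
    unfolding abs_mult[of "?Y n \<omega>"] by (intro mult_le_one bnd abs_ge_zero)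
  have "(\<lambda>k. \<integral>\<omega>. ?Y k \<omega> * ?Z k \<omega> \<partial>base) \<longlonglongrightarrow> (\<integral>\<omega>. indicator A \<omega> * indicator ?D \<omega> \<partial>base)"
  proof (rule integral_dominated_convergence[where w="\<lambda>_. 1"])
    show "AE \<omega> in base. norm (?Y n \<omega> * ?Z n \<omega>) \<le> 1" for n
      by (intro AE_I2) (simp only: real_norm_def bnd2)
    show "AE \<omega> in base. (\<lambda>k. ?Y k \<omega> * ?Z k \<omega>) \<longlonglongrightarrow> indicator A \<omega> * indicator ?D \<omega>"
      by (intro AE_I2 tendsto_mult Y Z)
  qed measurable
  also have "(\<integral>\<omega>. indicator A \<omega> * indicator ?D \<omega> \<partial>base) = measure base (A \<inter> ?D)"
    by (simp add: indicator_inter_arith[symmetric])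
  finally have 1: "(\<lambda>k. \<integral>\<omega>. ?Y k \<omega> * ?Z k \<omega> \<partial>base) \<longlonglongrightarrow> measure base (A \<inter> ?D)" .
  have "(\<lambda>k. (\<integral>\<omega>. ?Y k \<omega> \<partial>base) * (\<integral>\<omega>. ?Z k \<omega> \<partial>base)) \<longlonglongrightarrow>
      (\<integral>\<omega>. indicator A \<omega> \<partial>base) * (\<integral>\<omega>. indicator ?D \<omega> \<partial>base)"
    by (intro tendsto_mult integral_dominated_convergence[where w="\<lambda>_. 1"])
      (use bnd Y Z in auto)
  then have "(\<lambda>k. \<integral>\<omega>. ?Y k \<omega> * ?Z k \<omega> \<partial>base) \<longlonglongrightarrow> measure base A * measure base ?D"
    by (simp add: W_indep_cutoff[OF C R st])
  with 1 show ?thesis by (rule LIMSEQ_unique)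
qed

text \<open>The product formula extends from two intersection-stable generators to the generated
  sigma-algebras; half-lines generate all events of the increment.\<close>

lemma W_indep_Filt:
  assumes A: "A \<in> sets (Filt s)" and st: "0 \<le> s" "s < t" and B: "B \<in> sets borel"
  shows "measure base (A \<inter> ((\<lambda>\<omega>. W t \<omega> - W s \<omega>) -` B \<inter> space base)) =
         measure base A * measure base ((\<lambda>\<omega>. W t \<omega> - W s \<omega>) -` B \<inter> space base)"
proof -
  let ?H = "range (\<lambda>b. {\<omega>\<in>space base. W t \<omega> - W s \<omega> \<le> b})"
  have "base.indep_set (hist s) ?H"
    using hist_subset W_indep_hist[OF _ st] by (intro base.indep_setI) auto
  moreover have "Int_stable ?H"
  proof (rule Int_stableI)
    fix a b assume "a \<in> ?H" "b \<in> ?H"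
    then obtain u v where "a = {\<omega>\<in>space base. W t \<omega> - W s \<omega> \<le> u}" "b = {\<omega>\<in>space base. W t \<omega> - W s \<omega> \<le> v}"
      by auto
    then have "a \<inter> b = {\<omega>\<in>space base. W t \<omega> - W s \<omega> \<le> min u v}" by auto
    then show "a \<inter> b \<in> ?H" by blast
  qed
  ultimately have ind: "base.indep_set (sigma_sets (space base) (hist s)) (sigma_sets (space base) ?H)"
    by (rule base.indep_set_sigma_sets[OF _ Int_stable_hist])
  have sets_H: "sets (sigma (space base) ?H) = sigma_sets (space base) ?H"
    by (rule sets_measure_of) auto
  have "(\<lambda>\<omega>. W t \<omega> - W s \<omega>) \<in> borel_measurable (sigma (space base) ?H)"
    by (subst borel_measurable_iff_le) (auto simp: sets_H space_measure_of_conv)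
  from measurable_sets[OF this B]
  have "(\<lambda>\<omega>. W t \<omega> - W s \<omega>) -` B \<inter> space base \<in> sigma_sets (space base) ?H"
    by (simp add: sets_H space_measure_of_conv)
  then show ?thesis
    using base.indep_setD[OF ind] A by (simp add: sets_Filt)
qed

lemma wiener_W: "wiener_process base Filt W"
  unfolding wiener_process_def adapted_process_def continuous_process_def
  using measurable_W_Filt continuous_W AE_W_0 distributed_W_incr W_indep_Filt by simp

lemma filtered_base: "filtered_prob_space base Filt"
  unfolding filtered_prob_space_def
  using base.prob_space_axioms filtration_Filt Filt_subset by simp

end

section \<open>Riemann--Stieltjes sums and global Lipschitz equations\<close>

text \<open>On each cell the increment of \<open>H\<close> is the integral of \<open>h\<close>, so
  the error is the integral of \<open>h\<close> times the oscillation of \<open>g\<close>, which is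
  uniformly small. The tags are arbitrary because both kinds occur: left endpoints for Riemann sums
  and right endpoints for summation by parts.\<close>

lemma stieltjes_sum_tendsto:
  fixes g :: "real \<Rightarrow> 'a::banach"
  assumes t: "0 \<le> t" and g: "continuous_on {0..t} g" and h: "continuous_on {0..t} h"
    and H: "\<And>s. s \<in> {0..t} \<Longrightarrow> (H has_real_derivative h s) (at s within {0..t})"
    and c: "\<And>n k. k < 2 ^ n \<Longrightarrow> c n k \<in> {real k * t / 2 ^ n .. real (Suc k) * t / 2 ^ n}"
  shows "(\<lambda>n. \<Sum>k<2 ^ n. (H (real (Suc k) * t / 2 ^ n) - H (real k * t / 2 ^ n)) *\<^sub>R g (c n k))
           \<longlonglongrightarrow> integral {0..t} (\<lambda>s. h s *\<^sub>R g s)"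
proof -
  have hg: "continuous_on {0..t} (\<lambda>s. h s *\<^sub>R g s)" by (intro continuous_intros g h)
  obtain B where B: "B > 0" "\<And>s. s \<in> {0..t} \<Longrightarrow> \<bar>h s\<bar> \<le> B"
    using compact_imp_bounded[OF compact_continuous_image[OF h]] unfolding bounded_pos by auto
  have piece: "real k * t / 2 ^ n \<in> {0..t}" if "k \<le> 2 ^ n" for k n :: nat
  proof -
    have "real k \<le> 2 ^ n" using that by (metis of_nat_le_iff of_nat_numeral of_nat_power)
    then show ?thesis using t by (auto simp: divide_le_eq mult.commute[of t] intro: mult_right_mono)
  qed
  have mono: "real k * t / 2 ^ n \<le> real (Suc k) * t / 2 ^ n" for k n
    using t by (intro divide_right_mono mult_right_mono) auto
  have split: "integral {0..real m * t / 2 ^ n} f =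
      (\<Sum>k<m. integral {real k * t / 2 ^ n..real (Suc k) * t / 2 ^ n} f)"
    if "m \<le> 2 ^ n" "continuous_on {0..t} f" for m n and f :: "real \<Rightarrow> 'a"
    using that(1)
  proof (induction m)
    case (Suc m)
    have "integral {0..real m * t / 2 ^ n} f + integral {real m * t / 2 ^ n..real (Suc m) * t / 2 ^ n} f =
        integral {0..real (Suc m) * t / 2 ^ n} f"
    proof (rule Henstock_Kurzweil_Integration.integral_combine[OF _ mono])
      show "f integrable_on {0..real (Suc m) * t / 2 ^ n}"
        using piece[OF Suc.prems] by (intro integrable_continuous_real continuous_on_subset[OF that(2)]) auto
    qed (use t in simp)
    then show ?case using Suc by simp
  qed simp
  show ?thesis
  proof (rule LIMSEQ_I)
    fix e :: real assume "0 < e"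
    \<comment> \<open>The summand 1 in \<open>t + 1\<close> covers \<open>t = 0\<close>; the factor
      2 makes the final inequality strict.\<close>
    define e' where "e' = e / (2 * B * (t + 1))"
    have e': "0 < e'" using \<open>0 < e\<close> B t by (simp add: e'_def)
    have "uniformly_continuous_on {0..t} g" by (rule compact_uniformly_continuous[OF g]) simp
    with e' obtain d where d: "0 < d" "\<And>r s. r \<in> {0..t} \<Longrightarrow> s \<in> {0..t} \<Longrightarrow> dist r s < d \<Longrightarrow> dist (g r) (g s) < e'"
      unfolding uniformly_continuous_on_def by metis
    have "(\<lambda>n. t * (1 / 2) ^ n) \<longlonglongrightarrow> t * 0" by (intro tendsto_intros LIMSEQ_realpow_zero) auto
    then have "\<forall>\<^sub>F n in sequentially. t * (1 / 2) ^ n < d" using d(1) order_tendstoD(2)[of _ "t * 0"] by simp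
    then obtain N where N: "\<And>n. n \<ge> N \<Longrightarrow> t / 2 ^ n < d"
      by (auto simp: eventually_sequentially power_one_over)
    show "\<exists>N. \<forall>n\<ge>N. norm ((\<Sum>k<2 ^ n. (H (real (Suc k) * t / 2 ^ n) - H (real k * t / 2 ^ n)) *\<^sub>R g (c n k)) -
        integral {0..t} (\<lambda>s. h s *\<^sub>R g s)) < e"
    proof (intro exI[of _ N] allI impI)
      fix n assume n: "n \<ge> N"
      let ?I = "\<lambda>k. {real k * t / 2 ^ n..real (Suc k) * t / 2 ^ n}"
      have bound: "norm ((H (real (Suc k) * t / 2 ^ n) - H (real k * t / 2 ^ n)) *\<^sub>R g (c n k) -
          integral (?I k) (\<lambda>s. h s *\<^sub>R g s)) \<le> B * e' * (t / 2 ^ n)" if "k < 2 ^ n" for k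
      proof -
        have sub: "?I k \<subseteq> {0..t}" using piece[of k n] piece[of "Suc k" n] that by auto
        have len: "real (Suc k) * t / 2 ^ n - real k * t / 2 ^ n = t / 2 ^ n" by (simp add: field_simps)
        have "(h has_integral (H (real (Suc k) * t / 2 ^ n) - H (real k * t / 2 ^ n))) (?I k)"
          by (intro fundamental_theorem_of_calculus mono)
            (use sub in \<open>auto simp flip: has_real_derivative_iff_has_vector_derivative
              intro!: DERIV_subset[OF H]\<close>)
        then have "((\<lambda>s. h s *\<^sub>R g (c n k)) has_integral (H (real (Suc k) * t / 2 ^ n) - H (real k * t / 2 ^ n)) *\<^sub>R g (c n k)) (?I k)"
          by (rule has_integral_scaleR_left)
        moreover have "((\<lambda>s. h s *\<^sub>R g s) has_integral integral (?I k) (\<lambda>s. h s *\<^sub>R g s)) (?I k)"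
          by (intro integrable_integral integrable_continuous_real continuous_on_subset[OF hg sub])
        ultimately have "((\<lambda>s. h s *\<^sub>R g (c n k) - h s *\<^sub>R g s) has_integral
            ((H (real (Suc k) * t / 2 ^ n) - H (real k * t / 2 ^ n)) *\<^sub>R g (c n k) - integral (?I k) (\<lambda>s. h s *\<^sub>R g s))) (?I k)"
          by (rule has_integral_diff)
        then have "norm ((H (real (Suc k) * t / 2 ^ n) - H (real k * t / 2 ^ n)) *\<^sub>R g (c n k) -
            integral (?I k) (\<lambda>s. h s *\<^sub>R g s)) \<le> (B * e') * measure lborel (cbox (real k * t / 2 ^ n) (real (Suc k) * t / 2 ^ n))"
        proof (intro has_integral_bound)
          fix s assume s: "s \<in> cbox (real k * t / 2 ^ n) (real (Suc k) * t / 2 ^ n)"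
          then have "s \<in> ?I k" by simp
          with c[OF that] have "dist (c n k) s \<le> t / 2 ^ n" unfolding dist_real_def len[symmetric] by auto
          with N[OF n] c[OF that] \<open>s \<in> ?I k\<close> sub have "dist (g (c n k)) (g s) < e'" by (intro d(2)) auto
          moreover have "\<bar>h s\<bar> \<le> B" using B(2) sub \<open>s \<in> ?I k\<close> by blast
          ultimately show "norm (h s *\<^sub>R g (c n k) - h s *\<^sub>R g s) \<le> B * e'"
            unfolding scaleR_diff_right[symmetric] norm_scaleR dist_norm
            by (intro mult_mono) (use B in auto)
        qed (use B e' in auto)
        then show ?thesis using mono[of k n] len by simp
      qed
      have "norm ((\<Sum>k<2 ^ n. (H (real (Suc k) * t / 2 ^ n) - H (real k * t / 2 ^ n)) *\<^sub>R g (c n k)) -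
          integral {0..t} (\<lambda>s. h s *\<^sub>R g s)) =
          norm (\<Sum>k<2 ^ n. (H (real (Suc k) * t / 2 ^ n) - H (real k * t / 2 ^ n)) *\<^sub>R g (c n k) -
            integral (?I k) (\<lambda>s. h s *\<^sub>R g s))"
        using split[of "2 ^ n" n, OF _ hg] by (simp add: sum_subtractf)
      also have "\<dots> \<le> (\<Sum>k<(2::nat) ^ n. B * e' * (t / 2 ^ n))"
        by (intro order.trans[OF norm_sum] sum_mono bound) simp
      also have "\<dots> = B * e' * t" by simp
      also have "\<dots> \<le> B * e' * (t + 1)" using B e' by (intro mult_left_mono) auto
      also have "\<dots> = e / 2"
      proof -
        have "t + 1 \<noteq> 0" "B \<noteq> 0" using t B by auto
        then show ?thesis unfolding e'_def by (simp add: divide_simps)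
      qed
      also have "\<dots> < e" using \<open>0 < e\<close> by simp
      finally show "norm ((\<Sum>k<2 ^ n. (H (real (Suc k) * t / 2 ^ n) - H (real k * t / 2 ^ n)) *\<^sub>R g (c n k)) -
        integral {0..t} (\<lambda>s. h s *\<^sub>R g s)) < e" .
    qed
  qed
qed

lemma riemann_sum_tendsto:
  fixes g :: "real \<Rightarrow> 'a::banach"
  assumes "0 \<le> t" "continuous_on {0..t} g"
  shows "(\<lambda>n. \<Sum>k<2 ^ n. (t / 2 ^ n) *\<^sub>R g (real k * t / 2 ^ n)) \<longlonglongrightarrow> integral {0..t} g"
proof -
  have "(\<lambda>n. \<Sum>k<2 ^ n. (real (Suc k) * t / 2 ^ n - real k * t / 2 ^ n) *\<^sub>R g (real k * t / 2 ^ n))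
      \<longlonglongrightarrow> integral {0..t} (\<lambda>s. 1 *\<^sub>R g s)"
    by (rule stieltjes_sum_tendsto[where H="\<lambda>s. s" and h="\<lambda>_. 1"])
      (use assms in \<open>auto intro!: derivative_eq_intros divide_right_mono mult_right_mono\<close>)
  moreover have "real (Suc k) * t / 2 ^ n - real k * t / 2 ^ n = t / 2 ^ n" for k n
    by (simp add: field_simps)
  ultimately show ?thesis by simp
qed

text \<open>For integrands of bounded variation the left-point sums converge along every single
  continuous path, by summation by parts.\<close>
lemma left_sum_tendsto:
  fixes w :: "real \<Rightarrow> real"
  assumes t: "0 \<le> t" and w: "continuous_on {0..t} w" and h: "continuous_on {0..t} h"
    and H: "\<And>s. s \<in> {0..t} \<Longrightarrow> (H has_real_derivative h s) (at s within {0..t})"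
  shows "(\<lambda>n. \<Sum>k<2 ^ n. H (real k * t / 2 ^ n) * (w (real (Suc k) * t / 2 ^ n) - w (real k * t / 2 ^ n)))
           \<longlonglongrightarrow> H t * w t - H 0 * w 0 - integral {0..t} (\<lambda>s. h s * w s)"
proof -
  have parts: "(\<Sum>k<m. a k * (b (Suc k) - b k)) = a m * b m - a 0 * b 0 - (\<Sum>k<m. (a (Suc k) - a k) * b (Suc k))"
    for a b :: "nat \<Rightarrow> real" and m
    by (induction m) (auto simp: algebra_simps)
  have "(\<lambda>n. \<Sum>k<2 ^ n. (H (real (Suc k) * t / 2 ^ n) - H (real k * t / 2 ^ n)) *\<^sub>R w (real (Suc k) * t / 2 ^ n))
           \<longlonglongrightarrow> integral {0..t} (\<lambda>s. h s *\<^sub>R w s)"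
    by (rule stieltjes_sum_tendsto[OF t w h H])
      (use t in \<open>auto intro!: divide_right_mono mult_right_mono\<close>)
  from tendsto_diff[OF tendsto_const[of "H t * w t - H 0 * w 0"] this]
  show ?thesis
    using parts[where a="\<lambda>k. H (real k * t / 2 ^ n)" and b="\<lambda>k. w (real k * t / 2 ^ n)" and m="2 ^ n" for n]
    by simp
qed

section \<open>Gronwall's inequality and Picard iteration on the half-line\<close>

text \<open>Integrating factor: the right-hand side of the integral inequality, multiplied by
  \<open>exp (- b * s)\<close>, has a nonpositive derivative.\<close>

lemma gronwall:
  fixes g :: "real \<Rightarrow> real"
  assumes g: "continuous_on {0..T} g" and "0 \<le> b"
    and le: "\<And>t. t \<in> {0..T} \<Longrightarrow> g t \<le> a + b * integral {0..t} g"
    and t: "t \<in> {0..T}"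
  shows "g t \<le> a * exp (b * t)"
proof -
  define \<phi> where "\<phi> s = exp (- b * s) * (a + b * integral {0..s} g)" for s
  have d: "(\<phi> has_real_derivative exp (- b * s) * (b * g s - b * (a + b * integral {0..s} g))) (at s within {0..T})"
    if "s \<in> {0..T}" for s
    unfolding \<phi>_def
    by (auto intro!: derivative_eq_intros integral_has_real_derivative[OF g that] simp: algebra_simps)
  have "\<phi> t \<le> \<phi> 0"
  proof (cases "t = 0")
    case False
    show ?thesis
    proof (rule DERIV_nonpos_imp_decreasing_open[where f=\<phi> and a=0 and b=t])
      show "0 \<le> t" using t by simp
      show "continuous_on {0..t} \<phi>"
        using t by (intro continuous_on_subset[of "{0..T}", OF DERIV_continuous_on[OF d]]) auto
      fix s assume s: "0 < s" "s < t"
      then have "at s within {0..T} = at s" using t by (intro at_within_interior) auto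
      with d[of s] s t have "(\<phi> has_real_derivative exp (- b * s) * (b * g s - b * (a + b * integral {0..s} g))) (at s)"
        by auto
      moreover have "b * g s \<le> b * (a + b * integral {0..s} g)"
        using le[of s] s t \<open>0 \<le> b\<close> by (intro mult_left_mono) auto
      ultimately show "\<exists>y. (\<phi> has_real_derivative y) (at s) \<and> y \<le> 0"
        by (intro exI conjI) (auto intro!: mult_nonneg_nonpos)
    qed
  qed simp
  then have "a + b * integral {0..t} g \<le> a * exp (b * t)"
    by (simp add: \<phi>_def exp_minus field_simps)
  with le[OF t] show ?thesis by simp
qed

lemma continuous_on_halfline:
  fixes u :: "real \<Rightarrow> 'a::topological_space"
  assumes "\<And>T. 0 < T \<Longrightarrow> continuous_on {0..T} u"
  shows "continuous_on {0..} u"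
  unfolding continuous_on_eq_continuous_within
proof
  fix t :: real assume t: "t \<in> {0..}"
  have "at t within {0..} = at t within {0..t + 1}"
    by (rule at_within_nhd[of _ "{..<t + 1}"]) auto
  moreover have "continuous (at t within {0..t + 1}) u"
    using assms[of "t + 1"] t by (auto simp: continuous_on_eq_continuous_within)
  ultimately show "continuous (at t within {0..}) u"
    by (simp add: continuous_within)
qed

text \<open>Made for truncated fields, which are bounded and globally Lipschitz in the state. Time
  enters through a merely continuous noise path, so continuity is demanded along continuous
  curves.\<close>

locale lipschitz_ode =
  fixes f :: "real \<Rightarrow> 'a::banach \<Rightarrow> 'a" and L B :: real and u0 :: 'a
  assumes L: "0 < L" and B: "0 \<le> B"
    and lip: "\<And>t u v. norm (f t u - f t v) \<le> L * norm (u - v)"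
    and bnd: "\<And>t u. norm (f t u) \<le> B"
    and cont: "\<And>u. continuous_on {0..} u \<Longrightarrow> continuous_on {0..} (\<lambda>s. f s (u s))"
begin

lemma integrable_f: "continuous_on {0..} u \<Longrightarrow> (\<lambda>s. f s (u s)) integrable_on {0..t}"
  by (intro integrable_continuous_real continuous_on_subset[OF cont]) auto

text \<open>The weight \<open>exp (2 * L * t)\<close> makes the integral operator a contraction on all of
  the half-line.\<close>
lemma contraction:
  assumes u: "continuous_on {0..} u" and v: "continuous_on {0..} v" and t: "0 \<le> t"
    and uv: "\<And>s. s \<in> {0..t} \<Longrightarrow> norm (u s - v s) \<le> K * exp (2 * L * s)"
  shows "norm (integral {0..t} (\<lambda>s. f s (u s)) - integral {0..t} (\<lambda>s. f s (v s))) \<le> K / 2 * exp (2 * L * t)"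
proof -
  have "norm (u 0 - v 0) \<le> K" using uv[of 0] t by simp
  then have K: "0 \<le> K" using norm_ge_zero order.trans by blast
  have I: "((\<lambda>s. L * (K * exp (2 * L * s))) has_integral K / 2 * exp (2 * L * t) - K / 2 * exp (2 * L * 0)) {0..t}"
    by (rule fundamental_theorem_of_calculus[OF t])
      (use L in \<open>auto simp flip: has_real_derivative_iff_has_vector_derivative intro!: derivative_eq_intros\<close>)
  have "norm (integral {0..t} (\<lambda>s. f s (u s) - f s (v s))) \<le> integral {0..t} (\<lambda>s. L * (K * exp (2 * L * s)))"
  proof (rule integral_norm_bound_integral)
    show "(\<lambda>s. f s (u s) - f s (v s)) integrable_on {0..t}"
      by (intro integrable_diff integrable_f u v)
    show "(\<lambda>s. L * (K * exp (2 * L * s))) integrable_on {0..t}" using I by blast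
    fix s assume "s \<in> {0..t}"
    then have "L * norm (u s - v s) \<le> L * (K * exp (2 * L * s))"
      using L by (intro mult_left_mono uv) auto
    with lip show "norm (f s (u s) - f s (v s)) \<le> L * (K * exp (2 * L * s))" by (rule order.trans)
  qed
  also have "integral {0..t} (\<lambda>s. L * (K * exp (2 * L * s))) = K / 2 * exp (2 * L * t) - K / 2"
    using integral_unique[OF I] by (simp only: mult_zero_right exp_zero mult_1_right)
  also have "\<dots> \<le> K / 2 * exp (2 * L * t)" using K by simp
  finally show ?thesis by (simp add: integral_diff integrable_f u v)
qed

primrec picard :: "nat \<Rightarrow> real \<Rightarrow> 'a" where
  "picard 0 t = u0"
| "picard (Suc n) t = u0 + integral {0..t} (\<lambda>s. f s (picard n s))"

definition solution :: "real \<Rightarrow> 'a" where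
  "solution t = lim (\<lambda>n. picard n t)"

lemma continuous_integral_f:
  assumes "continuous_on {0..} u"
  shows "continuous_on {0..} (\<lambda>t. u0 + integral {0..t} (\<lambda>s. f s (u s)))"
  by (intro continuous_on_halfline continuous_intros indefinite_integral_continuous_1 integrable_f assms)

lemma continuous_picard: "continuous_on {0..} (picard n)"
proof (induction n)
  case (Suc n)
  then show ?case using continuous_integral_f[OF Suc] by (simp cong: continuous_on_cong)
qed (simp cong: continuous_on_cong)

text \<open>The first step is at most \<open>B * t\<close>, which the elementary bound
  \<open>2 * L * t \<le> exp (2 * L * t)\<close> turns into the weighted form; each further step
  gains the factor \<open>1 / 2\<close> from \<open>contraction\<close>.\<close>

lemma picard_step: "0 \<le> t \<Longrightarrow> norm (picard (Suc n) t - picard n t) \<le> B / (2 * L) * exp (2 * L * t) * (1 / 2) ^ n"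
proof (induction n arbitrary: t)
  case 0
  have "norm (integral {0..t} (\<lambda>s. f s u0)) \<le> B * (t - 0)"
    by (intro integral_bound 0 continuous_on_subset[OF cont]) (auto simp: bnd)
  also have "\<dots> = B / (2 * L) * (2 * L * t)" using L by simp
  also have "\<dots> \<le> B / (2 * L) * exp (2 * L * t)"
  proof (rule mult_left_mono)
    show "2 * L * t \<le> exp (2 * L * t)" using exp_ge_add_one_self[of "2 * L * t"] by linarith
  qed (use B L in auto)
  finally show ?case by simp
next
  case (Suc n)
  have "norm (picard (Suc n) s - picard n s) \<le> B / (2 * L) * (1 / 2) ^ n * exp (2 * L * s)" if "s \<in> {0..t}" for s
    using Suc.IH[of s] that by (simp add: mult.commute mult.left_commute)
  from contraction[OF continuous_picard continuous_picard Suc.prems this]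
  show ?case by (simp add: mult.commute mult.left_commute)
qed

lemma picard_tendsto: "0 \<le> t \<Longrightarrow> (\<lambda>n. picard n t) \<longlonglongrightarrow> solution t"
  unfolding solution_def 
  using geometric_Cauchy_convergent[where N=0 and a="\<lambda>n. picard n t" and q="1/2", OF picard_step]
  by (simp add: convergent_LIMSEQ_iff)

lemma picard_bound: "0 \<le> t \<Longrightarrow> norm (picard n t - solution t) \<le> B / L * (1 / 2) ^ n * exp (2 * L * t)"
  using geometric_Cauchy_bound[where N=0 and a="\<lambda>n. picard n t" and q="1/2" and n=n, OF picard_step]
  unfolding solution_def by (simp add: norm_minus_commute mult_ac)

lemma bound_tendsto_0: "(\<lambda>n. K * (1 / 2) ^ n * M :: real) \<longlonglongrightarrow> 0"
proof -
  have "(\<lambda>n. K * (1 / 2) ^ n * M) \<longlonglongrightarrow> K * 0 * M"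
    by (intro tendsto_intros LIMSEQ_realpow_zero) auto
  then show ?thesis by simp
qed

lemma continuous_solution: "continuous_on {0..} solution"
proof (rule continuous_on_halfline)
  fix T :: real assume "0 < T"
  have "uniform_limit {0..T} picard solution sequentially"
  proof (rule uniform_limitI)
    fix e :: real assume "0 < e"
    have "\<forall>\<^sub>F n in sequentially. B / L * (1 / 2) ^ n * exp (2 * L * T) < e"
      using bound_tendsto_0 \<open>0 < e\<close> by (rule order_tendstoD(2))
    then show "\<forall>\<^sub>F n in sequentially. \<forall>t\<in>{0..T}. dist (picard n t) (solution t) < e"
    proof (eventually_elim, safe)
      fix n t assume n: "B / L * (1 / 2) ^ n * exp (2 * L * T) < e" and t: "t \<in> {0..T}"
      have "norm (picard n t - solution t) \<le> B / L * (1 / 2) ^ n * exp (2 * L * t)"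
        using t by (intro picard_bound) auto
      also have "\<dots> \<le> B / L * (1 / 2) ^ n * exp (2 * L * T)"
        using t L B by (intro mult_left_mono) auto
      finally show "dist (picard n t) (solution t) < e" using n by (simp add: dist_norm)
    qed
  qed
  then show "continuous_on {0..T} solution"
    by (rule uniform_limit_theorem[rotated])
      (auto intro!: always_eventually continuous_on_subset[OF continuous_picard])
qed

lemma solution_eq:
  assumes "0 \<le> t"
  shows "solution t = u0 + integral {0..t} (\<lambda>s. f s (solution s))"
proof (rule LIMSEQ_unique)
  show "(\<lambda>n. picard (Suc n) t) \<longlonglongrightarrow> solution t"
    by (rule LIMSEQ_Suc[OF picard_tendsto[OF assms]])
  have "norm (integral {0..t} (\<lambda>s. f s (picard n s)) - integral {0..t} (\<lambda>s. f s (solution s)))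
      \<le> B / (2 * L) * (1 / 2) ^ n * exp (2 * L * t)" for n
    using contraction[OF continuous_picard continuous_solution assms, of n "B / L * (1 / 2) ^ n"] picard_bound[of _ n]
    by (simp add: mult.commute)
  then have "(\<lambda>n. integral {0..t} (\<lambda>s. f s (picard n s))) \<longlonglongrightarrow> integral {0..t} (\<lambda>s. f s (solution s))"
    by (intro LIM_zero_cancel[OF Lim_null_comparison[OF always_eventually bound_tendsto_0]]) blast
  then show "(\<lambda>n. picard (Suc n) t) \<longlonglongrightarrow> u0 + integral {0..t} (\<lambda>s. f s (solution s))"
    by (auto intro!: tendsto_intros)
qed

text \<open>Iterating \<open>contraction\<close> from a crude bound \<open>K\<close> makes the
  difference arbitrarily small. The integral equations are assumed on \<open>{0..T}\<close> only,
  since solutions for different truncation levels will share an equation only as long as they stay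
  in a common box.\<close>

lemma unique:
  assumes u: "continuous_on {0..} u" and v: "continuous_on {0..} v"
    and ueq: "\<And>t. t \<in> {0..T} \<Longrightarrow> u t = u0 + integral {0..t} (\<lambda>s. f s (u s))"
    and veq: "\<And>t. t \<in> {0..T} \<Longrightarrow> v t = u0 + integral {0..t} (\<lambda>s. f s (v s))"
    and t: "t \<in> {0..T}"
  shows "u t = v t"
proof -
  have "continuous_on {0..T} (\<lambda>s. u s - v s)"
    by (intro continuous_intros continuous_on_subset[OF u] continuous_on_subset[OF v]) auto
  from compact_imp_bounded[OF compact_continuous_image[OF this]]
  obtain K where K: "K > 0" "\<And>s. s \<in> {0..T} \<Longrightarrow> norm (u s - v s) \<le> K" unfolding bounded_pos by auto
  have "norm (u t - v t) \<le> K * (1 / 2) ^ n * exp (2 * L * t)" if "t \<in> {0..T}" for n t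
    using that
  proof (induction n arbitrary: t)
    case 0
    have "norm (u t - v t) \<le> K * 1" using K(2)[OF 0] by simp
    also have "\<dots> \<le> K * exp (2 * L * t)" using K L 0 by (intro mult_left_mono) auto
    finally show ?case by simp
  next
    case (Suc n)
    have "norm (u s - v s) \<le> K * (1 / 2) ^ n * exp (2 * L * s)" if "s \<in> {0..t}" for s
      using that Suc by auto
    from contraction[OF u v _ this] Suc.prems show ?case
      by (simp add: ueq[OF Suc.prems] veq[OF Suc.prems])
  qed
  then have "norm (u t - v t) \<le> 0"
    using t by (intro tendsto_lowerbound[OF bound_tendsto_0 always_eventually]) auto
  then show ?thesis by simp
qed

end

section \<open>A priori bounds for the pathwise equation\<close>

text \<open>The inverse of the substitution: the velocity \<open>y\<close> as a function of noise
  value, position and \<open>v\<close>.\<close>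

definition drift :: "real \<Rightarrow> real \<Rightarrow> real \<Rightarrow> real \<Rightarrow> real \<Rightarrow> real" where
  "drift \<gamma> c w x v = v + \<gamma> / 3 / x ^ 3 + c * w / x\<^sup>2"

text \<open>Differentiating \<open>c * w / x^2\<close> formally produces the noise term, which
  cancels, and \<open>- 2 * c * w * y / x ^ 3\<close>, which reappears with the opposite sign in the
  equation for \<open>v\<close>. The derivative of \<open>w\<close> therefore never occurs.\<close>

definition solves_on ::
  "real \<Rightarrow> real \<Rightarrow> real \<Rightarrow> (real \<Rightarrow> real) \<Rightarrow> real \<Rightarrow> (real \<Rightarrow> real) \<Rightarrow> (real \<Rightarrow> real) \<Rightarrow> bool" where
  "solves_on \<delta> \<gamma> c w T x v \<longleftrightarrow> (\<forall>t\<in>{0..T}. 0 < x t \<and>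
     (x has_real_derivative drift \<gamma> c (w t) (x t) (v t)) (at t within {0..T}) \<and>
     (v has_real_derivative \<delta> / x t ^ 3 + 2 * c * w t * drift \<gamma> c (w t) (x t) (v t) / x t ^ 3) (at t within {0..T}))"

lemma solves_onD:
  assumes "solves_on \<delta> \<gamma> c w T x v" "t \<in> {0..T}"
  shows "0 < x t" "(x has_real_derivative drift \<gamma> c (w t) (x t) (v t)) (at t within {0..T})"
    "(v has_real_derivative \<delta> / x t ^ 3 + 2 * c * w t * drift \<gamma> c (w t) (x t) (v t) / x t ^ 3) (at t within {0..T})"
  using assms by (auto simp: solves_on_def)

lemma solves_on_continuous:
  assumes "solves_on \<delta> \<gamma> c w T x v"
  shows "continuous_on {0..T} x" "continuous_on {0..T} v"
  by (rule DERIV_continuous_on[OF solves_onD(2)[OF assms]], assumption)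
    (rule DERIV_continuous_on[OF solves_onD(3)[OF assms]], assumption)

text \<open>The sign of \<open>y\<close> is unknown at time \<open>t\<close> but known at the time
  \<open>r\<close> of the minimum of \<open>x\<close> on \<open>{0..t}\<close>. Either
  \<open>r\<close> is 0, which gives the first entry of the maximum, or the inequality for
  \<open>q\<close> at \<open>r\<close> gives the second.\<close>

lemma inverse_bound:
  assumes sol: "solves_on \<delta> \<gamma> c w T x v" and "0 < \<gamma>"
    and K: "\<And>t. t \<in> {0..T} \<Longrightarrow> \<bar>w t\<bar> \<le> K" and t: "t \<in> {0..T}"
  shows "1 / x t \<le> max (1 / x 0) ((\<bar>(x 0)\<^sup>2 * v 0 - 2 * \<gamma> / 3 / x 0\<bar> + \<bar>c\<bar> * K) / \<gamma>) * exp (\<bar>\<delta>\<bar> / \<gamma> * t)"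
proof (rule gronwall[OF _ _ _ t])
  define y where "y s = drift \<gamma> c (w s) (x s) (v s)" for s
  \<comment> \<open>this is \<open>x\<^sup>2 * y - \<gamma> / x - c * w\<close> expressed through \<open>v\<close>\<close>
  define q where "q s = (x s)\<^sup>2 * v s - 2 * \<gamma> / 3 / x s" for s
  note pos = solves_onD(1)[OF sol]
  have cont: "continuous_on {0..T} (\<lambda>s. 1 / x s)"
    by (intro continuous_intros solves_on_continuous[OF sol]) (use pos in force)
  then show "continuous_on {0..T} (\<lambda>s. 1 / x s)" .
  show "0 \<le> \<bar>\<delta>\<bar> / \<gamma>" using \<open>0 < \<gamma>\<close> by simp
  have dq: "(q has_real_derivative 2 * x s * (y s)\<^sup>2 + \<delta> / x s) (at s within {0..T})" if s: "s \<in> {0..T}" for s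
  proof -
    note d = solves_onD[OF sol s, folded y_def]
    have "(q has_real_derivative (2 * x s * y s) * v s + (x s)\<^sup>2 * (\<delta> / x s ^ 3 + 2 * c * w s * y s / x s ^ 3) +
        2 * \<gamma> / 3 * y s / (x s)\<^sup>2) (at s within {0..T})"
      unfolding q_def using d(1)
      by (auto intro!: derivative_eq_intros d(2,3) simp: power2_eq_square)
    also have "(2 * x s * y s) * v s + (x s)\<^sup>2 * (\<delta> / x s ^ 3 + 2 * c * w s * y s / x s ^ 3) + 2 * \<gamma> / 3 * y s / (x s)\<^sup>2 =
        2 * x s * y s * (v s + \<gamma> / 3 / x s ^ 3 + c * w s / (x s)\<^sup>2) + \<delta> / x s"
      using d(1) by (simp add: field_simps power2_eq_square power3_eq_cube)
    finally show ?thesis unfolding drift_def[symmetric] y_def by (simp add: power2_eq_square mult.assoc)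
  qed
  \<comment> \<open>Only the lower bound \<open>- \<bar>\<delta>\<bar> / x\<close> of the derivative
    is kept; dropping the nonnegative square removes any dependence on the velocity.\<close>
  have q_ge: "q 0 - \<bar>\<delta>\<bar> * integral {0..t} (\<lambda>s. 1 / x s) \<le> q t" if t: "t \<in> {0..T}" for t
  proof -
    define \<phi> where "\<phi> s = q s + \<bar>\<delta>\<bar> * integral {0..s} (\<lambda>s. 1 / x s)" for s
    have d: "(\<phi> has_real_derivative 2 * x s * (y s)\<^sup>2 + \<delta> / x s + \<bar>\<delta>\<bar> * (1 / x s)) (at s within {0..T})"
      if "s \<in> {0..T}" for s
      unfolding \<phi>_def using that
      by (intro DERIV_add dq DERIV_cmult integral_has_real_derivative[OF cont])
    have "\<phi> 0 \<le> \<phi> t"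
    proof (rule DERIV_nonneg_imp_increasing_open[where f=\<phi>])
      show "0 \<le> t" using t by simp
      show "continuous_on {0..t} \<phi>"
        using t by (intro continuous_on_subset[of "{0..T}", OF DERIV_continuous_on[OF d]]) auto
      fix s assume s: "0 < s" "s < t"
      then have "at s within {0..T} = at s" using t by (intro at_within_interior) auto
      with d[of s] s t have "(\<phi> has_real_derivative 2 * x s * (y s)\<^sup>2 + \<delta> / x s + \<bar>\<delta>\<bar> * (1 / x s)) (at s)"
        by auto
      moreover have "0 \<le> (\<delta> + \<bar>\<delta>\<bar>) / x s" "0 \<le> 2 * x s * (y s)\<^sup>2"
        using pos[of s] s t by (auto intro!: mult_nonneg_nonneg divide_nonneg_nonneg)
      moreover have "2 * x s * (y s)\<^sup>2 + \<delta> / x s + \<bar>\<delta>\<bar> * (1 / x s) = 2 * x s * (y s)\<^sup>2 + (\<delta> + \<bar>\<delta>\<bar>) / x s"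
        by (simp add: add_divide_distrib)
      ultimately show "\<exists>d. (\<phi> has_real_derivative d) (at s) \<and> 0 \<le> d"
        by (metis add_nonneg_nonneg)
    qed
    then show ?thesis by (simp add: \<phi>_def)
  qed
  fix t assume t: "t \<in> {0..T}"
  let ?K = "max (1 / x 0) ((\<bar>(x 0)\<^sup>2 * v 0 - 2 * \<gamma> / 3 / x 0\<bar> + \<bar>c\<bar> * K) / \<gamma>)"
  have int: "(\<lambda>s. 1 / x s) integrable_on {0..s}" if "s \<in> {0..T}" for s
    using that by (intro integrable_continuous_real continuous_on_subset[OF cont]) auto
  obtain r where r: "r \<in> {0..t}" "\<And>s. s \<in> {0..t} \<Longrightarrow> x r \<le> x s"
    using continuous_attains_inf[of "{0..t}" x] continuous_on_subset[OF solves_on_continuous(1)[OF sol], of "{0..t}"] t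
    by auto
  have rT: "r \<in> {0..T}" using r t by auto
  have "1 / x t \<le> 1 / x r" using r(2)[of t] pos[OF rT] pos[OF t] t by (intro divide_left_mono mult_pos_pos) auto
  also have "1 / x r \<le> ?K + \<bar>\<delta>\<bar> / \<gamma> * integral {0..r} (\<lambda>s. 1 / x s)"
  proof (cases "r = 0")
    case False
    \<comment> \<open>With positive slope at \<open>r\<close>, the position would be smaller shortly
      before. The left-sided argument also covers \<open>r = t\<close>.\<close>
    have "y r \<le> 0"
    proof (rule ccontr)
      assume "\<not> y r \<le> 0"
      then obtain d where d: "d > 0" "\<And>h. 0 < h \<Longrightarrow> r - h \<in> {0..T} \<Longrightarrow> h < d \<Longrightarrow> x (r - h) < x r"
        using has_real_derivative_pos_inc_left[OF solves_onD(2)[OF sol rT]] unfolding y_def by auto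
      define h where "h = min (d / 2) (r / 2)"
      have "0 < h" "h < d" "r - h \<in> {0..t}" using d(1) r(1) False by (auto simp: h_def min_def)
      then have "x (r - h) < x r" using d(2)[of h] t by auto
      then show False using r(2)[OF \<open>r - h \<in> {0..t}\<close>] by simp
    qed
    then have "(x r)\<^sup>2 * y r \<le> 0" by (simp add: mult_nonneg_nonpos)
    moreover have "(x r)\<^sup>2 * y r = q r + c * w r + \<gamma> / x r"
      using pos[OF rT] by (simp add: y_def drift_def q_def field_simps power2_eq_square power3_eq_cube)
    ultimately have "\<gamma> / x r \<le> - q r - c * w r" by simp
    moreover have "- (c * w r) \<le> \<bar>c\<bar> * K"
      using K[OF rT] by (metis abs_ge_minus_self abs_mult abs_ge_zero mult_left_mono order.trans)
    moreover have "- q r \<le> \<bar>q 0\<bar> + \<bar>\<delta>\<bar> * integral {0..r} (\<lambda>s. 1 / x s)" using q_ge[OF rT] by linarith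
    ultimately have "\<gamma> / x r \<le> \<bar>q 0\<bar> + \<bar>\<delta>\<bar> * integral {0..r} (\<lambda>s. 1 / x s) + \<bar>c\<bar> * K" by linarith
    then have "\<gamma> / x r / \<gamma> \<le> (\<bar>q 0\<bar> + \<bar>\<delta>\<bar> * integral {0..r} (\<lambda>s. 1 / x s) + \<bar>c\<bar> * K) / \<gamma>"
      using \<open>0 < \<gamma>\<close> by (intro divide_right_mono) auto
    then have "1 / x r \<le> (\<bar>q 0\<bar> + \<bar>c\<bar> * K) / \<gamma> + \<bar>\<delta>\<bar> / \<gamma> * integral {0..r} (\<lambda>s. 1 / x s)"
      using \<open>0 < \<gamma>\<close> by (simp add: add_divide_distrib)
    then show ?thesis unfolding q_def by simp
  qed simp
  also have "\<dots> \<le> ?K + \<bar>\<delta>\<bar> / \<gamma> * integral {0..t} (\<lambda>s. 1 / x s)"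
    using r(1) t \<open>0 < \<gamma>\<close> pos
    by (intro add_left_mono mult_left_mono integral_subset_le int) (auto simp: less_imp_le)
  finally show "1 / x t \<le> ?K + \<bar>\<delta>\<bar> / \<gamma> * integral {0..t} (\<lambda>s. 1 / x s)" .
qed

text \<open>With \<open>1 / x\<close> and \<open>w\<close> bounded, the rate of \<open>v\<close> is
  at most affine in \<open>\<bar>v\<bar>\<close>: the part of \<open>drift\<close> free of
  \<open>v\<close> goes into the constant term, and the coefficient of \<open>v\<close> into the
  exponent of Gronwall's inequality.\<close>

lemma velocity_bound:
  assumes sol: "solves_on \<delta> \<gamma> c w T x v" and "0 < \<gamma>"
    and K: "\<And>t. t \<in> {0..T} \<Longrightarrow> \<bar>w t\<bar> \<le> K" and G: "\<And>t. t \<in> {0..T} \<Longrightarrow> 1 / x t \<le> G"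
    and t: "t \<in> {0..T}"
  shows "\<bar>v t\<bar> \<le> (\<bar>v 0\<bar> + (\<bar>\<delta>\<bar> * G ^ 3 + 2 * \<bar>c\<bar> * K * G ^ 3 * (\<gamma> / 3 * G ^ 3 + \<bar>c\<bar> * K * G\<^sup>2)) * T)
    * exp (2 * \<bar>c\<bar> * K * G ^ 3 * t)"
proof (rule gronwall[OF _ _ _ t])
  let ?a = "\<bar>\<delta>\<bar> * G ^ 3 + 2 * \<bar>c\<bar> * K * G ^ 3 * (\<gamma> / 3 * G ^ 3 + \<bar>c\<bar> * K * G\<^sup>2)"
  let ?b = "2 * \<bar>c\<bar> * K * G ^ 3"
  define v' where "v' s = \<delta> / x s ^ 3 + 2 * c * w s * drift \<gamma> c (w s) (x s) (v s) / x s ^ 3" for s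
  note pos = solves_onD(1)[OF sol]
  have K0: "0 \<le> K" using K[OF t] by linarith
  have "0 < 1 / x t" using pos[OF t] by simp
  then have G0: "0 \<le> G" using G[OF t] by linarith
  have a0: "0 \<le> ?a" and b0: "0 \<le> ?b" using K0 G0 \<open>0 < \<gamma>\<close> by (auto intro!: add_nonneg_nonneg mult_nonneg_nonneg)
  show "0 \<le> ?b" by (rule b0)
  have cv: "continuous_on {0..T} (\<lambda>s. \<bar>v s\<bar>)" by (intro continuous_intros solves_on_continuous[OF sol])
  then show "continuous_on {0..T} (\<lambda>s. \<bar>v s\<bar>)" .
  have rate: "\<bar>v' s\<bar> \<le> ?a + ?b * \<bar>v s\<bar>" if s: "s \<in> {0..T}" for s
  proof -
    let ?r = "1 / x s"
    have r: "0 \<le> ?r" "?r \<le> G" using pos[OF s] G[OF s] by (auto simp: less_imp_le)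
    have r2: "?r\<^sup>2 \<le> G\<^sup>2" and r3: "?r ^ 3 \<le> G ^ 3" using r by (auto intro: power_mono)
    have w: "\<bar>w s\<bar> \<le> K" by (rule K[OF s])
    have "\<bar>drift \<gamma> c (w s) (x s) (v s)\<bar> \<le> \<bar>v s\<bar> + \<gamma> / 3 * ?r ^ 3 + \<bar>c\<bar> * \<bar>w s\<bar> * ?r\<^sup>2"
    proof -
      have "drift \<gamma> c (w s) (x s) (v s) = v s + \<gamma> / 3 * ?r ^ 3 + c * w s * ?r\<^sup>2"
        by (simp add: drift_def power_one_over)
      also have "\<bar>\<dots>\<bar> \<le> \<bar>v s\<bar> + \<bar>\<gamma> / 3 * ?r ^ 3\<bar> + \<bar>c * w s * ?r\<^sup>2\<bar>" by linarith
      also have "\<bar>\<gamma> / 3 * ?r ^ 3\<bar> = \<gamma> / 3 * ?r ^ 3" using r \<open>0 < \<gamma>\<close> by (intro abs_of_nonneg mult_nonneg_nonneg) auto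
      also have "\<bar>c * w s * ?r\<^sup>2\<bar> = \<bar>c\<bar> * \<bar>w s\<bar> * ?r\<^sup>2" by (simp only: abs_mult abs_power2)
      finally show ?thesis .
    qed
    also have "\<dots> \<le> \<bar>v s\<bar> + \<gamma> / 3 * G ^ 3 + \<bar>c\<bar> * K * G\<^sup>2"
      using r2 r3 w K0 \<open>0 < \<gamma>\<close> less_imp_le[OF pos[OF s]] by (intro add_mono mult_mono order.refl) auto
    finally have y: "\<bar>drift \<gamma> c (w s) (x s) (v s)\<bar> \<le> \<bar>v s\<bar> + \<gamma> / 3 * G ^ 3 + \<bar>c\<bar> * K * G\<^sup>2" (is "_ \<le> ?Y") .
    have "\<bar>v' s\<bar> \<le> \<bar>\<delta>\<bar> * ?r ^ 3 + 2 * \<bar>c\<bar> * \<bar>w s\<bar> * ?r ^ 3 * \<bar>drift \<gamma> c (w s) (x s) (v s)\<bar>"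
    proof -
      have "v' s = \<delta> * ?r ^ 3 + 2 * c * w s * ?r ^ 3 * drift \<gamma> c (w s) (x s) (v s)"
        by (simp add: v'_def power_one_over)
      also have "\<bar>\<dots>\<bar> \<le> \<bar>\<delta> * ?r ^ 3\<bar> + \<bar>2 * c * w s * ?r ^ 3 * drift \<gamma> c (w s) (x s) (v s)\<bar>" by (rule abs_triangle_ineq)
      also have "\<dots> = \<bar>\<delta>\<bar> * ?r ^ 3 + 2 * \<bar>c\<bar> * \<bar>w s\<bar> * ?r ^ 3 * \<bar>drift \<gamma> c (w s) (x s) (v s)\<bar>"
        using abs_of_nonneg[OF zero_le_power[OF r(1), of 3]] by (simp only: abs_mult abs_numeral)
      finally show ?thesis .
    qed
    also have "\<dots> \<le> \<bar>\<delta>\<bar> * G ^ 3 + 2 * \<bar>c\<bar> * K * G ^ 3 * ?Y"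
      by (intro add_mono mult_mono mult_nonneg_nonneg zero_le_power r3 w y order.refl)
        (use r K0 G0 in auto)
    finally show ?thesis by (simp add: algebra_simps)
  qed
  fix t assume t: "t \<in> {0..T}"
  have I: "(v' has_integral v t - v 0) {0..t}"
    using t by (intro fundamental_theorem_of_calculus)
      (auto simp: v'_def simp flip: has_real_derivative_iff_has_vector_derivative
        intro!: DERIV_subset[OF solves_onD(3)[OF sol]])
  have ci: "(\<lambda>s. \<bar>v s\<bar>) integrable_on {0..t}"
    using t by (intro integrable_continuous_real continuous_on_subset[OF cv]) auto
  have J: "((\<lambda>s. ?a + ?b * \<bar>v s\<bar>) has_integral ?a * t + ?b * integral {0..t} (\<lambda>s. \<bar>v s\<bar>)) {0..t}"
    using has_integral_const_real[of ?a 0 t] t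
    by (intro has_integral_add has_integral_mult_right integrable_integral ci) (simp add: mult.commute)
  have "norm (integral {0..t} v') \<le> integral {0..t} (\<lambda>s. ?a + ?b * \<bar>v s\<bar>)"
    by (rule integral_norm_bound_integral) (use I J rate t in auto)
  then have "\<bar>v t - v 0\<bar> \<le> ?a * t + ?b * integral {0..t} (\<lambda>s. \<bar>v s\<bar>)"
    using integral_unique[OF I] integral_unique[OF J] by simp
  moreover have "?a * t \<le> ?a * T" using t a0 by (intro mult_left_mono) auto
  ultimately show "\<bar>v t\<bar> \<le> \<bar>v 0\<bar> + ?a * T + ?b * integral {0..t} (\<lambda>s. \<bar>v s\<bar>)" by linarith
qed

text \<open>One constant serves all shorter intervals \<open>{0..T'}\<close>, because it will be
  applied up to a first exit time that is not known beforehand. The inequalities are strict so that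
  reaching the boundary of the box is already a contradiction.\<close>

lemma a_priori:
  assumes "0 < \<gamma>" "0 < x0" "0 \<le> T" and K: "\<And>t. t \<in> {0..T} \<Longrightarrow> \<bar>w t\<bar> \<le> K"
  obtains A where "0 < A" "1 / A < x0" "\<bar>v0\<bar> < A"
    "\<And>T' x v t. T' \<in> {0..T} \<Longrightarrow> solves_on \<delta> \<gamma> c w T' x v \<Longrightarrow> x 0 = x0 \<Longrightarrow> v 0 = v0 \<Longrightarrow> t \<in> {0..T'} \<Longrightarrow>
      1 / A < x t \<and> \<bar>v t\<bar> < A"
proof -
  define K1 where "K1 = max (1 / x0) ((\<bar>x0\<^sup>2 * v0 - 2 * \<gamma> / 3 / x0\<bar> + \<bar>c\<bar> * K) / \<gamma>)"
  define G where "G = K1 * exp (\<bar>\<delta>\<bar> / \<gamma> * T)"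
  define a where "a = \<bar>\<delta>\<bar> * G ^ 3 + 2 * \<bar>c\<bar> * K * G ^ 3 * (\<gamma> / 3 * G ^ 3 + \<bar>c\<bar> * K * G\<^sup>2)"
  define b where "b = 2 * \<bar>c\<bar> * K * G ^ 3"
  define V where "V = (\<bar>v0\<bar> + a * T) * exp (b * T)"
  \<comment> \<open>Adding 1 turns the weak bounds by \<open>G\<close> and \<open>V\<close> into
    strict ones.\<close>
  define A where "A = max G V + 1"
  have K0: "0 \<le> K" using K[of 0] \<open>0 \<le> T\<close> by auto
  have x0: "0 < 1 / x0" "1 / x0 \<le> K1" using \<open>0 < x0\<close> by (auto simp: K1_def)
  then have K1: "0 \<le> K1" by linarith
  have "K1 * 1 \<le> G" unfolding G_def using K1 assms by (intro mult_left_mono) auto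
  then have G: "K1 \<le> G" by simp
  then have G': "0 < G" using x0 by linarith
  have a0: "0 \<le> a" and b0: "0 \<le> b"
    using K0 G' \<open>0 < \<gamma>\<close> by (auto simp: a_def b_def intro!: add_nonneg_nonneg mult_nonneg_nonneg)
  have aT: "0 \<le> a * T" using a0 \<open>0 \<le> T\<close> by simp
  then have "\<bar>v0\<bar> \<le> (\<bar>v0\<bar> + a * T) * 1" by simp
  also have "\<dots> \<le> V"
    unfolding V_def using b0 aT \<open>0 \<le> T\<close> by (intro mult_left_mono) auto
  finally have V: "\<bar>v0\<bar> \<le> V" .
  have inv: "1 / A < z" if "0 < z" "1 / z \<le> G" for z
  proof -
    have "1 / z < A" using that by (simp add: A_def)
    then show ?thesis using that G' by (simp add: A_def field_simps)
  qed
  show ?thesis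
  proof
    show "0 < A" using G' by (simp add: A_def)
    show "1 / A < x0" using x0 G by (intro inv \<open>0 < x0\<close>) linarith
    show "\<bar>v0\<bar> < A" using V by (simp add: A_def)
    fix T' x v t
    assume T': "T' \<in> {0..T}" and sol: "solves_on \<delta> \<gamma> c w T' x v" and init: "x 0 = x0" "v 0 = v0" and t: "t \<in> {0..T'}"
    have K': "\<bar>w s\<bar> \<le> K" if "s \<in> {0..T'}" for s using K that T' by auto
    have inv_le: "1 / x s \<le> G" if s: "s \<in> {0..T'}" for s
    proof -
      have "1 / x s \<le> K1 * exp (\<bar>\<delta>\<bar> / \<gamma> * s)"
        using inverse_bound[OF sol \<open>0 < \<gamma>\<close> K' s] unfolding init K1_def by simp
      also have "\<dots> \<le> G" unfolding G_def using K1 s T' \<open>0 < \<gamma>\<close> by (intro mult_left_mono) (auto intro!: divide_right_mono mult_left_mono)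
      finally show ?thesis .
    qed
    have "\<bar>v t\<bar> \<le> (\<bar>v0\<bar> + a * T') * exp (b * t)"
      using velocity_bound[OF sol \<open>0 < \<gamma>\<close> K' inv_le t] unfolding init a_def b_def by simp
    also have "\<dots> \<le> V"
      unfolding V_def using a0 b0 T' t
      by (intro mult_mono add_mono order.refl mult_left_mono) (auto intro!: mult_left_mono mult_nonneg_nonneg)
    finally show "1 / A < x t \<and> \<bar>v t\<bar> < A"
      using inv[OF solves_onD(1)[OF sol t] inv_le[OF t]] by (simp add: A_def)
  qed
qed

section \<open>Global solutions of the pathwise equation\<close>

text \<open>Boundedness belongs to the notion because products of Lipschitz functions stay Lipschitz
  only when the factors are bounded; with it the class is closed under all operations that build the
  field.\<close>

definition bounded_lipschitz :: "('a::metric_space \<Rightarrow> real) \<Rightarrow> bool" where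
  "bounded_lipschitz h \<longleftrightarrow> (\<exists>B. \<forall>p. \<bar>h p\<bar> \<le> B) \<and> (\<exists>L. \<forall>p q. \<bar>h p - h q\<bar> \<le> L * dist p q)"

lemma bounded_lipschitz_const: "bounded_lipschitz (\<lambda>_. a)"
  unfolding bounded_lipschitz_def by (intro conjI exI[of _ "\<bar>a\<bar>"] exI[of _ 0]) auto

lemma bounded_lipschitz_add:
  assumes "bounded_lipschitz f" "bounded_lipschitz g"
  shows "bounded_lipschitz (\<lambda>p. f p + g p)"
proof -
  from assms obtain B1 L1 B2 L2 where f: "\<And>p. \<bar>f p\<bar> \<le> B1" "\<And>p q. \<bar>f p - f q\<bar> \<le> L1 * dist p q"
    and g: "\<And>p. \<bar>g p\<bar> \<le> B2" "\<And>p q. \<bar>g p - g q\<bar> \<le> L2 * dist p q"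
    unfolding bounded_lipschitz_def by blast
  show ?thesis
    unfolding bounded_lipschitz_def
  proof (intro conjI exI allI)
    fix p q
    show "\<bar>f p + g p\<bar> \<le> B1 + B2" using f(1)[of p] g(1)[of p] by linarith
    show "\<bar>(f p + g p) - (f q + g q)\<bar> \<le> (L1 + L2) * dist p q"
      using f(2)[of p q] g(2)[of p q] unfolding distrib_right by linarith
  qed
qed

lemma bounded_lipschitz_mult:
  assumes "bounded_lipschitz f" "bounded_lipschitz g"
  shows "bounded_lipschitz (\<lambda>p. f p * g p)"
proof -
  from assms obtain B1 L1 B2 L2 where f: "\<And>p. \<bar>f p\<bar> \<le> B1" "\<And>p q. \<bar>f p - f q\<bar> \<le> L1 * dist p q"
    and g: "\<And>p. \<bar>g p\<bar> \<le> B2" "\<And>p q. \<bar>g p - g q\<bar> \<le> L2 * dist p q"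
    unfolding bounded_lipschitz_def by blast
  have B: "0 \<le> B1" "0 \<le> B2" using f(1)[of undefined] g(1)[of undefined] by linarith+
  show ?thesis
    unfolding bounded_lipschitz_def
  proof (intro conjI exI allI)
    fix p q
    show "\<bar>f p * g p\<bar> \<le> B1 * B2" unfolding abs_mult by (intro mult_mono f g B) auto
    have "f p * g p - f q * g q = f p * (g p - g q) + (f p - f q) * g q" by (simp add: algebra_simps)
    then have "\<bar>f p * g p - f q * g q\<bar> \<le> \<bar>f p\<bar> * \<bar>g p - g q\<bar> + \<bar>f p - f q\<bar> * \<bar>g q\<bar>"
      by (metis abs_mult abs_triangle_ineq)
    also have "\<dots> \<le> B1 * (L2 * dist p q) + (L1 * dist p q) * B2"
      using order.trans[OF abs_ge_zero f(2)[of p q]]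
      by (intro add_mono mult_mono f g B) auto
    also have "\<dots> = (B1 * L2 + L1 * B2) * dist p q" by (simp add: algebra_simps)
    finally show "\<bar>f p * g p - f q * g q\<bar> \<le> (B1 * L2 + L1 * B2) * dist p q" .
  qed
qed

lemma bounded_lipschitz_power: "bounded_lipschitz f \<Longrightarrow> bounded_lipschitz (\<lambda>p. f p ^ k)"
  by (induction k) (auto intro: bounded_lipschitz_const bounded_lipschitz_mult)

definition clamp :: "real \<Rightarrow> real \<Rightarrow> real" where
  "clamp n a = max (- n) (min n a)"

lemma clamp_id: "\<bar>a\<bar> \<le> n \<Longrightarrow> clamp n a = a"
  by (auto simp: clamp_def)

lemma bounded_lipschitz_clamp:
  fixes f :: "'a::metric_space \<Rightarrow> real"
  assumes "\<And>p q. \<bar>f p - f q\<bar> \<le> dist p q" "0 < n"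
  shows "bounded_lipschitz (\<lambda>p. clamp n (f p))"
proof -
  have 1: "\<bar>clamp n (f p)\<bar> \<le> n" for p using assms(2) by (auto simp: clamp_def)
  have 2: "\<bar>clamp n (f p) - clamp n (f q)\<bar> \<le> 1 * dist p q" for p q
  proof -
    have "\<bar>clamp n (f p) - clamp n (f q)\<bar> \<le> \<bar>f p - f q\<bar>" by (auto simp: clamp_def min_def max_def)
    with assms(1)[of p q] show ?thesis by linarith
  qed
  show ?thesis unfolding bounded_lipschitz_def using 1 2 by blast
qed

lemma bounded_lipschitz_inverse:
  fixes f :: "'a::metric_space \<Rightarrow> real"
  assumes "\<And>p q. \<bar>f p - f q\<bar> \<le> dist p q" "0 < n"
  shows "bounded_lipschitz (\<lambda>p. 1 / max (1 / n) (f p))"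
proof -
  have "\<bar>1 / max (1 / n) (f p)\<bar> \<le> n \<and>
    \<bar>1 / max (1 / n) (f p) - 1 / max (1 / n) (f q)\<bar> \<le> n * n * dist p q" for p q
  proof
    let ?a = "max (1 / n) (f p)" and ?b = "max (1 / n) (f q)"
    have n: "0 < 1 / n" "1 / n \<le> ?a" "1 / n \<le> ?b" using assms(2) by auto
    then have pos: "0 < ?a" "0 < ?b" by linarith+
    have inv: "1 / z \<le> n" if "1 / n \<le> z" for z
      using divide_left_mono[OF that, of 1] n(1) that assms(2) by simp
    show "\<bar>1 / ?a\<bar> \<le> n" using inv[OF n(2)] pos by simp
    have "1 / ?a - 1 / ?b = (1 / ?a) * (1 / ?b) * (?b - ?a)" using pos by (simp add: field_simps)
    then have "\<bar>1 / ?a - 1 / ?b\<bar> = \<bar>1 / ?a\<bar> * \<bar>1 / ?b\<bar> * \<bar>?b - ?a\<bar>" by (simp only: abs_mult)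
    also have "\<dots> \<le> n * n * dist p q"
    proof (intro mult_mono)
      have "\<bar>?b - ?a\<bar> \<le> \<bar>f p - f q\<bar>" by (auto simp: max_def)
      with assms(1)[of p q] show "\<bar>?b - ?a\<bar> \<le> dist p q" by linarith
    qed (use inv[OF n(2)] inv[OF n(3)] pos assms(2) in auto)
    finally show "\<bar>1 / ?a - 1 / ?b\<bar> \<le> n * n * dist p q" .
  qed
  then show ?thesis unfolding bounded_lipschitz_def by blast
qed

text \<open>The argument is the triple of noise value, position and \<open>v\<close>. Each
  occurrence of a coordinate is truncated separately, which changes nothing when \<open>x\<close> is
  at least \<open>1 / n\<close> and \<open>v\<close>, \<open>w\<close> are at most \<open>n\<close>
  in absolute value.\<close>

definition trunc_drift :: "real \<Rightarrow> real \<Rightarrow> real \<Rightarrow> real \<times> real \<times> real \<Rightarrow> real" where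
  "trunc_drift \<gamma> c n p = clamp n (snd (snd p)) + \<gamma> / 3 * (1 / max (1 / n) (fst (snd p))) ^ 3
     + c * (clamp n (fst p) * (1 / max (1 / n) (fst (snd p)))\<^sup>2)"

definition trunc_field :: "real \<Rightarrow> real \<Rightarrow> real \<Rightarrow> real \<Rightarrow> real \<times> real \<times> real \<Rightarrow> real \<times> real" where
  "trunc_field \<delta> \<gamma> c n p = (trunc_drift \<gamma> c n p,
     \<delta> * (1 / max (1 / n) (fst (snd p))) ^ 3
     + 2 * c * (clamp n (fst p) * (1 / max (1 / n) (fst (snd p))) ^ 3 * trunc_drift \<gamma> c n p))"

lemma trunc_field_eq:
  assumes "0 < n" "1 / n \<le> x" "\<bar>v\<bar> \<le> n" "\<bar>w\<bar> \<le> n"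
  shows "trunc_field \<delta> \<gamma> c n (w, x, v) =
    (drift \<gamma> c w x v, \<delta> / x ^ 3 + 2 * c * w * drift \<gamma> c w x v / x ^ 3)"
proof -
  have "max (1 / n) x = x" using assms by simp
  then show ?thesis
    using assms by (simp add: trunc_field_def trunc_drift_def drift_def clamp_id power_one_over)
qed

lemma trunc_field_lipschitz:
  assumes "0 < n"
  obtains L B where "0 < L" "0 \<le> B" "\<And>p q. norm (trunc_field \<delta> \<gamma> c n p - trunc_field \<delta> \<gamma> c n q) \<le> L * dist p q"
    "\<And>p. norm (trunc_field \<delta> \<gamma> c n p) \<le> B"
proof -
  have d: "\<bar>fst p - fst q\<bar> \<le> dist p q" "\<bar>fst (snd p) - fst (snd q)\<bar> \<le> dist p q" "\<bar>snd (snd p) - snd (snd q)\<bar> \<le> dist p q"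
    for p q :: "real \<times> real \<times> real"
    using dist_fst_le[of p q] dist_snd_le[of p q] dist_fst_le[of "snd p" "snd q"] dist_snd_le[of "snd p" "snd q"]
    by (auto simp: dist_real_def)
  note bl = bounded_lipschitz_const bounded_lipschitz_add bounded_lipschitz_mult bounded_lipschitz_power
    bounded_lipschitz_clamp[OF _ assms] bounded_lipschitz_inverse[OF _ assms] d
  have 1: "bounded_lipschitz (trunc_drift \<gamma> c n)"
    unfolding trunc_drift_def[abs_def] by (intro bl)
  then have 2: "bounded_lipschitz (\<lambda>p. snd (trunc_field \<delta> \<gamma> c n p))"
    unfolding trunc_field_def snd_conv by (intro bl)
  from 1 2 obtain B1 L1 B2 L2 where
    b: "\<And>p. \<bar>trunc_drift \<gamma> c n p\<bar> \<le> B1" "\<And>p. \<bar>snd (trunc_field \<delta> \<gamma> c n p)\<bar> \<le> B2"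
    and l: "\<And>p q. \<bar>trunc_drift \<gamma> c n p - trunc_drift \<gamma> c n q\<bar> \<le> L1 * dist p q"
      "\<And>p q. \<bar>snd (trunc_field \<delta> \<gamma> c n p) - snd (trunc_field \<delta> \<gamma> c n q)\<bar> \<le> L2 * dist p q"
    unfolding bounded_lipschitz_def by blast
  have fst_eq: "fst (trunc_field \<delta> \<gamma> c n p) = trunc_drift \<gamma> c n p" for p by (simp add: trunc_field_def)
  have norm_le: "norm z \<le> \<bar>fst z\<bar> + \<bar>snd z\<bar>" for z :: "real \<times> real"
    using norm_Pair_le[of "fst z" "snd z"] by simp
  show ?thesis
  proof (rule that[of "\<bar>L1\<bar> + \<bar>L2\<bar> + 1" "B1 + B2"])
    show "0 \<le> B1 + B2" using b(1)[of 0] b(2)[of 0] by linarith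
    show "norm (trunc_field \<delta> \<gamma> c n p) \<le> B1 + B2" for p
      using norm_le[of "trunc_field \<delta> \<gamma> c n p"] b(1)[of p] b(2)[of p] unfolding fst_eq by linarith
    show "norm (trunc_field \<delta> \<gamma> c n p - trunc_field \<delta> \<gamma> c n q) \<le> (\<bar>L1\<bar> + \<bar>L2\<bar> + 1) * dist p q" for p q
    proof -
      have "norm (trunc_field \<delta> \<gamma> c n p - trunc_field \<delta> \<gamma> c n q) \<le> L1 * dist p q + L2 * dist p q"
        using norm_le[of "trunc_field \<delta> \<gamma> c n p - trunc_field \<delta> \<gamma> c n q"] l(1)[of p q] l(2)[of p q]
        unfolding fst_diff snd_diff fst_eq by linarith
      also have "\<dots> = (L1 + L2) * dist p q" by (simp add: algebra_simps)
      also have "\<dots> \<le> (\<bar>L1\<bar> + \<bar>L2\<bar> + 1) * dist p q" by (intro mult_right_mono) auto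
      finally show ?thesis .
    qed
  qed simp
qed

lemma continuous_trunc_field:
  assumes "0 < n"
  shows "continuous_on UNIV (trunc_field \<delta> \<gamma> c n)"
proof -
  obtain L B where "0 < L" "\<And>p q. norm (trunc_field \<delta> \<gamma> c n p - trunc_field \<delta> \<gamma> c n q) \<le> L * dist p q"
    using trunc_field_lipschitz[OF assms] by metis
  then have "L-lipschitz_on UNIV (trunc_field \<delta> \<gamma> c n)"
    by (auto simp: lipschitz_on_def dist_norm)
  then show ?thesis by (rule lipschitz_on_continuous_on)
qed

lemma lipschitz_ode_trunc:
  assumes "0 < n" and w: "continuous_on {0..} w"
  shows "\<exists>L B. lipschitz_ode (\<lambda>t u. trunc_field \<delta> \<gamma> c n (w t, u)) L B"
proof -
  obtain L B where LB: "0 < L" "0 \<le> B" "\<And>p q. norm (trunc_field \<delta> \<gamma> c n p - trunc_field \<delta> \<gamma> c n q) \<le> L * dist p q"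
    "\<And>p. norm (trunc_field \<delta> \<gamma> c n p) \<le> B"
    using trunc_field_lipschitz[OF assms(1)] by metis
  have "lipschitz_ode (\<lambda>t u. trunc_field \<delta> \<gamma> c n (w t, u)) L B"
  proof
    show "norm (trunc_field \<delta> \<gamma> c n (w t, u) - trunc_field \<delta> \<gamma> c n (w t, v)) \<le> L * norm (u - v)" for t u v
      using LB(3)[of "(w t, u)" "(w t, v)"] by (simp add: dist_Pair_Pair dist_norm)
    show "continuous_on {0..} (\<lambda>s. trunc_field \<delta> \<gamma> c n (w s, u s))" if "continuous_on {0..} u" for u
      by (rule continuous_on_compose2[OF continuous_trunc_field[OF assms(1)]])
        (auto intro!: continuous_intros w that)
  qed (use LB in auto)
  then show ?thesis by blast
qed

section \<open>Solutions of the truncated equations and removal of the truncation\<close>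

text \<open>The level is \<open>Suc n\<close>, so that the truncation bound is positive for every
  \<open>n\<close>.\<close>

definition trunc_solution ::
  "real \<Rightarrow> real \<Rightarrow> real \<Rightarrow> (real \<Rightarrow> real) \<Rightarrow> real \<times> real \<Rightarrow> nat \<Rightarrow> real \<Rightarrow> real \<times> real" where
  "trunc_solution \<delta> \<gamma> c w u0 n =
     lipschitz_ode.solution (\<lambda>t u. trunc_field \<delta> \<gamma> c (real (Suc n)) (w t, u)) u0"

text \<open>A sufficient level depends on the path and on the time interval; the limit over all
  levels avoids selecting one and is measurable in the path.\<close>

definition path_solution ::
  "real \<Rightarrow> real \<Rightarrow> real \<Rightarrow> (real \<Rightarrow> real) \<Rightarrow> real \<times> real \<Rightarrow> real \<Rightarrow> real \<times> real" where
  "path_solution \<delta> \<gamma> c w u0 t = lim (\<lambda>n. trunc_solution \<delta> \<gamma> c w u0 n t)"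

lemma trunc_solution_eq:
  assumes w: "continuous_on {0..} w"
  shows "continuous_on {0..} (trunc_solution \<delta> \<gamma> c w u0 n)"
    and "0 \<le> t \<Longrightarrow> trunc_solution \<delta> \<gamma> c w u0 n t =
      u0 + integral {0..t} (\<lambda>s. trunc_field \<delta> \<gamma> c (real (Suc n)) (w s, trunc_solution \<delta> \<gamma> c w u0 n s))"
proof -
  obtain L B where *: "lipschitz_ode (\<lambda>t u. trunc_field \<delta> \<gamma> c (real (Suc n)) (w t, u)) L B"
    using lipschitz_ode_trunc[OF _ w, of "real (Suc n)" \<delta> \<gamma> c] by (auto simp del: of_nat_Suc)
  show "continuous_on {0..} (trunc_solution \<delta> \<gamma> c w u0 n)"
    "0 \<le> t \<Longrightarrow> trunc_solution \<delta> \<gamma> c w u0 n t =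
      u0 + integral {0..t} (\<lambda>s. trunc_field \<delta> \<gamma> c (real (Suc n)) (w s, trunc_solution \<delta> \<gamma> c w u0 n s))"
    unfolding trunc_solution_def
    by (rule lipschitz_ode.continuous_solution[OF *]) (rule lipschitz_ode.solution_eq[OF *])
qed

lemma trunc_solution_deriv:
  assumes w: "continuous_on {0..} w" and t: "t \<in> {0..T}"
  shows "(trunc_solution \<delta> \<gamma> c w u0 n has_vector_derivative
     trunc_field \<delta> \<gamma> c (real (Suc n)) (w t, trunc_solution \<delta> \<gamma> c w u0 n t)) (at t within {0..T})"
proof -
  let ?u = "trunc_solution \<delta> \<gamma> c w u0 n" and ?f = "\<lambda>s. trunc_field \<delta> \<gamma> c (real (Suc n)) (w s, trunc_solution \<delta> \<gamma> c w u0 n s)"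
  have "continuous_on {0..} ?f"
    by (rule continuous_on_compose2[OF continuous_trunc_field])
      (auto intro!: continuous_intros w trunc_solution_eq(1))
  then have "continuous_on {0..T} ?f" by (rule continuous_on_subset) auto
  from integral_has_vector_derivative[OF this t]
  have "((\<lambda>t. u0 + integral {0..t} ?f) has_vector_derivative 0 + ?f t) (at t within {0..T})"
    by (intro has_vector_derivative_add has_vector_derivative_const)
  then show ?thesis
    using trunc_solution_eq(2)[OF w] t
    by (intro has_vector_derivative_transform[of t "{0..T}" ?u "\<lambda>t. u0 + integral {0..t} ?f"]) auto
qed

lemma trunc_solves_on:
  assumes w: "continuous_on {0..} w"
    and box: "\<And>t. t \<in> {0..T} \<Longrightarrow> 1 / A \<le> fst (trunc_solution \<delta> \<gamma> c w u0 n t) \<and>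
      \<bar>snd (trunc_solution \<delta> \<gamma> c w u0 n t)\<bar> \<le> A \<and> \<bar>w t\<bar> \<le> A"
    and A: "0 < A" "A \<le> real (Suc n)"
  shows "solves_on \<delta> \<gamma> c w T (\<lambda>t. fst (trunc_solution \<delta> \<gamma> c w u0 n t)) (\<lambda>t. snd (trunc_solution \<delta> \<gamma> c w u0 n t))"
  unfolding solves_on_def
proof (intro ballI conjI)
  fix t assume t: "t \<in> {0..T}"
  let ?u = "trunc_solution \<delta> \<gamma> c w u0 n"
  have "1 / real (Suc n) \<le> 1 / A" using A by (intro divide_left_mono) auto
  with box[OF t] A have "trunc_field \<delta> \<gamma> c (real (Suc n)) (w t, fst (?u t), snd (?u t)) =
      (drift \<gamma> c (w t) (fst (?u t)) (snd (?u t)),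
       \<delta> / fst (?u t) ^ 3 + 2 * c * w t * drift \<gamma> c (w t) (fst (?u t)) (snd (?u t)) / fst (?u t) ^ 3)"
    by (intro trunc_field_eq) (simp, linarith+)
  with trunc_solution_deriv[OF w t, of \<delta> \<gamma> c u0 n]
  have d: "(?u has_vector_derivative (drift \<gamma> c (w t) (fst (?u t)) (snd (?u t)),
       \<delta> / fst (?u t) ^ 3 + 2 * c * w t * drift \<gamma> c (w t) (fst (?u t)) (snd (?u t)) / fst (?u t) ^ 3)) (at t within {0..T})"
    by simp
  have "0 < 1 / A" using A by simp
  then show "0 < fst (?u t)" using box[OF t] by linarith
  show "((\<lambda>t. fst (?u t)) has_real_derivative drift \<gamma> c (w t) (fst (?u t)) (snd (?u t))) (at t within {0..T})"
    using bounded_linear.has_vector_derivative[OF bounded_linear_fst d]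
    by (simp add: has_real_derivative_iff_has_vector_derivative)
  show "((\<lambda>t. snd (?u t)) has_real_derivative \<delta> / fst (?u t) ^ 3 +
      2 * c * w t * drift \<gamma> c (w t) (fst (?u t)) (snd (?u t)) / fst (?u t) ^ 3) (at t within {0..T})"
    using bounded_linear.has_vector_derivative[OF bounded_linear_snd d]
    by (simp add: has_real_derivative_iff_has_vector_derivative)
qed

text \<open>First exit argument. Up to the first time at which the boundary of the box is reached,
  the truncation is inactive, so the true equation holds there and the strict a priori bound
  contradicts the exit. The bound obtained does not depend on the level.\<close>

lemma trunc_solution_stays:
  assumes "0 < \<gamma>" "0 < x0" "0 \<le> T" and w: "continuous_on {0..} w"
  obtains A where "0 < A" and "\<And>t. t \<in> {0..T} \<Longrightarrow> \<bar>w t\<bar> \<le> A"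
    and "\<And>n t. A \<le> real (Suc n) \<Longrightarrow> t \<in> {0..T} \<Longrightarrow>
      1 / A < fst (trunc_solution \<delta> \<gamma> c w (x0, v0) n t) \<and> \<bar>snd (trunc_solution \<delta> \<gamma> c w (x0, v0) n t)\<bar> < A"
proof -
  have "compact (w ` {0..T})"
    by (intro compact_continuous_image continuous_on_subset[OF w]) auto
  from compact_imp_bounded[OF this] obtain K where K: "K > 0" "\<And>t. t \<in> {0..T} \<Longrightarrow> \<bar>w t\<bar> \<le> K"
    unfolding bounded_pos by auto
  obtain A where A: "0 < A" "1 / A < x0" "\<bar>v0\<bar> < A"
    and apriori: "\<And>T' x v t. T' \<in> {0..T} \<Longrightarrow> solves_on \<delta> \<gamma> c w T' x v \<Longrightarrow> x 0 = x0 \<Longrightarrow> v 0 = v0 \<Longrightarrow>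
      t \<in> {0..T'} \<Longrightarrow> 1 / A < x t \<and> \<bar>v t\<bar> < A"
    by (rule a_priori[where ?v0.0=v0 and \<delta>=\<delta> and c=c and w=w, OF assms(1,2,3) K(2)]) (assumption | rule that)+
  show ?thesis
  \<comment> \<open>The enlarged constant also dominates the noise, so that the clamp on
    \<open>w\<close> is inactive as well.\<close>
  proof (rule that[of "A + K"])
    show "0 < A + K" using A K by simp
    show "\<bar>w t\<bar> \<le> A + K" if "t \<in> {0..T}" for t using K(2)[OF that] A by simp
    fix n t assume n: "A + K \<le> real (Suc n)" and t: "t \<in> {0..T}"
    let ?u = "trunc_solution \<delta> \<gamma> c w (x0, v0) n"
    have cont: "continuous_on {0..T} ?u" by (rule continuous_on_subset[OF trunc_solution_eq(1)[OF w]]) auto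
    have init: "?u 0 = (x0, v0)" using trunc_solution_eq(2)[OF w, of 0] by simp
    have AK: "1 / (A + K) \<le> 1 / A" using A K by (intro divide_left_mono) auto
    \<comment> \<open>The exit set contains the boundary of the box; it is therefore closed and
      contains its infimum.\<close>
    define S where "S = {t\<in>{0..T}. fst (?u t) \<le> 1 / A} \<union> {t\<in>{0..T}. A \<le> \<bar>snd (?u t)\<bar>}"
    have "S = {}"
    proof (rule ccontr)
      assume "S \<noteq> {}"
      have "closed S" unfolding S_def
        by (intro closed_Un continuous_on_closed_Collect_le continuous_intros cont)
      moreover have bb: "bdd_below S" by (rule bdd_belowI[of _ 0]) (auto simp: S_def)
      ultimately have inf: "Inf S \<in> S" using closed_contains_Inf \<open>S \<noteq> {}\<close> by blast
      define t1 where "t1 = Inf S"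
      have t1: "t1 \<in> {0..T}" using inf by (auto simp: S_def t1_def)
      have before: "1 / A < fst (?u s) \<and> \<bar>snd (?u s)\<bar> < A" if "0 \<le> s" "s < t1" for s
      proof -
        have "s \<notin> S" using cInf_lower[OF _ bb, of s] that by (auto simp: t1_def)
        then show ?thesis using that t1 by (auto simp: S_def)
      qed
      have "t1 \<noteq> 0" using inf A init by (auto simp: S_def t1_def)
      then have "0 < t1" using t1 by simp
      have cl: "closure {0..<t1} = {0..t1}" using \<open>0 < t1\<close> by simp
      have c1: "continuous_on {0..t1} ?u" using t1 by (intro continuous_on_subset[OF cont]) auto
      have "1 / A \<le> fst (?u s)" if "s \<in> {0..t1}" for s
        by (rule continuous_ge_on_closure[of "{0..<t1}" "\<lambda>s. fst (?u s)"])
          (use that before cl less_imp_le in \<open>auto intro!: continuous_intros c1\<close>)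
      moreover have "\<bar>snd (?u s)\<bar> \<le> A" if "s \<in> {0..t1}" for s
        by (rule continuous_le_on_closure[of "{0..<t1}" "\<lambda>s. \<bar>snd (?u s)\<bar>"])
          (use that before cl less_imp_le in \<open>auto intro!: continuous_intros c1\<close>)
      ultimately have "solves_on \<delta> \<gamma> c w t1 (\<lambda>t. fst (?u t)) (\<lambda>t. snd (?u t))"
        using t1 AK A K n by (intro trunc_solves_on[OF w, of _ "A + K"]) force+
      from apriori[OF t1 this, of t1] init t1 have "1 / A < fst (?u t1) \<and> \<bar>snd (?u t1)\<bar> < A" by simp
      then show False using inf by (auto simp: S_def t1_def)
    qed
    then have "1 / A < fst (?u t) \<and> \<bar>snd (?u t)\<bar> < A" using t by (auto simp: S_def)
    then show "1 / (A + K) < fst (?u t) \<and> \<bar>snd (?u t)\<bar> < A + K" using AK K by auto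
  qed
qed

text \<open>Above level \<open>N\<close> no truncation is active on \<open>{0..T}\<close>, so every
  later solution also satisfies the equation of level \<open>N\<close>. Uniqueness for that level
  makes the sequence constant from \<open>N\<close> on.\<close>

lemma path_solution_eq_trunc:
  assumes "0 < \<gamma>" "0 < x0" "0 \<le> T" and w: "continuous_on {0..} w"
  obtains n where "solves_on \<delta> \<gamma> c w T (\<lambda>t. fst (trunc_solution \<delta> \<gamma> c w (x0, v0) n t)) (\<lambda>t. snd (trunc_solution \<delta> \<gamma> c w (x0, v0) n t))"
    and "\<And>t. t \<in> {0..T} \<Longrightarrow> (\<lambda>n. trunc_solution \<delta> \<gamma> c w (x0, v0) n t) \<longlonglongrightarrow> trunc_solution \<delta> \<gamma> c w (x0, v0) n t"
proof -
  let ?u = "trunc_solution \<delta> \<gamma> c w (x0, v0)"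
  obtain A where A: "0 < A" "\<And>t. t \<in> {0..T} \<Longrightarrow> \<bar>w t\<bar> \<le> A"
    and stays: "\<And>n t. A \<le> real (Suc n) \<Longrightarrow> t \<in> {0..T} \<Longrightarrow> 1 / A < fst (?u n t) \<and> \<bar>snd (?u n t)\<bar> < A"
    by (rule trunc_solution_stays[OF assms, where \<delta>=\<delta> and c=c and ?v0.0=v0]) (rule that)
  define N where "N = nat \<lceil>A\<rceil>"
  have N: "A \<le> real (Suc n)" if "n \<ge> N" for n using that unfolding N_def by linarith
  obtain L B where *: "lipschitz_ode (\<lambda>t u. trunc_field \<delta> \<gamma> c (real (Suc N)) (w t, u)) L B"
    using lipschitz_ode_trunc[OF _ w, of "real (Suc N)" \<delta> \<gamma> c] by (auto simp del: of_nat_Suc)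
  have field: "trunc_field \<delta> \<gamma> c (real (Suc n)) (w s, ?u n s) = trunc_field \<delta> \<gamma> c (real (Suc N)) (w s, ?u n s)"
    if n: "n \<ge> N" and s: "s \<in> {0..T}" for n s
  proof -
    have "1 / real (Suc n) \<le> 1 / A" "1 / real (Suc N) \<le> 1 / A"
      using A N[OF n] N[OF order.refl] by (auto intro!: divide_left_mono simp del: of_nat_Suc)
    with stays[OF N[OF n] s] A(2)[OF s] N[OF n] N[OF order.refl]
    have "trunc_field \<delta> \<gamma> c (real (Suc n)) (w s, fst (?u n s), snd (?u n s)) =
        trunc_field \<delta> \<gamma> c (real (Suc N)) (w s, fst (?u n s), snd (?u n s))"
      by (subst (1 2) trunc_field_eq) (auto simp del: of_nat_Suc)
    then show ?thesis by simp
  qed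
  have eq: "?u n t = ?u N t" if n: "n \<ge> N" and t: "t \<in> {0..T}" for n t
  proof (rule lipschitz_ode.unique[OF * _ _ _ _ t])
    show "continuous_on {0..} (?u n)" "continuous_on {0..} (?u N)" by (rule trunc_solution_eq(1)[OF w])+
    show "?u N s = (x0, v0) + integral {0..s} (\<lambda>s. trunc_field \<delta> \<gamma> c (real (Suc N)) (w s, ?u N s))" if "s \<in> {0..T}" for s
      using trunc_solution_eq(2)[OF w] that by simp
    show "?u n s = (x0, v0) + integral {0..s} (\<lambda>s. trunc_field \<delta> \<gamma> c (real (Suc N)) (w s, ?u n s))" if s: "s \<in> {0..T}" for s
    proof -
      have "integral {0..s} (\<lambda>s. trunc_field \<delta> \<gamma> c (real (Suc n)) (w s, ?u n s)) =
          integral {0..s} (\<lambda>s. trunc_field \<delta> \<gamma> c (real (Suc N)) (w s, ?u n s))"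
        using s by (intro integral_cong field n) auto
      then show ?thesis using trunc_solution_eq(2)[OF w, of s \<delta> \<gamma> c "(x0, v0)" n] s by simp
    qed
  qed
  show ?thesis
  proof (rule that[of N])
    show "solves_on \<delta> \<gamma> c w T (\<lambda>t. fst (?u N t)) (\<lambda>t. snd (?u N t))"
      by (rule trunc_solves_on[OF w _ A(1) N[OF order.refl]])
        (use stays[OF N[OF order.refl]] A(2) in \<open>auto intro: less_imp_le\<close>)
    show "(\<lambda>n. ?u n t) \<longlonglongrightarrow> ?u N t" if t: "t \<in> {0..T}" for t
      using eventually_ge_at_top[of N] by (intro tendsto_eventually, elim eventually_mono) (rule eq[OF _ t])
  qed
qed

lemma path_solution_tendsto:
  assumes "0 < \<gamma>" "0 < x0" "0 \<le> t" "continuous_on {0..} w"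
  shows "(\<lambda>n. trunc_solution \<delta> \<gamma> c w (x0, v0) n t) \<longlonglongrightarrow> path_solution \<delta> \<gamma> c w (x0, v0) t"
proof -
  obtain n where "solves_on \<delta> \<gamma> c w t (\<lambda>t. fst (trunc_solution \<delta> \<gamma> c w (x0, v0) n t)) (\<lambda>t. snd (trunc_solution \<delta> \<gamma> c w (x0, v0) n t))"
    and *: "\<And>s. s \<in> {0..t} \<Longrightarrow> (\<lambda>n. trunc_solution \<delta> \<gamma> c w (x0, v0) n s) \<longlonglongrightarrow> trunc_solution \<delta> \<gamma> c w (x0, v0) n s"
    by (rule path_solution_eq_trunc[OF assms, where \<delta>=\<delta> and c=c and ?v0.0=v0]) (rule that)
  from *[of t] show ?thesis using assms(3) unfolding path_solution_def by (simp add: limI)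
qed

lemma path_solution_solves:
  assumes "0 < \<gamma>" "0 < x0" "0 \<le> T" and w: "continuous_on {0..} w"
  shows "solves_on \<delta> \<gamma> c w T (\<lambda>t. fst (path_solution \<delta> \<gamma> c w (x0, v0) t)) (\<lambda>t. snd (path_solution \<delta> \<gamma> c w (x0, v0) t))"
proof -
  let ?u = "trunc_solution \<delta> \<gamma> c w (x0, v0)" and ?p = "path_solution \<delta> \<gamma> c w (x0, v0)"
  obtain n where sol: "solves_on \<delta> \<gamma> c w T (\<lambda>t. fst (?u n t)) (\<lambda>t. snd (?u n t))"
    and lim: "\<And>t. t \<in> {0..T} \<Longrightarrow> (\<lambda>n. ?u n t) \<longlonglongrightarrow> ?u n t"
    by (rule path_solution_eq_trunc[OF assms, where \<delta>=\<delta> and c=c and ?v0.0=v0]) (rule that)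
  have eq: "?p t = ?u n t" if "t \<in> {0..T}" for t
    using lim[OF that] unfolding path_solution_def by (rule limI)
  show ?thesis
    unfolding solves_on_def
  proof (intro ballI conjI)
    fix t assume t: "t \<in> {0..T}"
    note d = solves_onD[OF sol t, folded eq[OF t]]
    show "0 < fst (?p t)" by (rule d(1))
    show "((\<lambda>t. fst (?p t)) has_real_derivative drift \<gamma> c (w t) (fst (?p t)) (snd (?p t))) (at t within {0..T})"
      using d(2) eq unfolding has_field_derivative_def by (intro has_derivative_transform[OF t _ d(2)[unfolded has_field_derivative_def]]) auto
    show "((\<lambda>t. snd (?p t)) has_real_derivative \<delta> / fst (?p t) ^ 3 +
        2 * c * w t * drift \<gamma> c (w t) (fst (?p t)) (snd (?p t)) / fst (?p t) ^ 3) (at t within {0..T})"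
      using d(3) eq unfolding has_field_derivative_def by (intro has_derivative_transform[OF t _ d(3)[unfolded has_field_derivative_def]]) auto
  qed
qed

lemma path_solution_0:
  assumes "0 < \<gamma>" "0 < x0" and w: "continuous_on {0..} w"
  shows "path_solution \<delta> \<gamma> c w (x0, v0) 0 = (x0, v0)"
  using path_solution_tendsto[OF assms(1,2) order.refl w, where \<delta>=\<delta> and c=c and ?v0.0=v0] trunc_solution_eq(2)[OF w, of 0]
  by (simp add: LIMSEQ_const_iff)

section \<open>Measurable dependence of the solution on the noise path\<close>

text \<open>The measure \<open>M\<close> is arbitrary and only the values of \<open>W\<close> up to
  \<open>t\<close> are assumed measurable, so that \<open>M\<close> can be the sigma-algebra of the
  past at time \<open>t\<close>. Left-point sums up to \<open>s\<close> read times in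
  \<open>{0..s}\<close> only, which carries the induction over the iterates.\<close>

lemma measurable_trunc_solution:
  fixes W :: "real \<Rightarrow> 'b \<Rightarrow> real"
  assumes W: "\<And>s. s \<in> {0..t} \<Longrightarrow> W s \<in> borel_measurable M"
    and cont: "\<And>\<omega>. \<omega> \<in> space M \<Longrightarrow> continuous_on {0..} (\<lambda>s. W s \<omega>)"
    and u0 [measurable]: "u0 \<in> borel_measurable M" and t: "0 \<le> t"
  shows "(\<lambda>\<omega>. trunc_solution \<delta> \<gamma> c (\<lambda>s. W s \<omega>) (u0 \<omega>) n t) \<in> borel_measurable M"
proof -
  define f where "f \<omega> s u = trunc_field \<delta> \<gamma> c (real (Suc n)) (W s \<omega>, u)" for \<omega> s u
  have [measurable]: "trunc_field \<delta> \<gamma> c (real (Suc n)) \<in> borel_measurable borel"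
    by (intro borel_measurable_continuous_onI continuous_trunc_field) simp
  have ode: "\<exists>L B. lipschitz_ode (f \<omega>) L B" if "\<omega> \<in> space M" for \<omega>
    using lipschitz_ode_trunc[OF _ cont[OF that], of "real (Suc n)" \<delta> \<gamma> c] unfolding f_def[abs_def] by simp
  have "(\<lambda>\<omega>. lipschitz_ode.picard (f \<omega>) (u0 \<omega>) k s) \<in> borel_measurable M" if "s \<in> {0..t}" for k s
    using that
  proof (induction k arbitrary: s)
    case 0
    have "(\<lambda>\<omega>. lipschitz_ode.picard (f \<omega>) (u0 \<omega>) 0 s) \<in> borel_measurable M \<longleftrightarrow> u0 \<in> borel_measurable M"
      by (rule measurable_cong) (use ode lipschitz_ode.picard.simps(1) in blast)
    then show ?case using u0 by simp
  next
    case (Suc k)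
    have [measurable]: "(\<lambda>\<omega>. f \<omega> r (lipschitz_ode.picard (f \<omega>) (u0 \<omega>) k r)) \<in> borel_measurable M" if "r \<in> {0..t}" for r
    proof -
      have [measurable]: "W r \<in> borel_measurable M" by (rule W[OF that])
      have "(\<lambda>\<omega>. f \<omega> r (P \<omega>)) \<in> borel_measurable M" if [measurable]: "P \<in> borel_measurable M" for P
        unfolding f_def by measurable
      then show ?thesis using Suc.IH[OF that] .
    qed
    show ?case
    proof (rule borel_measurable_LIMSEQ_metric)
      fix \<omega> assume \<omega>: "\<omega> \<in> space M"
      obtain L B where *: "lipschitz_ode (f \<omega>) L B" using ode[OF \<omega>] by blast
      have "continuous_on {0..s} (\<lambda>r. f \<omega> r (lipschitz_ode.picard (f \<omega>) (u0 \<omega>) k r))"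
        by (rule continuous_on_subset[OF lipschitz_ode.cont[OF * lipschitz_ode.continuous_picard[OF *]]]) auto
      from tendsto_add[OF tendsto_const[of "u0 \<omega>"] riemann_sum_tendsto[OF _ this]] Suc.prems
      show "(\<lambda>i. u0 \<omega> + (\<Sum>j<2 ^ i. (s / 2 ^ i) *\<^sub>R f \<omega> (real j * s / 2 ^ i) (lipschitz_ode.picard (f \<omega>) (u0 \<omega>) k (real j * s / 2 ^ i))))
          \<longlonglongrightarrow> lipschitz_ode.picard (f \<omega>) (u0 \<omega>) (Suc k) s"
        by (simp add: lipschitz_ode.picard.simps(2)[OF *])
    next
      fix i :: nat
      have "real j * s / 2 ^ i \<in> {0..t}" if "j < 2 ^ i" for j :: nat
      proof -
        have "real j \<le> 2 ^ i" using that by (metis less_imp_le of_nat_le_iff of_nat_numeral of_nat_power)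
        then have "real j * s \<le> s * 2 ^ i" using Suc.prems by (simp add: mult.commute mult_left_mono)
        then have "real j * s / 2 ^ i \<le> s" by (simp add: divide_le_eq)
        then show ?thesis using Suc.prems by auto
      qed
      then show "(\<lambda>\<omega>. u0 \<omega> + (\<Sum>j<2 ^ i. (s / 2 ^ i) *\<^sub>R f \<omega> (real j * s / 2 ^ i) (lipschitz_ode.picard (f \<omega>) (u0 \<omega>) k (real j * s / 2 ^ i))))
          \<in> borel_measurable M"
        by (intro borel_measurable_add borel_measurable_sum borel_measurable_scaleR) auto
    qed
  qed
  then show ?thesis
  proof (rule borel_measurable_LIMSEQ_metric)
    fix \<omega> assume \<omega>: "\<omega> \<in> space M"
    obtain L B where *: "lipschitz_ode (f \<omega>) L B" using ode[OF \<omega>] by blast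
    show "(\<lambda>k. lipschitz_ode.picard (f \<omega>) (u0 \<omega>) k t) \<longlonglongrightarrow> trunc_solution \<delta> \<gamma> c (\<lambda>s. W s \<omega>) (u0 \<omega>) n t"
      using lipschitz_ode.picard_tendsto[OF * t] unfolding trunc_solution_def f_def .
  qed (use t in simp)
qed

lemma measurable_path_solution:
  fixes W :: "real \<Rightarrow> 'b \<Rightarrow> real"
  assumes "\<And>s. s \<in> {0..t} \<Longrightarrow> W s \<in> borel_measurable M"
    and cont: "\<And>\<omega>. \<omega> \<in> space M \<Longrightarrow> continuous_on {0..} (\<lambda>s. W s \<omega>)"
    and [measurable]: "x0 \<in> borel_measurable M" "v0 \<in> borel_measurable M"
    and "0 \<le> t" "0 < \<gamma>" and pos: "\<And>\<omega>. \<omega> \<in> space M \<Longrightarrow> 0 < x0 \<omega>"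
  shows "(\<lambda>\<omega>. path_solution \<delta> \<gamma> c (\<lambda>s. W s \<omega>) (x0 \<omega>, v0 \<omega>) t) \<in> borel_measurable M"
proof (rule borel_measurable_LIMSEQ_metric)
  show "(\<lambda>\<omega>. trunc_solution \<delta> \<gamma> c (\<lambda>s. W s \<omega>) (x0 \<omega>, v0 \<omega>) n t) \<in> borel_measurable M" for n
    by (rule measurable_trunc_solution[OF assms(1,2) _ \<open>0 \<le> t\<close>]) measurable
qed (rule path_solution_tendsto[OF \<open>0 < \<gamma>\<close> pos \<open>0 \<le> t\<close> cont])

section \<open>The stochastic differential equation\<close>

lemma LBINT_eq_integral:
  fixes f :: "real \<Rightarrow> real"
  assumes "0 \<le> t" "continuous_on {0..t} f"
  shows "(LBINT s=0..t. f s) = integral {0..t} f"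
  using interval_integral_eq_integral[OF assms(1) borel_integrable_atLeastAtMost'[OF assms(2)]]
  by (simp add: zero_ereal_def)

text \<open>The indicators of the deviation events vanish eventually at each point, so their
  integrals tend to 0 by dominated convergence.\<close>

lemma (in prob_space) pointwise_limit_in_probability:
  fixes X :: "nat \<Rightarrow> 'a \<Rightarrow> real"
  assumes [measurable]: "\<And>n. X n \<in> borel_measurable M" "Y \<in> borel_measurable M"
    and lim: "\<And>\<omega>. \<omega> \<in> space M \<Longrightarrow> (\<lambda>n. X n \<omega>) \<longlonglongrightarrow> Y \<omega>" and "0 < e"
  shows "(\<lambda>n. prob {\<omega>\<in>space M. \<bar>X n \<omega> - Y \<omega>\<bar> > e}) \<longlonglongrightarrow> 0"
proof -
  let ?A = "\<lambda>n. {\<omega>\<in>space M. \<bar>X n \<omega> - Y \<omega>\<bar> > e}"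
  have "(\<lambda>n. \<integral>\<omega>. indicator (?A n) \<omega> \<partial>M) \<longlonglongrightarrow> (\<integral>\<omega>. 0 \<partial>M :: real)"
  proof (rule integral_dominated_convergence[where w="\<lambda>_. 1"])
    show "AE \<omega> in M. (\<lambda>n. indicator (?A n) \<omega> :: real) \<longlonglongrightarrow> 0"
    proof (intro AE_I2 tendsto_eventually)
      fix \<omega> assume "\<omega> \<in> space M"
      from tendstoD[OF lim[OF this] \<open>0 < e\<close>]
      show "\<forall>\<^sub>F n in sequentially. indicator (?A n) \<omega> = (0 :: real)"
        by eventually_elim (auto simp: dist_real_def)
    qed
  qed auto
  then show ?thesis by simp
qed

section \<open>The integral equations along one fixed noise path\<close>

context
  fixes \<delta> \<gamma> c :: real and w x v y I :: "real \<Rightarrow> real"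
  assumes w: "continuous_on {0..} w"
    and sol: "\<And>T. 0 \<le> T \<Longrightarrow> solves_on \<delta> \<gamma> c w T x v"
    and y_def: "\<And>t. y t = drift \<gamma> c (w t) (x t) (v t)"
    and I_def: "\<And>t. I t = w t / (x t)\<^sup>2 - w 0 / (x 0)\<^sup>2 + integral {0..t} (\<lambda>s. 2 * w s * y s / x s ^ 3)"
begin

lemma solution_pos: "0 \<le> t \<Longrightarrow> 0 < x t"
  using solves_onD(1)[OF sol, of t t] by simp

lemma solution_continuous: "continuous_on {0..} x" "continuous_on {0..} v"
  using solves_on_continuous[OF sol] by (auto intro!: continuous_on_halfline)

lemma solution_continuous_y: "continuous_on {0..} y"
proof -
  have "continuous_on {0..} (\<lambda>t. v t + \<gamma> / 3 / x t ^ 3 + c * w t / (x t)\<^sup>2)"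
    by (intro continuous_intros w solution_continuous) (use solution_pos in force)+
  then show ?thesis by (simp add: y_def drift_def cong: continuous_on_cong)
qed

lemma solution_continuous_div:
  assumes "continuous_on {0..} f"
  shows "continuous_on {0..t} (\<lambda>s. f s / x s ^ k)"
  by (intro continuous_intros continuous_on_subset[OF assms] continuous_on_subset[OF solution_continuous(1)])
    (use solution_pos in force)+

lemma solution_has_integral:
  assumes "\<And>s. s \<in> {0..t} \<Longrightarrow> (f has_real_derivative g s) (at s within {0..t})" "0 \<le> t"
  shows "integral {0..t} g = f t - f 0"
  using assms
  by (intro integral_unique fundamental_theorem_of_calculus)
    (auto simp flip: has_real_derivative_iff_has_vector_derivative)

lemma solution_deriv:
  assumes "s \<in> {0..t}"
  shows "(x has_real_derivative y s) (at s within {0..t})"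
    "(v has_real_derivative \<delta> / x s ^ 3 + 2 * c * w s * y s / x s ^ 3) (at s within {0..t})"
    "((\<lambda>s. 1 / (x s)\<^sup>2) has_real_derivative - 2 * y s / x s ^ 3) (at s within {0..t})"
    "((\<lambda>s. \<gamma> / 3 / x s ^ 3) has_real_derivative - \<gamma> * (y s / x s ^ 4)) (at s within {0..t})"
proof -
  note d = solves_onD[OF sol assms, folded y_def]
  have t: "0 \<le> t" using assms by auto
  show x: "(x has_real_derivative y s) (at s within {0..t})"
    and "(v has_real_derivative \<delta> / x s ^ 3 + 2 * c * w s * y s / x s ^ 3) (at s within {0..t})"
    using d(2,3)[OF t] by auto
  have pos: "0 < x s" by (rule d(1)[OF t])
  show "((\<lambda>s. 1 / (x s)\<^sup>2) has_real_derivative - 2 * y s / x s ^ 3) (at s within {0..t})"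
    using pos by (auto intro!: derivative_eq_intros x simp: field_simps eval_nat_numeral)
  show "((\<lambda>s. \<gamma> / 3 / x s ^ 3) has_real_derivative - \<gamma> * (y s / x s ^ 4)) (at s within {0..t})"
    using pos by (auto intro!: derivative_eq_intros x simp: field_simps eval_nat_numeral)
qed

lemma solution_position:
  assumes t: "0 \<le> t"
  shows "x t = x 0 + (LBINT s=0..t. y s)"
proof -
  have "integral {0..t} y = x t - x 0"
    using t by (intro solution_has_integral solution_deriv(1))
  moreover have "continuous_on {0..t} y"
    by (rule continuous_on_subset[OF solution_continuous_y]) auto
  ultimately show ?thesis using LBINT_eq_integral[OF t] by simp
qed

text \<open>The increment of \<open>y\<close> splits according to \<open>drift\<close>: the term in
  \<open>\<gamma>\<close> yields the friction integral, and the integral of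
  \<open>2 * c * w * y / x ^ 3\<close> from \<open>v\<close> joins the boundary terms of
  \<open>c * w / x^2\<close> to form \<open>c * I t\<close>.\<close>

lemma solution_velocity:
  assumes t: "0 \<le> t"
  shows "y t = y 0 + \<delta> * (LBINT s=0..t. 1 / x s ^ 3) - \<gamma> * (LBINT s=0..t. y s / x s ^ 4) + c * I t"
proof -
  have c3: "continuous_on {0..t} (\<lambda>s. 1 / x s ^ 3)" and c4: "continuous_on {0..t} (\<lambda>s. y s / x s ^ 4)"
    and cw: "continuous_on {0..t} (\<lambda>s. 2 * w s * y s / x s ^ 3)"
    by (intro solution_continuous_div continuous_intros w solution_continuous_y)+
  have int: "(\<lambda>s. 1 / x s ^ 3) integrable_on {0..t}" "(\<lambda>s. y s / x s ^ 4) integrable_on {0..t}"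
    "(\<lambda>s. 2 * w s * y s / x s ^ 3) integrable_on {0..t}"
    by (intro integrable_continuous_real c3 c4 cw)+
  have "v t - v 0 = integral {0..t} (\<lambda>s. \<delta> / x s ^ 3 + 2 * c * w s * y s / x s ^ 3)"
    using solution_has_integral[OF solution_deriv(2) t] by simp
  also have "\<dots> = integral {0..t} (\<lambda>s. \<delta> * (1 / x s ^ 3) + c * (2 * w s * y s / x s ^ 3))"
    by (simp add: mult_ac)
  also have "\<dots> = \<delta> * integral {0..t} (\<lambda>s. 1 / x s ^ 3) + c * integral {0..t} (\<lambda>s. 2 * w s * y s / x s ^ 3)"
    using integral_add[OF integrable_on_mult_right[OF int(1), of \<delta>] integrable_on_mult_right[OF int(3), of c]]
    by (simp only: integral_mult_right)
  finally have v: "v t - v 0 = \<dots>" .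
  have "integral {0..t} (\<lambda>s. - \<gamma> * (y s / x s ^ 4)) = \<gamma> / 3 / x t ^ 3 - \<gamma> / 3 / x 0 ^ 3"
    by (rule solution_has_integral[OF solution_deriv(4) t])
  then have g: "\<gamma> / 3 / x t ^ 3 - \<gamma> / 3 / x 0 ^ 3 = - \<gamma> * integral {0..t} (\<lambda>s. y s / x s ^ 4)"
    by (simp only: integral_mult_right)
  have "y t - y 0 = (v t - v 0) + (\<gamma> / 3 / x t ^ 3 - \<gamma> / 3 / x 0 ^ 3) + c * (w t / (x t)\<^sup>2 - w 0 / (x 0)\<^sup>2)"
    by (simp add: y_def drift_def algebra_simps)
  also have "\<dots> = \<delta> * integral {0..t} (\<lambda>s. 1 / x s ^ 3) - \<gamma> * integral {0..t} (\<lambda>s. y s / x s ^ 4) + c * I t"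
    unfolding v g I_def by (simp add: algebra_simps)
  finally show ?thesis
    unfolding LBINT_eq_integral[OF t c3] LBINT_eq_integral[OF t c4] by simp
qed

lemma solution_continuous_I: "continuous_on {0..} I"
proof -
  have "continuous_on {0..} (\<lambda>t. w t / (x t)\<^sup>2 - w 0 / (x 0)\<^sup>2 + integral {0..t} (\<lambda>s. 2 * w s * y s / x s ^ 3))"
  proof (rule continuous_on_halfline)
    fix T :: real assume "0 < T"
    have "continuous_on {0..T} (\<lambda>s. 2 * w s * y s / x s ^ 3)"
      by (intro solution_continuous_div continuous_intros w solution_continuous_y)
    then have "continuous_on {0..T} (\<lambda>t. integral {0..t} (\<lambda>s. 2 * w s * y s / x s ^ 3))"
      by (intro indefinite_integral_continuous_1 integrable_continuous_real)
    moreover have "continuous_on {0..T} (\<lambda>t. w t / (x t)\<^sup>2)"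
      by (rule solution_continuous_div[OF w])
    ultimately show "continuous_on {0..T} (\<lambda>t. w t / (x t)\<^sup>2 - w 0 / (x 0)\<^sup>2 + integral {0..t} (\<lambda>s. 2 * w s * y s / x s ^ 3))"
      by (intro continuous_on_add continuous_on_diff continuous_on_const)
  qed
  then show ?thesis by (simp add: I_def[abs_def])
qed

text \<open>The integrand \<open>1 / x^2\<close> is continuously differentiable in time, so its
  left-point sums converge along the path itself; convergence in probability then follows from
  convergence at every outcome.\<close>

lemma solution_left_sums:
  assumes t: "0 \<le> t"
  shows "(\<lambda>n. \<Sum>k<2 ^ n. 1 / (x (real k * t / 2 ^ n))\<^sup>2 * (w (real (Suc k) * t / 2 ^ n) - w (real k * t / 2 ^ n)))
    \<longlonglongrightarrow> I t"
proof -
  have "continuous_on {0..t} (\<lambda>s. - 2 * y s / x s ^ 3)"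
    by (intro solution_continuous_div continuous_intros solution_continuous_y)
  from left_sum_tendsto[OF t continuous_on_subset[OF w] this solution_deriv(3)]
  have "(\<lambda>n. \<Sum>k<2 ^ n. 1 / (x (real k * t / 2 ^ n))\<^sup>2 * (w (real (Suc k) * t / 2 ^ n) - w (real k * t / 2 ^ n)))
    \<longlonglongrightarrow> 1 / (x t)\<^sup>2 * w t - 1 / (x 0)\<^sup>2 * w 0 - integral {0..t} (\<lambda>s. - 2 * y s / x s ^ 3 * w s)"
    by auto
  also have "integral {0..t} (\<lambda>s. - 2 * y s / x s ^ 3 * w s) = - integral {0..t} (\<lambda>s. 2 * w s * y s / x s ^ 3)"
    by (subst integral_neg[symmetric]) (simp add: mult_ac)
  finally show ?thesis by (simp add: I_def)
qed

end

theorem theorem1: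
  fixes \<delta> \<gamma> D :: real
    and m :: "(real \<times> real) measure"
  assumes "\<gamma> > 0" and "D > 0"
    and "prob_space m" and "sets m = sets borel"
    and "measure m ({0<..} \<times> UNIV) = 1"
  shows "\<exists>(M :: (real \<Rightarrow> real \<times> real \<times> real) measure) F x y W I.
    filtered_prob_space M F \<and>
    adapted_process F x \<and> adapted_process F y \<and>
    continuous_process M x \<and> continuous_process M y \<and>
    wiener_process M F W \<and>
    distr M borel (\<lambda>\<omega>. (x 0 \<omega>, y 0 \<omega>)) = m \<and>
    ito_integral_process M (\<lambda>s \<omega>. 1 / (x s \<omega>)^2) W I \<and>
    (AE \<omega> in M. \<forall>t\<ge>0.
       x t \<omega> > 0 \<and>
       x t \<omega> = x 0 \<omega> + (LBINT s=0..t. y s \<omega>) \<and>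
       y t \<omega> = y 0 \<omega> + \<delta> * (LBINT s=0..t. 1 / (x s \<omega>)^3)
                 - \<gamma> * (LBINT s=0..t. y s \<omega> / (x s \<omega>)^4)
                 + sqrt (2 * D) * I t \<omega>)"
proof -
  interpret walk_init m by (rule walk_init.intro) (fact assms)+
  define c where "c = sqrt (2 * D)"
  \<comment> \<open>The value 1 on the null event of a nonpositive initial position makes
    \<open>x0\<close> positive at every outcome, so that the pathwise theory applies without
    exceptions; the law of the initial pair is unaffected.\<close>
  define x0 where "x0 \<omega> = (if 0 < fst (snd (\<omega> 0)) then fst (snd (\<omega> 0)) else 1)"
    for \<omega> :: "real \<Rightarrow> real \<times> real \<times> real"
  \<comment> \<open>This is the substitution solved at time 0, so that \<open>y 0\<close> is exactly
    the prescribed velocity. The term with \<open>W 0\<close> is kept because \<open>W\<close>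
    starts at 0 only almost surely.\<close>
  define v0 where "v0 \<omega> = snd (snd (\<omega> 0)) - \<gamma> / 3 / x0 \<omega> ^ 3 - c * W 0 \<omega> / (x0 \<omega>)\<^sup>2"
    for \<omega> :: "real \<Rightarrow> real \<times> real \<times> real"
  define u where "u t \<omega> = path_solution \<delta> \<gamma> c (\<lambda>s. W s \<omega>) (x0 \<omega>, v0 \<omega>) t"
    for t and \<omega> :: "real \<Rightarrow> real \<times> real \<times> real"
  define x where "x t \<omega> = fst (u t \<omega>)" for t \<omega>
  define y where "y t \<omega> = drift \<gamma> c (W t \<omega>) (fst (u t \<omega>)) (snd (u t \<omega>))" for t \<omega>
  define I where "I t \<omega> = W t \<omega> / (x t \<omega>)\<^sup>2 - W 0 \<omega> / (x 0 \<omega>)\<^sup>2 +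
      integral {0..t} (\<lambda>s. 2 * W s \<omega> * y s \<omega> / x s \<omega> ^ 3)" for t \<omega>
  have x0: "0 < x0 \<omega>" for \<omega> by (simp add: x0_def)
  have sol: "solves_on \<delta> \<gamma> c (\<lambda>s. W s \<omega>) T (\<lambda>t. x t \<omega>) (\<lambda>t. snd (u t \<omega>))" if "0 \<le> T" for T \<omega>
    unfolding x_def u_def by (rule path_solution_solves[OF assms(1) x0 that continuous_W])
  have y_eq: "y t \<omega> = drift \<gamma> c (W t \<omega>) (x t \<omega>) (snd (u t \<omega>))" for t \<omega> by (simp add: y_def x_def)
  note path = continuous_W sol y_eq I_def
  have init: "x 0 \<omega> = x0 \<omega>" "y 0 \<omega> = snd (snd (\<omega> 0))" for \<omega>
    using path_solution_0[OF assms(1) x0 continuous_W] by (simp_all add: x_def y_def u_def drift_def v0_def)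
  \<comment> \<open>Stated for a general \<open>N\<close>, to be used with \<open>Filt t\<close> for
    adaptedness and with \<open>base\<close> for the measurability of the sums.\<close>
  have meas_u: "u t \<in> borel_measurable N"
    if "\<And>s. s \<in> {0..t} \<Longrightarrow> W s \<in> borel_measurable N" "(\<lambda>\<omega>. snd (\<omega> 0)) \<in> borel_measurable N" "0 \<le> t"
    for t and N :: "(real \<Rightarrow> real \<times> real \<times> real) measure"
  proof -
    have [measurable]: "W 0 \<in> borel_measurable N" "(\<lambda>\<omega>. snd (\<omega> 0)) \<in> borel_measurable N"
      using that by auto
    have [measurable]: "x0 \<in> borel_measurable N" unfolding x0_def by measurable
    have [measurable]: "v0 \<in> borel_measurable N" unfolding v0_def by measurable
    show ?thesis
      unfolding u_def by (rule measurable_path_solution[OF that(1) continuous_W _ _ that(3) assms(1) x0]) measurable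
  qed
  have "adapted_process Filt x \<and> adapted_process Filt y"
    unfolding adapted_process_def
  proof (intro conjI allI impI)
    fix t :: real assume t: "0 \<le> t"
    have [measurable]: "u t \<in> borel_measurable (Filt t)" "W t \<in> borel_measurable (Filt t)"
      using t measurable_W_Filt measurable_init_Filt by (auto intro!: meas_u)
    show "x t \<in> borel_measurable (Filt t)" "y t \<in> borel_measurable (Filt t)"
      unfolding x_def y_def drift_def by measurable
  qed
  moreover have "continuous_process base x \<and> continuous_process base y"
    unfolding continuous_process_def
    using solution_continuous(1)[OF path] solution_continuous_y[OF path] by simp
  moreover have "distr base borel (\<lambda>\<omega>. (x 0 \<omega>, y 0 \<omega>)) = m"
  proof -
    \<comment> \<open>The mass assumption on \<open>m\<close> says that the default value of
      \<open>x0\<close> is almost surely not taken, so the initial pair agrees almost surely with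
      the coordinates of law \<open>m\<close>.\<close>
    have "AE p in m. p \<in> {0<..} \<times> UNIV"
      using prob_space.AE_prob_1[OF assms(3,5)] .
    then have "AE p in distr base borel (\<lambda>\<omega>. snd (\<omega> 0)). 0 < fst p"
      unfolding distr_base_init by eventually_elim auto
    then have "AE \<omega> in base. 0 < fst (snd (\<omega> 0))"
      by (subst (asm) AE_distr_iff) auto
    then have "AE \<omega> in base. (x 0 \<omega>, y 0 \<omega>) = snd (\<omega> 0)"
      by eventually_elim (simp add: init x0_def)
    then have "distr base borel (\<lambda>\<omega>. (x 0 \<omega>, y 0 \<omega>)) = distr base borel (\<lambda>\<omega>. snd (\<omega> 0))"
      by (intro distr_cong_AE) (auto simp: init x0_def)
    then show ?thesis by (simp add: distr_base_init)
  qed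
  moreover have "ito_integral_process base (\<lambda>s \<omega>. 1 / (x s \<omega>)^2) W I"
    unfolding ito_integral_process_def
  proof (intro conjI allI impI)
    show "continuous_process base I"
      unfolding continuous_process_def using solution_continuous_I[OF path] by simp
    fix t :: real assume t: "0 \<le> t"
    have xm: "x s \<in> borel_measurable base" if "0 \<le> s" for s
    proof -
      have [measurable]: "u s \<in> borel_measurable base" by (rule meas_u[OF _ _ that]) auto
      show ?thesis unfolding x_def by measurable
    qed
    have [measurable]: "ito_sum (\<lambda>s \<omega>. 1 / (x s \<omega>)\<^sup>2) W t n \<in> borel_measurable base" for n
      unfolding ito_sum_def using t
      by (intro borel_measurable_sum borel_measurable_times borel_measurable_divide borel_measurable_power
          borel_measurable_const borel_measurable_diff measurable_W xm) auto
    have lim: "(\<lambda>n. ito_sum (\<lambda>s \<omega>. 1 / (x s \<omega>)\<^sup>2) W t n \<omega>) \<longlonglongrightarrow> I t \<omega>" for \<omega>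
      unfolding ito_sum_def by (rule solution_left_sums[OF path t])
    show I [measurable]: "I t \<in> borel_measurable base"
      by (rule borel_measurable_LIMSEQ_metric[OF _ lim]) measurable
    show "(\<lambda>n. measure base {\<omega>\<in>space base. \<bar>ito_sum (\<lambda>s \<omega>. 1 / (x s \<omega>)\<^sup>2) W t n \<omega> - I t \<omega>\<bar> > e}) \<longlonglongrightarrow> 0"
      if "0 < e" for e
      by (rule base.pointwise_limit_in_probability[OF _ I lim that]) measurable
  qed
  moreover have "AE \<omega> in base. \<forall>t\<ge>0.
       x t \<omega> > 0 \<and>
       x t \<omega> = x 0 \<omega> + (LBINT s=0..t. y s \<omega>) \<and>
       y t \<omega> = y 0 \<omega> + \<delta> * (LBINT s=0..t. 1 / (x s \<omega>)^3)
                 - \<gamma> * (LBINT s=0..t. y s \<omega> / (x s \<omega>)^4)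
                 + sqrt (2 * D) * I t \<omega>"
    using solution_pos[OF path] solution_position[OF path] solution_velocity[OF path]
    unfolding c_def[symmetric] by (intro AE_I2 allI impI conjI)
  ultimately show ?thesis
    using filtered_base wiener_W by blast
qed

end
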